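(* Let $(\mathcal Z,\mathcal I)=(\hat N,\hat I_3)/\mathbb C^\times$ be the twistor space of the quaternionic Kähler manifold $\overline N$ obtained by the HK/QK correspondence from HK data $(N,g_N,\omega_\alpha,V,f)$, $(\pi:P\to N,\eta)$. Consider the holomorphic line bundle $\mathcal L:=\hat N\times_{\mathbb C^\times}\mathbb C\to\mathcal Z$ associated to the action $x\cdot z=x^2z$ of $\mathbb C^\times$ on $\mathbb C$. Then $\hat\lambda$ descends to a holomorphic section $\lambda$ of $T^*\mathcal Z\otimes\mathcal L\to\mathcal Z$ (i.e. a holomorphic $1$-form on $\mathcal Z$ with values in $\mathcal L$), and $\lambda$ defines a holomorphic contact distribution on $\mathcal Z$ matching the canonical contact structure of the twistor space.
   Context: HK data. $(N,g_N,\omega_1,\omega_2,\omega_3)$ is a pseudo-hyperkähler manifold with a vector field $V$, time-like or space-like, with $\mathcal L_V\omega_1=-2\omega_2$, $\mathcal L_V\omega_2=2\omega_1$, $\mathcal L_V\omega_3=0$; $f:N\to\mathbb R$ is nowhere zero with $df=-\iota_V\omega_3$, and $f_3:=f-\frac12g_N(V,V)$ is nowhere zero. $\pi:P\to N$ is an $S^1$-principal bundle with connection $\eta$ such that $d\eta=\pi^*(\omega_3-\frac12d(\iota_Vg_N))$. Let $\widetilde V$ be the $\eta$-horizontal lift of $V$, $X_P$ the fundamental vector field of $P$, $V_3:=\widetilde V+f_3X_P$. On $P$ (pullbacks suppressed) put $\theta_3^P=\eta+\frac12\iota_Vg_N$, $\theta_1^P=\frac12\iota_V\omega_2$, $\theta_2^P=-\frac12\iota_V\omega_1$,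 $\theta_\alpha=f^{-1}\theta_\alpha^P$, $\theta=\theta_1i+\theta_2j+\theta_3k$. HK cone. Let $\widetilde N=\mathbb H^\times\times P$, $\varphi=dq\,q^{-1}$ the right-invariant Maurer–Cartan form of $\mathbb H^\times$, $\widetilde\theta=\varphi+q\theta q^{-1}=\widetilde\theta_0+\widetilde\theta_1i+\widetilde\theta_2j+\widetilde\theta_3k$, $\widetilde\omega_\alpha=d(|q|^2f\widetilde\theta_\alpha)$. Let $e_0,\dots,e_3$ be the right-invariant vector fields on $\mathbb H^\times$ equal to $1,i,j,k$ at $q=1$, $e_3^L$ the left-invariant one equal to $k$ at $q=1$, and $V_3^L:=e_3^L-V_3$. Let $\widetilde\pi:\widetilde N\to\hat N$ be the projection to the space of integral curves of $V_3^L$, assumed to be a Hausdorff manifold. It is known that $\hat N$ carries a pseudo-hyperkähler structure $(\hat g,\hat I_1,\hat I_2,\hat I_3)$ with Kähler forms $\hat\omega_\alpha$ satisfying $\widetilde\pi^*\hat\omega_\alpha=\widetilde\omega_\alpha$, and that it is the Swann bundle (HK cone) of the quaternionic Kähler manifold $\overline N$ obtained from the data by the HK/QK correspondence. With $q=q_0+q_1i+q_2j+q_3k$, set $z=q_0+iq_3$, $w=q_1+iq_2$. The vector field $e_3$ descends to a vector field $K$ on $\hat N$; $K^{1,0}=\frac12(K-i\hat I_3K)$ generates an $\hat I_3$-holomorphic $\mathbb C^\times$-action on $\hat N$, induced by $(z,w)\mapsto(xz,xw)$, $x\in\mathbb C^\times$, on $\widetilde N$. The twistor space is $(\mathcal Z,\mathcal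 I)=(\hat N,\hat I_3)/\mathbb C^\times$. Contact form. $\hat\varpi=\hat\omega_1+i\hat\omega_2$ is a holomorphic symplectic form on $(\hat N,\hat I_3)$. The form $\widetilde\lambda:=|q|^2f(\widetilde\theta_1+i\widetilde\theta_2)=f\big(z\,dw-w\,dz+z^2(\theta_1+i\theta_2)+w^2(\theta_1-i\theta_2)-2izw\,\theta_3\big)$ on $\widetilde N$ descends to a $1$-form $\hat\lambda$ on $\hat N$: $\widetilde\pi^*\hat\lambda=\widetilde\lambda$, $d\hat\lambda=\hat\varpi$. The canonical contact distribution of the twistor space $\mathcal Z$ is the one induced by the distribution $\mathrm{Ker}(\iota_{K^{1,0}}\hat\varpi)/K^{1,0}$ on $\hat N$. *)

theory Defs
  imports "HOL-Analysis.Analysis"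
begin

section \<open>Smooth manifolds\<close>

text \<open>\<open>Ck_on k S F\<close> is meant for open \<open>S\<close>.\<close>

primrec Ck_on :: "nat \<Rightarrow> 'e::euclidean_space set \<Rightarrow> ('e \<Rightarrow> 'v::real_normed_vector) \<Rightarrow> bool" where
  "Ck_on 0 S F = continuous_on S F"
| "Ck_on (Suc k) S F =
     (\<exists>F'. (\<forall>x\<in>S. (F has_derivative F' x) (at x)) \<and> (\<forall>e. Ck_on k S (\<lambda>x. F' x e)))"

definition Cinf_on :: "'e::euclidean_space set \<Rightarrow> ('e \<Rightarrow> 'v::real_normed_vector) \<Rightarrow> bool" where
  "Cinf_on S F \<longleftrightarrow> (\<forall>k. Ck_on k S F)"

record ('a, 'e) mfd =
  mtop :: "'a topology"
  atlas :: "('a set \<times> ('a \<Rightarrow> 'e)) set"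

definition pts :: "('a, 'e) mfd \<Rightarrow> 'a set" where
  "pts M = topspace (mtop M)"

definition is_chart :: "'a topology \<Rightarrow> 'a set \<times> ('a \<Rightarrow> 'e::euclidean_space) \<Rightarrow> bool" where
  "is_chart T c \<longleftrightarrow> (case c of (U, \<phi>) \<Rightarrow>
     openin T U \<and> open (\<phi> ` U) \<and>
     homeomorphic_map (subtopology T U) (top_of_set (\<phi> ` U)) \<phi>)"

definition compatible_charts ::
  "'a set \<times> ('a \<Rightarrow> 'e::euclidean_space) \<Rightarrow> 'a set \<times> ('a \<Rightarrow> 'e) \<Rightarrow> bool" where
  "compatible_charts c d \<longleftrightarrow> (case c of (U, \<phi>) \<Rightarrow> case d of (W, \<psi>) \<Rightarrow>
     Cinf_on (\<phi> ` (U \<inter> W)) (\<psi> \<circ> inv_into U \<phi>) \<and>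
     Cinf_on (\<psi> ` (U \<inter> W)) (\<phi> \<circ> inv_into W \<psi>))"

definition smooth_manifold :: "('a, 'e::euclidean_space) mfd \<Rightarrow> bool" where
  "smooth_manifold M \<longleftrightarrow>
     Hausdorff_space (mtop M) \<and> second_countable (mtop M) \<and>
     (\<Union>c\<in>atlas M. fst c) = pts M \<and>
     (\<forall>c\<in>atlas M. is_chart (mtop M) c) \<and>
     (\<forall>c\<in>atlas M. \<forall>d\<in>atlas M. compatible_charts c d)"

definition max_atlas :: "('a, 'e::euclidean_space) mfd \<Rightarrow> ('a set \<times> ('a \<Rightarrow> 'e)) set" where
  "max_atlas M = {c. is_chart (mtop M) c \<and> (\<forall>d\<in>atlas M. compatible_charts c d)}"

definition open_mfd :: "'e::euclidean_space set \<Rightarrow> ('e, 'e) mfd" where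
  "open_mfd S = \<lparr>mtop = top_of_set S, atlas = {(S, id)}\<rparr>"

definition mprod ::
  "('a, 'e) mfd \<Rightarrow> ('b, 'f) mfd \<Rightarrow> ('a \<times> 'b, 'e \<times> 'f) mfd" where
  "mprod M M' = \<lparr>mtop = prod_topology (mtop M) (mtop M'),
     atlas = {(U \<times> W, map_prod \<phi> \<psi>) | U \<phi> W \<psi>. (U, \<phi>) \<in> atlas M \<and> (W, \<psi>) \<in> atlas M'}\<rparr>"

text \<open>\<open>smooth_at M p h\<close>: the (globally typed) function \<open>h\<close> is smooth on some neighbourhood of \<open>p\<close>.\<close>

definition smooth_at ::
  "('a, 'e::euclidean_space) mfd \<Rightarrow> 'a \<Rightarrow> ('a \<Rightarrow> 'v::real_normed_vector) \<Rightarrow> bool" where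
  "smooth_at M p h \<longleftrightarrow> (\<exists>(U, \<phi>)\<in>atlas M. p \<in> U \<and>
     (\<exists>W. open W \<and> \<phi> p \<in> W \<and> W \<subseteq> \<phi> ` U \<and> Cinf_on W (h \<circ> inv_into U \<phi>)))"

definition smooth_map_on ::
  "('a, 'e::euclidean_space) mfd \<Rightarrow> 'a set \<Rightarrow> ('b, 'f::euclidean_space) mfd \<Rightarrow> ('a \<Rightarrow> 'b) \<Rightarrow> bool" where
  "smooth_map_on M U M' F \<longleftrightarrow> openin (mtop M) U \<and>
     continuous_map (subtopology (mtop M) U) (mtop M') F \<and>
     (\<forall>p\<in>U. \<forall>(W, \<psi>)\<in>atlas M'. F p \<in> W \<longrightarrow> smooth_at M p (\<psi> \<circ> F))"


section \<open>Tangent vectors and tensor fields\<close>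

text \<open>
  Tangent vectors at \<open>p\<close> are derivations on the functions that are smooth near \<open>p\<close>. The
  Leibniz rule forces such a derivation to depend only on germs: if \<open>g\<close> and \<open>h\<close> agree near
  \<open>p\<close>, then \<open>g - h = (g - h) * k\<close> for the indicator \<open>k\<close> of the complement of a
  neighbourhood of \<open>p\<close>. The value \<open>0\<close> off the smooth functions makes equality of vectors
  equality in HOL. A vector with complex values is an element of the complexified tangent space.
\<close>

type_synonym 'a tvec = "('a \<Rightarrow> real) \<Rightarrow> real"
type_synonym 'a ctvec = "('a \<Rightarrow> real) \<Rightarrow> complex"
type_synonym 'a endo = "'a \<Rightarrow> 'a tvec \<Rightarrow> 'a tvec"
type_synonym ('a, 'v) form1 = "'a \<Rightarrow> 'a tvec \<Rightarrow> 'v"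
type_synonym ('a, 'v) form2 = "'a \<Rightarrow> 'a tvec \<Rightarrow> 'a tvec \<Rightarrow> 'v"

definition tspace :: "('a, 'e::euclidean_space) mfd \<Rightarrow> 'a \<Rightarrow> 'a tvec set" where
  "tspace M p = {v.
     (\<forall>h. \<not> smooth_at M p h \<longrightarrow> v h = 0) \<and>
     (\<forall>g h. smooth_at M p g \<longrightarrow> smooth_at M p h \<longrightarrow>
        v (\<lambda>x. g x + h x) = v g + v h \<and> v (\<lambda>x. g x * h x) = v g * h p + g p * v h) \<and>
     (\<forall>c h. smooth_at M p h \<longrightarrow> v (\<lambda>x. c * h x) = c * v h)}"

definition tzero :: "'a tvec" where
  "tzero = (\<lambda>h. 0)"

definition lincomb :: "real \<Rightarrow> 'a tvec \<Rightarrow> real \<Rightarrow> 'a tvec \<Rightarrow> 'a tvec" where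
  "lincomb a u b v = (\<lambda>h. a * u h + b * v h)"

text \<open>Derivative \<open>dh(v)\<close> of a vector-valued function \<open>h\<close> along \<open>v\<close>.\<close>

definition vapply :: "'a tvec \<Rightarrow> ('a \<Rightarrow> 'v::euclidean_space) \<Rightarrow> 'v" where
  "vapply v h = (\<Sum>b\<in>Basis. v (\<lambda>x. h x \<bullet> b) *\<^sub>R b)"

text \<open>\<open>push M' F p\<close> is the differential of \<open>F\<close> at \<open>p\<close>, where \<open>M'\<close> is the target;
  it applies to real and to complexified vectors.\<close>

definition push ::
  "('b, 'f::euclidean_space) mfd \<Rightarrow> ('a \<Rightarrow> 'b) \<Rightarrow> 'a \<Rightarrow>
     (('a \<Rightarrow> real) \<Rightarrow> 'v::zero) \<Rightarrow> ('b \<Rightarrow> real) \<Rightarrow> 'v" where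
  "push M' F p v = (\<lambda>h. if smooth_at M' (F p) h then v (h \<circ> F) else 0)"

definition vfield :: "('a, 'e::euclidean_space) mfd \<Rightarrow> 'a set \<Rightarrow> ('a \<Rightarrow> 'a tvec) \<Rightarrow> bool" where
  "vfield M U X \<longleftrightarrow> openin (mtop M) U \<and>
     (\<forall>p\<in>U. X p \<in> tspace M p \<and> (\<forall>h. smooth_at M p h \<longrightarrow> smooth_at M p (\<lambda>q. X q h)))"

definition bracket ::
  "('a, 'e::euclidean_space) mfd \<Rightarrow> ('a \<Rightarrow> 'a tvec) \<Rightarrow> ('a \<Rightarrow> 'a tvec) \<Rightarrow> 'a \<Rightarrow> 'a tvec" where
  "bracket M X Y p =
     (\<lambda>h. if smooth_at M p h then X p (\<lambda>q. Y q h) - Y p (\<lambda>q. X q h) else 0)"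

definition is_form1 ::
  "('a, 'e::euclidean_space) mfd \<Rightarrow> 'a set \<Rightarrow> ('a, 'v::real_normed_vector) form1 \<Rightarrow> bool" where
  "is_form1 M U \<alpha> \<longleftrightarrow>
     (\<forall>p\<in>U. \<forall>u\<in>tspace M p. \<forall>v\<in>tspace M p. \<forall>a b.
        \<alpha> p (lincomb a u b v) = a *\<^sub>R \<alpha> p u + b *\<^sub>R \<alpha> p v) \<and>
     (\<forall>W X. W \<subseteq> U \<longrightarrow> vfield M W X \<longrightarrow> (\<forall>p\<in>W. smooth_at M p (\<lambda>q. \<alpha> q (X q))))"

definition is_tensor2 ::
  "('a, 'e::euclidean_space) mfd \<Rightarrow> ('a, 'v::real_normed_vector) form2 \<Rightarrow> bool" where
  "is_tensor2 M \<beta> \<longleftrightarrow>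
     (\<forall>p\<in>pts M. \<forall>u\<in>tspace M p. \<forall>v\<in>tspace M p. \<forall>w\<in>tspace M p. \<forall>a b.
        \<beta> p (lincomb a u b v) w = a *\<^sub>R \<beta> p u w + b *\<^sub>R \<beta> p v w \<and>
        \<beta> p w (lincomb a u b v) = a *\<^sub>R \<beta> p w u + b *\<^sub>R \<beta> p w v) \<and>
     (\<forall>W X Y. vfield M W X \<longrightarrow> vfield M W Y \<longrightarrow> (\<forall>p\<in>W. smooth_at M p (\<lambda>q. \<beta> q (X q) (Y q))))"

text \<open>\<open>has_ext_deriv M U \<alpha> \<beta>\<close> says \<open>d\<alpha> = \<beta>\<close> on \<open>U\<close>, with the normalization
  \<open>d\<alpha>(X,Y) = X(\<alpha>(Y)) - Y(\<alpha>(X)) - \<alpha>([X,Y])\<close>.\<close>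

definition has_ext_deriv ::
  "('a, 'e::euclidean_space) mfd \<Rightarrow> 'a set \<Rightarrow> ('a, 'v::euclidean_space) form1 \<Rightarrow> ('a, 'v) form2 \<Rightarrow> bool" where
  "has_ext_deriv M U \<alpha> \<beta> \<longleftrightarrow>
     (\<forall>W X Y. W \<subseteq> U \<longrightarrow> vfield M W X \<longrightarrow> vfield M W Y \<longrightarrow>
       (\<forall>p\<in>W. \<beta> p (X p) (Y p) =
          vapply (X p) (\<lambda>q. \<alpha> q (Y q)) - vapply (Y p) (\<lambda>q. \<alpha> q (X q)) - \<alpha> p (bracket M X Y p)))"

definition closed_form2 :: "('a, 'e::euclidean_space) mfd \<Rightarrow> ('a, real) form2 \<Rightarrow> bool" where
  "closed_form2 M \<beta> \<longleftrightarrow>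
     (\<forall>W X Y Z. vfield M W X \<longrightarrow> vfield M W Y \<longrightarrow> vfield M W Z \<longrightarrow>
       (\<forall>p\<in>W. X p (\<lambda>q. \<beta> q (Y q) (Z q)) + Y p (\<lambda>q. \<beta> q (Z q) (X q)) + Z p (\<lambda>q. \<beta> q (X q) (Y q))
          - \<beta> p (bracket M X Y p) (Z p) - \<beta> p (bracket M Y Z p) (X p)
          - \<beta> p (bracket M Z X p) (Y p) = 0))"

text \<open>\<open>L\<^sub>V \<beta> = \<gamma>\<close>.\<close>

definition has_lie_deriv2 ::
  "('a, 'e::euclidean_space) mfd \<Rightarrow> ('a \<Rightarrow> 'a tvec) \<Rightarrow> ('a, real) form2 \<Rightarrow> ('a, real) form2 \<Rightarrow> bool" where
  "has_lie_deriv2 M V \<beta> \<gamma> \<longleftrightarrow>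
     (\<forall>W X Y. vfield M W X \<longrightarrow> vfield M W Y \<longrightarrow>
       (\<forall>p\<in>W. \<gamma> p (X p) (Y p) =
          V p (\<lambda>q. \<beta> q (X q) (Y q)) - \<beta> p (bracket M V X p) (Y p) - \<beta> p (X p) (bracket M V Y p)))"

definition integral_curve ::
  "('a, 'e::euclidean_space) mfd \<Rightarrow> ('a \<Rightarrow> 'a tvec) \<Rightarrow> real set \<Rightarrow> (real \<Rightarrow> 'a) \<Rightarrow> bool" where
  "integral_curve M X T \<gamma> \<longleftrightarrow> open T \<and> is_interval T \<and> \<gamma> ` T \<subseteq> pts M \<and>
     (\<forall>t\<in>T. \<forall>h. smooth_at M (\<gamma> t) h \<longrightarrow>
        ((\<lambda>s. h (\<gamma> s)) has_real_derivative X (\<gamma> t) h) (at t))"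

definition submersion ::
  "('a, 'e::euclidean_space) mfd \<Rightarrow> ('b, 'f::euclidean_space) mfd \<Rightarrow> ('a \<Rightarrow> 'b) \<Rightarrow> bool" where
  "submersion M M' F \<longleftrightarrow> smooth_map_on M (pts M) M' F \<and>
     (\<forall>p\<in>pts M. push M' F p ` tspace M p = tspace M' (F p))"

text \<open>\<open>F : M \<rightarrow> M'\<close> is the projection onto the (smooth) space of integral curves of \<open>X\<close>.\<close>

definition space_of_integral_curves ::
  "('a, 'e::euclidean_space) mfd \<Rightarrow> ('a \<Rightarrow> 'a tvec) \<Rightarrow> ('b, 'f::euclidean_space) mfd \<Rightarrow>
     ('a \<Rightarrow> 'b) \<Rightarrow> bool" where
  "space_of_integral_curves M X M' F \<longleftrightarrow>
     smooth_manifold M' \<and> submersion M M' F \<and> F ` pts M = pts M' \<and>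
     (\<forall>x\<in>pts M. \<forall>y\<in>pts M. F x = F y \<longleftrightarrow>
        (\<exists>T \<gamma>. integral_curve M X T \<gamma> \<and> x \<in> \<gamma> ` T \<and> y \<in> \<gamma> ` T))"


section \<open>Complex and pseudo-hyperkaehler structures\<close>

definition almost_complex :: "('a, 'e::euclidean_space) mfd \<Rightarrow> 'a endo \<Rightarrow> bool" where
  "almost_complex M J \<longleftrightarrow>
     (\<forall>p\<in>pts M. \<forall>u\<in>tspace M p. J p u \<in> tspace M p \<and> J p (J p u) = lincomb (-1) u 0 u \<and>
        (\<forall>v\<in>tspace M p. \<forall>a b. J p (lincomb a u b v) = lincomb a (J p u) b (J p v))) \<and>
     (\<forall>W X. vfield M W X \<longrightarrow> vfield M W (\<lambda>p. J p (X p)))"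

text \<open>
  Integrability is expressed by local holomorphic coordinates, i.e. charts in which \<open>J\<close>
  becomes a constant complex structure \<open>j\<close> of the model vector space.
\<close>

definition complex_structure :: "('a, 'e::euclidean_space) mfd \<Rightarrow> 'a endo \<Rightarrow> bool" where
  "complex_structure M J \<longleftrightarrow> almost_complex M J \<and>
     (\<forall>p\<in>pts M. \<exists>(U, \<phi>)\<in>max_atlas M. \<exists>j. p \<in> U \<and> linear j \<and> (\<forall>e. j (j e) = - e) \<and>
        (\<forall>q\<in>U. \<forall>v\<in>tspace M q. vapply (J q v) \<phi> = j (vapply v \<phi>)))"

definition pseudo_riemannian :: "('a, 'e::euclidean_space) mfd \<Rightarrow> ('a, real) form2 \<Rightarrow> bool" where
  "pseudo_riemannian M g \<longleftrightarrow> is_tensor2 M g \<and>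
     (\<forall>p\<in>pts M. \<forall>u\<in>tspace M p. (\<forall>v\<in>tspace M p. g p u v = g p v u) \<and>
        ((\<forall>v\<in>tspace M p. g p u v = 0) \<longrightarrow> u = tzero))"

definition kahler_form :: "('a, real) form2 \<Rightarrow> 'a endo \<Rightarrow> ('a, real) form2" where
  "kahler_form g J = (\<lambda>p u v. g p (J p u) v)"

text \<open>Three complex structures \<open>J 1\<close>, \<open>J 2\<close>, \<open>J 3 = J 1 J 2\<close>, for each of which \<open>g\<close> is
  pseudo-Kaehler.\<close>

definition pseudo_hyperkahler ::
  "('a, 'e::euclidean_space) mfd \<Rightarrow> ('a, real) form2 \<Rightarrow> (nat \<Rightarrow> 'a endo) \<Rightarrow> bool" where
  "pseudo_hyperkahler M g J \<longleftrightarrow> smooth_manifold M \<and> pseudo_riemannian M g \<and>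
     (\<forall>a\<in>{1, 2, 3}. complex_structure M (J a) \<and> closed_form2 M (kahler_form g (J a)) \<and>
        (\<forall>p\<in>pts M. \<forall>u\<in>tspace M p. \<forall>v\<in>tspace M p. g p (J a p u) (J a p v) = g p u v)) \<and>
     (\<forall>p\<in>pts M. \<forall>u\<in>tspace M p. J 1 p (J 2 p u) = J 3 p u)"


section \<open>Holomorphic objects\<close>

definition hol_map_on ::
  "('a, 'e::euclidean_space) mfd \<Rightarrow> 'a endo \<Rightarrow> 'a set \<Rightarrow>
   ('b, 'f::euclidean_space) mfd \<Rightarrow> 'b endo \<Rightarrow> ('a \<Rightarrow> 'b) \<Rightarrow> bool" where
  "hol_map_on M J U M' J' F \<longleftrightarrow> smooth_map_on M U M' F \<and>
     (\<forall>p\<in>U. \<forall>v\<in>tspace M p. push M' F p (J p v) = J' (F p) (push M' F p v))"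

definition hol_fun_on ::
  "('a, 'e::euclidean_space) mfd \<Rightarrow> 'a endo \<Rightarrow> 'a set \<Rightarrow> ('a \<Rightarrow> complex) \<Rightarrow> bool" where
  "hol_fun_on M J U h \<longleftrightarrow> openin (mtop M) U \<and>
     (\<forall>p\<in>U. smooth_at M p h \<and> (\<forall>v\<in>tspace M p. vapply (J p v) h = \<i> * vapply v h))"

text \<open>Real holomorphic vector fields: \<open>L\<^sub>X J = 0\<close>.\<close>

definition hol_vfield ::
  "('a, 'e::euclidean_space) mfd \<Rightarrow> 'a endo \<Rightarrow> 'a set \<Rightarrow> ('a \<Rightarrow> 'a tvec) \<Rightarrow> bool" where
  "hol_vfield M J U X \<longleftrightarrow> vfield M U X \<and>
     (\<forall>W Y. W \<subseteq> U \<longrightarrow> vfield M W Y \<longrightarrow>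
        (\<forall>p\<in>W. bracket M X (\<lambda>q. J q (Y q)) p = J p (bracket M X Y p)))"

text \<open>Forms of type \<open>(1,0)\<close> that map local holomorphic vector fields to holomorphic functions.\<close>

definition hol_form1 ::
  "('a, 'e::euclidean_space) mfd \<Rightarrow> 'a endo \<Rightarrow> 'a set \<Rightarrow> ('a, complex) form1 \<Rightarrow> bool" where
  "hol_form1 M J U \<alpha> \<longleftrightarrow> openin (mtop M) U \<and> is_form1 M U \<alpha> \<and>
     (\<forall>p\<in>U. \<forall>v\<in>tspace M p. \<alpha> p (J p v) = \<i> * \<alpha> p v) \<and>
     (\<forall>W X. W \<subseteq> U \<longrightarrow> hol_vfield M J W X \<longrightarrow> hol_fun_on M J W (\<lambda>p. \<alpha> p (X p)))"

definition re_vec :: "'a ctvec \<Rightarrow> 'a tvec" where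
  "re_vec w = (\<lambda>h. Re (w h))"

definition im_vec :: "'a ctvec \<Rightarrow> 'a tvec" where
  "im_vec w = (\<lambda>h. Im (w h))"

text \<open>Complex-linear extensions of forms to the complexified tangent bundle.\<close>

definition cext1 :: "('a, complex) form1 \<Rightarrow> 'a \<Rightarrow> 'a ctvec \<Rightarrow> complex" where
  "cext1 \<alpha> p w = \<alpha> p (re_vec w) + \<i> * \<alpha> p (im_vec w)"

definition cext2 :: "('a, complex) form2 \<Rightarrow> 'a \<Rightarrow> 'a ctvec \<Rightarrow> 'a ctvec \<Rightarrow> complex" where
  "cext2 \<beta> p w x =
     \<beta> p (re_vec w) (re_vec x) + \<i> * \<beta> p (re_vec w) (im_vec x)
     + \<i> * \<beta> p (im_vec w) (re_vec x) - \<beta> p (im_vec w) (im_vec x)"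

text \<open>The holomorphic tangent space \<open>T\<^sup>1\<^sup>,\<^sup>0 = {w. J w = i w}\<close>; for \<open>w = u + i v\<close> the
  condition reads \<open>J u = -v\<close> and \<open>J v = u\<close>.\<close>

definition T10 :: "('a, 'e::euclidean_space) mfd \<Rightarrow> 'a endo \<Rightarrow> 'a \<Rightarrow> 'a ctvec set" where
  "T10 M J p = {w. re_vec w \<in> tspace M p \<and> im_vec w \<in> tspace M p \<and>
     (\<forall>h. Complex (J p (re_vec w) h) (J p (im_vec w) h) = \<i> * w h)}"

text \<open>\<open>X\<^sup>1\<^sup>,\<^sup>0 = (X - i J X) / 2\<close>.\<close>

definition part10 :: "'a endo \<Rightarrow> ('a \<Rightarrow> 'a tvec) \<Rightarrow> 'a \<Rightarrow> 'a ctvec" where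
  "part10 J X p = (\<lambda>h. (1 / 2) * (complex_of_real (X p h) - \<i> * complex_of_real (J p (X p) h)))"

text \<open>
  A holomorphic contact distribution is locally the kernel of a nowhere vanishing holomorphic
  1-form \<open>\<alpha>\<close> whose differential is nondegenerate on the kernel, i.e.
  \<open>\<alpha> \<and> (d\<alpha>)\<^sup>n\<close> vanishes nowhere in complex dimension \<open>2n+1\<close>.
\<close>

definition hol_contact_distribution ::
  "('a, 'e::euclidean_space) mfd \<Rightarrow> 'a endo \<Rightarrow> ('a \<Rightarrow> 'a ctvec set) \<Rightarrow> bool" where
  "hol_contact_distribution M J D \<longleftrightarrow>
     (\<forall>p\<in>pts M. \<exists>U \<alpha> \<beta>. p \<in> U \<and> hol_form1 M J U \<alpha> \<and> has_ext_deriv M U \<alpha> \<beta> \<and>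
        (\<forall>q\<in>U. (\<exists>w\<in>T10 M J q. cext1 \<alpha> q w \<noteq> 0) \<and>
                D q = {w\<in>T10 M J q. cext1 \<alpha> q w = 0} \<and>
                (\<forall>w\<in>D q. (\<forall>x\<in>D q. cext2 \<beta> q w x = 0) \<longrightarrow> w = (\<lambda>h. 0))))"

text \<open>
  A line bundle with total space \<open>E\<close> and projection \<open>pr\<close> is given by a family of
  trivializations \<open>(U, \<tau>)\<close>, \<open>\<tau> z : \<complex> \<rightarrow> E\<^sub>z\<close>, with holomorphic linear transition functions.
  These determine the vector space structure of the fibres and the complex structure of \<open>E\<close>.
\<close>

type_synonym ('z, 'l) triv = "'z set \<times> ('z \<Rightarrow> complex \<Rightarrow> 'l)"

definition hol_line_bundle ::
  "('z, 'e::euclidean_space) mfd \<Rightarrow> 'z endo \<Rightarrow> 'l set \<Rightarrow> ('l \<Rightarrow> 'z) \<Rightarrow> ('z, 'l) triv set \<Rightarrow> bool" where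
  "hol_line_bundle M J E pr \<T> \<longleftrightarrow>
     pr ` E \<subseteq> pts M \<and>
     (\<Union>t\<in>\<T>. fst t) = pts M \<and>
     (\<forall>(U, \<tau>)\<in>\<T>. openin (mtop M) U \<and> (\<forall>z\<in>U. bij_betw (\<tau> z) UNIV {l\<in>E. pr l = z})) \<and>
     (\<forall>(U, \<tau>)\<in>\<T>. \<forall>(U', \<tau>')\<in>\<T>. \<exists>k. hol_fun_on M J (U \<inter> U') k \<and>
        (\<forall>z\<in>U \<inter> U'. k z \<noteq> 0 \<and> (\<forall>c. \<tau>' z c = \<tau> z (k z * c))))"

text \<open>
  Holomorphic sections of \<open>T\<^sup>*M \<otimes> L\<close>, for a line bundle \<open>L\<close> with trivializations \<open>\<T>\<close>: on
  each trivialization, a holomorphic 1-form.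
\<close>

definition hol_form1_with_values ::
  "('z, 'e::euclidean_space) mfd \<Rightarrow> 'z endo \<Rightarrow> ('z, 'l) triv set \<Rightarrow>
     ('z \<Rightarrow> 'z ctvec \<Rightarrow> 'l) \<Rightarrow> bool" where
  "hol_form1_with_values M J \<T> \<Lambda> \<longleftrightarrow>
     (\<forall>(U, \<tau>)\<in>\<T>. \<exists>\<alpha>. hol_form1 M J U \<alpha> \<and>
        (\<forall>z\<in>U. \<forall>w\<in>T10 M J z. \<Lambda> z w = \<tau> z (cext1 \<alpha> z w)))"


section \<open>Actions of the multiplicative group of complex numbers\<close>

text \<open>Complex multiplication by \<open>i\<close> on the tangent spaces of open subsets of \<open>\<complex>\<close>.\<close>

definition J_complex :: "complex endo" where
  "J_complex x v = (\<lambda>h. if smooth_at (open_mfd (- {0})) x h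
     then frechet_derivative h (at x) (\<i> * vapply v id) else 0)"

text \<open>Joint holomorphy is smoothness together with holomorphy in each variable.\<close>

definition hol_Cx_action ::
  "('a, 'e::euclidean_space) mfd \<Rightarrow> 'a endo \<Rightarrow> (complex \<Rightarrow> 'a \<Rightarrow> 'a) \<Rightarrow> bool" where
  "hol_Cx_action M J act \<longleftrightarrow>
     (\<forall>y\<in>pts M. act 1 y = y \<and> (\<forall>a b. a \<noteq> 0 \<longrightarrow> b \<noteq> 0 \<longrightarrow> act (a * b) y = act a (act b y))) \<and>
     smooth_map_on (mprod (open_mfd (- {0})) M) ((- {0}) \<times> pts M) M (\<lambda>(x, y). act x y) \<and>
     (\<forall>x. x \<noteq> 0 \<longrightarrow> hol_map_on M J (pts M) M J (act x)) \<and>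
     (\<forall>y\<in>pts M. hol_map_on (open_mfd (- {0})) J_complex (- {0}) M J (\<lambda>x. act x y))"

definition hol_section ::
  "('h, 'e::euclidean_space) mfd \<Rightarrow> 'h endo \<Rightarrow> ('z, 'f::euclidean_space) mfd \<Rightarrow> 'z endo \<Rightarrow>
     ('h \<Rightarrow> 'z) \<Rightarrow> 'z set \<Rightarrow> ('z \<Rightarrow> 'h) \<Rightarrow> bool" where
  "hol_section M J Z I pz U s \<longleftrightarrow> hol_map_on Z I U M J s \<and> (\<forall>z\<in>U. pz (s z) = z)"

text \<open>
  \<open>(Z, I) = (M, J) / \<complex>\<^sup>\<times>\<close> as a complex manifold: \<open>pz\<close> is a holomorphic submersion onto \<open>Z\<close>
  whose fibres are the orbits. The local holomorphic sections, which the implicit function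
  theorem provides for any holomorphic submersion, are made part of the structure because they
  trivialize the associated bundle below.
\<close>

definition complex_quotient ::
  "('h, 'e::euclidean_space) mfd \<Rightarrow> 'h endo \<Rightarrow> (complex \<Rightarrow> 'h \<Rightarrow> 'h) \<Rightarrow>
   ('z, 'f::euclidean_space) mfd \<Rightarrow> 'z endo \<Rightarrow> ('h \<Rightarrow> 'z) \<Rightarrow> bool" where
  "complex_quotient M J act Z I pz \<longleftrightarrow>
     smooth_manifold Z \<and> complex_structure Z I \<and>
     hol_map_on M J (pts M) Z I pz \<and> submersion M Z pz \<and> pz ` pts M = pts Z \<and>
     (\<forall>y\<in>pts M. \<forall>y'\<in>pts M. pz y = pz y' \<longleftrightarrow> (\<exists>x. x \<noteq> 0 \<and> y' = act x y)) \<and>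
     (\<forall>y\<in>pts M. \<exists>U s. pz y \<in> U \<and> hol_section M J Z I pz U s \<and> s (pz y) = y)"

text \<open>
  The associated bundle \<open>M \<times>\<^bsub>\<complex>\<^sup>\<times>\<^esub> \<complex>\<close> for the action of \<open>x\<close> on \<open>\<complex>\<close> by \<open>x\<^sup>2\<close>: classes
  \<open>[y, c] = [x y, x\<^sup>2 c]\<close>, trivialized over \<open>U\<close> by \<open>c \<mapsto> [s z, c]\<close> for local holomorphic
  sections \<open>s\<close> of \<open>M \<rightarrow> Z\<close>.
\<close>

definition assoc_class ::
  "(complex \<Rightarrow> 'h \<Rightarrow> 'h) \<Rightarrow> 'h \<Rightarrow> complex \<Rightarrow> ('h \<times> complex) set" where
  "assoc_class act y c = {(act x y, x\<^sup>2 * c) | x. x \<noteq> 0}"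

definition assoc_total ::
  "('h, 'e) mfd \<Rightarrow> (complex \<Rightarrow> 'h \<Rightarrow> 'h) \<Rightarrow> ('h \<times> complex) set set" where
  "assoc_total M act = {assoc_class act y c | y c. y \<in> pts M}"

definition assoc_proj :: "('h \<Rightarrow> 'z) \<Rightarrow> ('h \<times> complex) set \<Rightarrow> 'z" where
  "assoc_proj pz l = the_elem ((pz \<circ> fst) ` l)"

definition assoc_trivs ::
  "('h, 'e::euclidean_space) mfd \<Rightarrow> 'h endo \<Rightarrow> (complex \<Rightarrow> 'h \<Rightarrow> 'h) \<Rightarrow>
   ('z, 'f::euclidean_space) mfd \<Rightarrow> 'z endo \<Rightarrow> ('h \<Rightarrow> 'z) \<Rightarrow> ('z, ('h \<times> complex) set) triv set" where
  "assoc_trivs M J act Z I pz =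
     {(U, \<lambda>z c. assoc_class act (s z) c) | U s. hol_section M J Z I pz U s}"


section \<open>HK data\<close>

definition fundamental_field ::
  "('p, 'e::euclidean_space) mfd \<Rightarrow> (complex \<Rightarrow> 'p \<Rightarrow> 'p) \<Rightarrow> 'p \<Rightarrow> 'p tvec" where
  "fundamental_field P S p =
     (\<lambda>h. if smooth_at P p h then deriv (\<lambda>t::real. h (S (cis t) p)) 0 else 0)"

text \<open>The circle acts through unit complex numbers. A local trivialization is the pair of a
  section \<open>s\<close> and the fibre coordinate \<open>\<kappa>\<close> of \<open>p = \<kappa>(p) s(\<pi>(p))\<close>.\<close>

definition circle_bundle ::
  "('p, 'ep::euclidean_space) mfd \<Rightarrow> (complex \<Rightarrow> 'p \<Rightarrow> 'p) \<Rightarrow>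
   ('n, 'en::euclidean_space) mfd \<Rightarrow> ('p \<Rightarrow> 'n) \<Rightarrow> bool" where
  "circle_bundle P S N pr \<longleftrightarrow> smooth_manifold P \<and> smooth_map_on P (pts P) N pr \<and>
     smooth_map_on (mprod (open_mfd (UNIV :: real set)) P) (UNIV \<times> pts P) P (\<lambda>(t, p). S (cis t) p) \<and>
     (\<forall>p\<in>pts P. S 1 p = p \<and>
        (\<forall>a b. norm a = 1 \<longrightarrow> norm b = 1 \<longrightarrow> S (a * b) p = S a (S b p)) \<and>
        (\<forall>a. norm a = 1 \<longrightarrow> pr (S a p) = pr p \<and> (S a p = p \<longrightarrow> a = 1))) \<and>
     (\<forall>x\<in>pts N. \<exists>U s \<kappa>. x \<in> U \<and> smooth_map_on N U P s \<and> (\<forall>u\<in>U. pr (s u) = u) \<and>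
        (\<forall>p\<in>pts P. pr p \<in> U \<longrightarrow>
           smooth_at P p \<kappa> \<and> norm (\<kappa> p :: complex) = 1 \<and> p = S (\<kappa> p) (s (pr p))))"

definition circle_connection ::
  "('p, 'ep::euclidean_space) mfd \<Rightarrow> (complex \<Rightarrow> 'p \<Rightarrow> 'p) \<Rightarrow> ('p, real) form1 \<Rightarrow> bool" where
  "circle_connection P S \<eta> \<longleftrightarrow> is_form1 P (pts P) \<eta> \<and>
     (\<forall>p\<in>pts P. \<eta> p (fundamental_field P S p) = 1 \<and>
        (\<forall>a. norm a = 1 \<longrightarrow> (\<forall>v\<in>tspace P p. \<eta> (S a p) (push P (S a) p v) = \<eta> p v)))"

record ('n, 'en, 'p, 'ep) hk =
  hkN :: "('n, 'en) mfd"
  hkg :: "('n, real) form2"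
  hkJ :: "nat \<Rightarrow> 'n endo"
  hkV :: "'n \<Rightarrow> 'n tvec"
  hkf :: "'n \<Rightarrow> real"
  hkP :: "('p, 'ep) mfd"
  hkS :: "complex \<Rightarrow> 'p \<Rightarrow> 'p"
  hkpi :: "'p \<Rightarrow> 'n"
  hketa :: "('p, real) form1"

definition hk_omega :: "('n, 'en, 'p, 'ep) hk \<Rightarrow> nat \<Rightarrow> ('n, real) form2" where
  "hk_omega D a = kahler_form (hkg D) (hkJ D a)"

definition hk_f3 :: "('n, 'en, 'p, 'ep) hk \<Rightarrow> 'n \<Rightarrow> real" where
  "hk_f3 D x = hkf D x - hkg D x (hkV D x) (hkV D x) / 2"

definition hk_data ::
  "('n, 'en::euclidean_space, 'p, 'ep::euclidean_space) hk \<Rightarrow> bool" where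
  "hk_data D \<longleftrightarrow> (let N = hkN D; g = hkg D; V = hkV D; f = hkf D; \<omega> = hk_omega D; pr = hkpi D in
     pseudo_hyperkahler N g (hkJ D) \<and>
     vfield N (pts N) V \<and>
     ((\<forall>x\<in>pts N. g x (V x) (V x) < 0) \<or> (\<forall>x\<in>pts N. g x (V x) (V x) > 0)) \<and>
     has_lie_deriv2 N V (\<omega> 1) (\<lambda>x u v. - 2 * \<omega> 2 x u v) \<and>
     has_lie_deriv2 N V (\<omega> 2) (\<lambda>x u v. 2 * \<omega> 1 x u v) \<and>
     has_lie_deriv2 N V (\<omega> 3) (\<lambda>x u v. 0) \<and>
     (\<forall>x\<in>pts N. smooth_at N x f \<and> f x \<noteq> 0 \<and> hk_f3 D x \<noteq> 0 \<and>
        (\<forall>u\<in>tspace N x. u f = - \<omega> 3 x (V x) u)) \<and>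
     circle_bundle (hkP D) (hkS D) N pr \<and>
     circle_connection (hkP D) (hkS D) (hketa D) \<and>
     (\<exists>\<beta>. has_ext_deriv N (pts N) (\<lambda>x u. g x (V x) u) \<beta> \<and>
        has_ext_deriv (hkP D) (pts (hkP D)) (hketa D)
          (\<lambda>p u v. \<omega> 3 (pr p) (push N pr p u) (push N pr p v)
                    - \<beta> (pr p) (push N pr p u) (push N pr p v) / 2)))"

definition horizontal_lift ::
  "('n, 'en::euclidean_space, 'p, 'ep::euclidean_space) hk \<Rightarrow> ('p \<Rightarrow> 'p tvec) \<Rightarrow> bool" where
  "horizontal_lift D Vt \<longleftrightarrow> vfield (hkP D) (pts (hkP D)) Vt \<and>
     (\<forall>p\<in>pts (hkP D). hketa D p (Vt p) = 0 \<and>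
        push (hkN D) (hkpi D) p (Vt p) = hkV D (hkpi D p))"

definition hk_V3 ::
  "('n, 'en, 'p, 'ep::euclidean_space) hk \<Rightarrow> ('p \<Rightarrow> 'p tvec) \<Rightarrow> 'p \<Rightarrow> 'p tvec" where
  "hk_V3 D Vt p = lincomb 1 (Vt p) (hk_f3 D (hkpi D p)) (fundamental_field (hkP D) (hkS D) p)"

definition theta_P :: "('n, 'en::euclidean_space, 'p, 'ep) hk \<Rightarrow> nat \<Rightarrow> ('p, real) form1" where
  "theta_P D a p v = (let x = hkpi D p; u = push (hkN D) (hkpi D) p v in
     if a = 1 then hk_omega D 2 x (hkV D x) u / 2
     else if a = 2 then - hk_omega D 1 x (hkV D x) u / 2
     else hketa D p v + hkg D x (hkV D x) u / 2)"

definition hk_theta :: "('n, 'en::euclidean_space, 'p, 'ep) hk \<Rightarrow> nat \<Rightarrow> ('p, real) form1" where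
  "hk_theta D a p v = theta_P D a p v / hkf D (hkpi D p)"


section \<open>The HK cone\<close>

text \<open>\<open>(a, b, c, d)\<close> stands for the quaternion \<open>a + b i + c j + d k\<close>.\<close>

type_synonym quat = "real \<times> real \<times> real \<times> real"

fun qmul :: "quat \<Rightarrow> quat \<Rightarrow> quat" where
  "qmul (a0, a1, a2, a3) (b0, b1, b2, b3) =
     (a0 * b0 - a1 * b1 - a2 * b2 - a3 * b3,
      a0 * b1 + a1 * b0 + a2 * b3 - a3 * b2,
      a0 * b2 - a1 * b3 + a2 * b0 + a3 * b1,
      a0 * b3 + a1 * b2 - a2 * b1 + a3 * b0)"

fun qconj :: "quat \<Rightarrow> quat" where
  "qconj (a, b, c, d) = (a, - b, - c, - d)"

definition qinv :: "quat \<Rightarrow> quat" where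
  "qinv q = (1 / (q \<bullet> q)) *\<^sub>R qconj q"

definition qk :: quat where
  "qk = (0, 0, 0, 1)"

fun qcomp :: "nat \<Rightarrow> quat \<Rightarrow> real" where
  "qcomp a (x0, x1, x2, x3) = (if a = 0 then x0 else if a = 1 then x1 else if a = 2 then x2 else x3)"

text \<open>The action \<open>(z, w) \<mapsto> (x z, x w)\<close> in the coordinates \<open>z = q\<^sub>0 + i q\<^sub>3\<close>,
  \<open>w = q\<^sub>1 + i q\<^sub>2\<close>.\<close>

fun q_act :: "complex \<Rightarrow> quat \<Rightarrow> quat" where
  "q_act x (q0, q1, q2, q3) =
     (let z = x * Complex q0 q3; w = x * Complex q1 q2 in (Re z, Re w, Im w, Im z))"

definition cone_mfd :: "('n, 'en, 'p, 'ep) hk \<Rightarrow> (quat \<times> 'p, quat \<times> 'ep) mfd" where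
  "cone_mfd D = mprod (open_mfd (- {0})) (hkP D)"

text \<open>The vectors of the product that are tangent to the first factor, with direction \<open>a\<close>, and
  to the second factor, respectively.\<close>

definition quat_vec ::
  "('n, 'en, 'p, 'ep::euclidean_space) hk \<Rightarrow> quat \<times> 'p \<Rightarrow> quat \<Rightarrow> (quat \<times> 'p) tvec" where
  "quat_vec D y a = (\<lambda>h. if smooth_at (cone_mfd D) y h
     then frechet_derivative (\<lambda>r. h (r, snd y)) (at (fst y)) a else 0)"

definition P_vec ::
  "('n, 'en, 'p, 'ep::euclidean_space) hk \<Rightarrow> quat \<times> 'p \<Rightarrow> 'p tvec \<Rightarrow> (quat \<times> 'p) tvec" where
  "P_vec D y u = (\<lambda>h. if smooth_at (cone_mfd D) y h then u (\<lambda>p. h (fst y, p)) else 0)"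

definition e3_field ::
  "('n, 'en, 'p, 'ep::euclidean_space) hk \<Rightarrow> quat \<times> 'p \<Rightarrow> (quat \<times> 'p) tvec" where
  "e3_field D y = quat_vec D y (qmul qk (fst y))"

definition V3L_field ::
  "('n, 'en, 'p, 'ep::euclidean_space) hk \<Rightarrow> ('p \<Rightarrow> 'p tvec) \<Rightarrow> quat \<times> 'p \<Rightarrow> (quat \<times> 'p) tvec" where
  "V3L_field D Vt y =
     lincomb 1 (quat_vec D y (qmul (fst y) qk)) (- 1) (P_vec D y (hk_V3 D Vt (snd y)))"

definition theta_cone ::
  "('n, 'en::euclidean_space, 'p, 'ep::euclidean_space) hk \<Rightarrow> (quat \<times> 'p, quat) form1" where
  "theta_cone D y v = (let q = fst y; u = push (hkP D) snd y v in
     qmul (vapply v fst) (qinv q) +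
     qmul (qmul q (0, hk_theta D 1 (snd y) u, hk_theta D 2 (snd y) u, hk_theta D 3 (snd y) u)) (qinv q))"

definition lambda_cone ::
  "('n, 'en::euclidean_space, 'p, 'ep::euclidean_space) hk \<Rightarrow> nat \<Rightarrow> (quat \<times> 'p, real) form1" where
  "lambda_cone D a y v =
     (fst y \<bullet> fst y) * hkf D (hkpi D (snd y)) * qcomp a (theta_cone D y v)"

text \<open>
  The HK cone \<open>Nh\<close> of the data \<open>D\<close>, with projection \<open>pt\<close> from \<open>\<H>\<^sup>\<times> \<times> P\<close>; the last clause is
  \<open>pt\<^sup>* \<omega>\<^sub>a = d(|q|\<^sup>2 f \<theta>\<^sub>a)\<close>.
\<close>

definition hk_cone ::
  "('n, 'en::euclidean_space, 'p, 'ep::euclidean_space) hk \<Rightarrow> ('p \<Rightarrow> 'p tvec) \<Rightarrow>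
   ('h, 'eh::euclidean_space) mfd \<Rightarrow> (quat \<times> 'p \<Rightarrow> 'h) \<Rightarrow>
   ('h, real) form2 \<Rightarrow> (nat \<Rightarrow> 'h endo) \<Rightarrow> bool" where
  "hk_cone D Vt Nh pt g J \<longleftrightarrow>
     space_of_integral_curves (cone_mfd D) (V3L_field D Vt) Nh pt \<and>
     pseudo_hyperkahler Nh g J \<and>
     (\<forall>a\<in>{1, 2, 3}. has_ext_deriv (cone_mfd D) (pts (cone_mfd D)) (lambda_cone D a)
        (\<lambda>y u v. kahler_form g (J a) (pt y) (push Nh pt y u) (push Nh pt y v)))"

definition varpi :: "('h, real) form2 \<Rightarrow> (nat \<Rightarrow> 'h endo) \<Rightarrow> ('h, complex) form2" where
  "varpi g J y u v = Complex (kahler_form g (J 1) y u v) (kahler_form g (J 2) y u v)"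


section \<open>The canonical contact distribution of the twistor space\<close>

text \<open>The image in \<open>T\<^sup>1\<^sup>,\<^sup>0 Z\<close> of the kernel of the contraction of \<open>\<omega>\<^sub>1 + i \<omega>\<^sub>2\<close> with
  \<open>K\<^sup>1\<^sup>,\<^sup>0\<close>.\<close>

definition canonical_contact ::
  "('h, 'eh::euclidean_space) mfd \<Rightarrow> ('h, real) form2 \<Rightarrow> (nat \<Rightarrow> 'h endo) \<Rightarrow> ('h \<Rightarrow> 'h tvec) \<Rightarrow>
   ('z, 'ez::euclidean_space) mfd \<Rightarrow> ('h \<Rightarrow> 'z) \<Rightarrow> 'z \<Rightarrow> 'z ctvec set" where
  "canonical_contact Nh g J K Z pz z =
     {push Z pz y w | y w. y \<in> pts Nh \<and> pz y = z \<and> w \<in> T10 Nh (J 3) y \<and>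
        cext2 (varpi g J) y (part10 (J 3) K y) w = 0}"

text \<open>The kernel of a form with values in the associated bundle; \<open>[y, 0]\<close> is the zero of the
  fibre over \<open>pz y\<close>.\<close>

definition form_kernel ::
  "('h, 'eh) mfd \<Rightarrow> (complex \<Rightarrow> 'h \<Rightarrow> 'h) \<Rightarrow> ('z, 'ez::euclidean_space) mfd \<Rightarrow> 'z endo \<Rightarrow> ('h \<Rightarrow> 'z) \<Rightarrow>
   ('z \<Rightarrow> 'z ctvec \<Rightarrow> ('h \<times> complex) set) \<Rightarrow> 'z \<Rightarrow> 'z ctvec set" where
  "form_kernel Nh act Z I pz \<Lambda> z =
     {w\<in>T10 Z I z. \<exists>y\<in>pts Nh. pz y = z \<and> \<Lambda> z w = assoc_class act y 0}"

end

theory Submission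
  imports Defs
begin

text \<open>
  On \<open>\<H>\<^sup>\<times> \<times> P\<close> the form \<open>\<lambda>\<close> is the \<open>(i, j)\<close>-part of \<open>f (dq q* + q \<theta> q*)\<close>, with \<open>q*\<close> the conjugate
  of \<open>q\<close>. Since \<open>x \<in> \<complex>\<^sup>\<times>\<close> acts by left multiplication of \<open>q\<close>, \<open>x\<^sup>*\<lambda> = x\<^sup>2 \<lambda>\<close>, and the generator \<open>K\<close>
  satisfies \<open>\<lambda>(K) = 0\<close> and \<open>\<iota>\<^sub>K d\<lambda> = 2\<i> \<lambda>\<close>. So \<open>\<lambda>\<close> is of type \<open>(1, 0)\<close>, because \<open>d\<lambda> = \<omega>\<^sub>1 + \<i> \<omega>\<^sub>2\<close> is of
  type \<open>(2, 0)\<close>, and it vanishes nowhere. The kernel of the projection to \<open>Z\<close> is spanned by \<open>K\<close> and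
  \<open>J K\<close>: otherwise the smooth map \<open>(x, z) \<mapsto> x s(z)\<close>, for a local section \<open>s\<close>, would have an open image of
  larger dimension than its domain. Hence \<open>\<lambda>\<close> vanishes on vertical vectors. Two consequences are
  that stabilizers lie in \<open>{1, -1}\<close>, so that the fibres of the associated bundle are lines, and that
  \<open>\<lambda>\<close> is determined by the forms \<open>s\<^sup>*\<lambda>\<close>, which satisfy \<open>(x s)\<^sup>*\<lambda> = x\<^sup>2 s\<^sup>*\<lambda>\<close> for functions \<open>x\<close>. They are
  holomorphic since \<open>s\<^sup>*d\<lambda>\<close> is of type \<open>(2, 0)\<close>, and quotients of them are the transition functions.
  They are contact forms because \<open>d\<lambda>\<close> is nondegenerate and \<open>\<lambda>\<close> is a multiple of \<open>\<iota>\<^sub>K d\<lambda>\<close>.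
\<close>

section \<open>Calculus of smooth functions\<close>

text \<open>Tangent vectors are bare derivations, so nothing is known about \<open>tspace\<close>
  until Hadamard's lemma identifies it with the coordinate derivations
  (\<open>tspace_eq_cvec\<close>); dimension counts, extensions of vectors to fields and comparisons
  of vectors all pass through that. The second obstacle is naturality of d: it is defined by
  brackets, and vector fields cannot in general be pushed forward along a projection or a section,
  so \<open>pullback_ext_deriv\<close> is a computation in target coordinates. No relation between
  the dimensions of \<open>Nh\<close> and \<open>Z\<close> is given. As model spaces are types, a
  comparison near a single point settles it everywhere. Computations use real vectors;
  \<open>c10\<close> carries them to vectors of type (1, 0). Two sections differ by a factor x that
  exists only pointwise and is unique only up to sign, so its regularity is out of reach. The bundle
  sees only the square of x, and this is a quotient of two forms whose differentials have type (2,
  0); holomorphy is derived from the forms, never from x.\<close>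

lemma Ck_on_SucE:
  assumes "Ck_on (Suc k) S F"
  obtains F' where "\<And>x. x \<in> S \<Longrightarrow> (F has_derivative F' x) (at x)" "\<And>e. Ck_on k S (\<lambda>x. F' x e)"
  using assms by auto

lemma Ck_on_cong:
  assumes "open S" "\<And>x. x \<in> S \<Longrightarrow> F x = G x" "Ck_on k S F"
  shows "Ck_on k S G"
proof (cases k)
  case 0
  then show ?thesis
    using assms(2,3) continuous_on_cong by fastforce
next
  case (Suc k')
  then obtain F' where F': "\<And>x. x \<in> S \<Longrightarrow> (F has_derivative F' x) (at x)"
    "\<And>e. Ck_on k' S (\<lambda>x. F' x e)"
    using assms(3) by auto
  have "(G has_derivative F' x) (at x)" if "x \<in> S" for x
    by (rule has_derivative_transform_within_open[OF F'(1)[OF that] assms(1) that assms(2)])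
  then show ?thesis
    unfolding Suc using F'(2) by auto
qed

lemma Ck_on_subset:
  assumes "Ck_on k S F" "T \<subseteq> S"
  shows "Ck_on k T F"
  using assms(1)
proof (induction k arbitrary: F)
  case 0
  then show ?case using assms(2) continuous_on_subset by auto
next
  case (Suc k)
  then show ?case using assms(2) by (simp, meson subsetD)
qed

lemma Ck_on_Suc_imp: "Ck_on (Suc k) S F \<Longrightarrow> Ck_on k S F"
proof (induction k arbitrary: F)
  case 0
  then show ?case
    by (auto intro!: continuous_at_imp_continuous_on dest: has_derivative_continuous)
next
  case (Suc k)
  then show ?case
    unfolding Ck_on.simps(2)[of "Suc k"] Ck_on.simps(2)[of k S F] by blast
qed

lemma Ck_on_const [simp]: "Ck_on k S (\<lambda>x. c)"
proof (induction k arbitrary: c)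
  case (Suc k)
  then show ?case by (auto intro!: exI[of _ "\<lambda>x e. 0"])
qed auto

lemma Ck_on_bounded_linear:
  assumes "bounded_linear L"
  shows "Ck_on k S L"
proof (cases k)
  case 0
  then show ?thesis by (simp add: assms linear_continuous_on)
next
  case (Suc k')
  then show ?thesis
    by (auto intro!: exI[of _ "\<lambda>x. L"] bounded_linear.has_derivative[OF assms]
        has_derivative_ident)
qed

lemma Ck_on_add:
  assumes "Ck_on k S F" "Ck_on k S G"
  shows "Ck_on k S (\<lambda>x. F x + G x)"
  using assms
proof (induction k arbitrary: F G)
  case 0
  then show ?case by (auto intro: continuous_on_add)
next
  case (Suc k)
  from Suc.prems(1) obtain F' where F': "\<And>x. x \<in> S \<Longrightarrow> (F has_derivative F' x) (at x)"
    "\<And>e. Ck_on k S (\<lambda>x. F' x e)"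
    by (rule Ck_on_SucE) (rule that)
  from Suc.prems(2) obtain G' where G': "\<And>x. x \<in> S \<Longrightarrow> (G has_derivative G' x) (at x)"
    "\<And>e. Ck_on k S (\<lambda>x. G' x e)"
    by (rule Ck_on_SucE) (rule that)
  show ?case
    using has_derivative_add[OF F'(1) G'(1)] Suc.IH[OF F'(2) G'(2)]
    by (auto intro!: exI[of _ "\<lambda>x e. F' x e + G' x e"])
qed

lemma Ck_on_sum:
  assumes "\<And>i. i \<in> A \<Longrightarrow> Ck_on k S (F i)"
  shows "Ck_on k S (\<lambda>x. \<Sum>i\<in>A. F i x)"
  using assms
proof (induction A rule: infinite_finite_induct)
  case (insert i A)
  then show ?case by (simp add: Ck_on_add)
qed auto

lemma Ck_on_bilinear:
  assumes "bounded_bilinear pr" "Ck_on k S F" "Ck_on k S G"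
  shows "Ck_on k S (\<lambda>x. pr (F x) (G x))"
  using assms(2,3)
proof (induction k arbitrary: F G)
  case 0
  then show ?case using bounded_bilinear.continuous_on[OF assms(1)] by auto
next
  case (Suc k)
  from Suc.prems(1) obtain F' where F': "\<And>x. x \<in> S \<Longrightarrow> (F has_derivative F' x) (at x)"
    "\<And>e. Ck_on k S (\<lambda>x. F' x e)"
    by (rule Ck_on_SucE) (rule that)
  from Suc.prems(2) obtain G' where G': "\<And>x. x \<in> S \<Longrightarrow> (G has_derivative G' x) (at x)"
    "\<And>e. Ck_on k S (\<lambda>x. G' x e)"
    by (rule Ck_on_SucE) (rule that)
  have "Ck_on k S F" "Ck_on k S G"
    using Suc.prems Ck_on_Suc_imp by blast+
  then have "Ck_on k S (\<lambda>x. pr (F x) (G' x e) + pr (F' x e) (G x))" for e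
    by (intro Ck_on_add Suc.IH F' G')
  then show ?case
    using bounded_bilinear.FDERIV[OF assms(1) F'(1) G'(1)]
    by (auto intro!: exI[of _ "\<lambda>x e. pr (F x) (G' x e) + pr (F' x e) (G x)"])
qed

lemma Ck_on_linear_comp:
  assumes "bounded_linear L" "Ck_on k S F"
  shows "Ck_on k S (\<lambda>x. L (F x))"
proof -
  \<comment> \<open>A linear map is the bilinear map \<open>c *\<^sub>R L x\<close> at
    \<open>c = 1\<close>, so the product rule already covers it.\<close>
  have "bounded_bilinear (\<lambda>c x. c *\<^sub>R L x)"
    by (rule bounded_bilinear.comp[OF bounded_bilinear_scaleR bounded_linear_ident assms(1)])
  from Ck_on_bilinear[OF this Ck_on_const assms(2), of 1] show ?thesis by simp
qed

lemma Ck_on_compose: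
  fixes F :: "'a::euclidean_space \<Rightarrow> 'b::euclidean_space"
  assumes "Ck_on k S F" "Ck_on k T G" "F ` S \<subseteq> T"
  shows "Ck_on k S (\<lambda>x. G (F x))"
  using assms
proof (induction k arbitrary: G)
  case 0
  then show ?case by (auto intro: continuous_on_compose2)
next
  case (Suc k)
  from Suc.prems(1) obtain F' where F': "\<And>x. x \<in> S \<Longrightarrow> (F has_derivative F' x) (at x)"
    "\<And>e. Ck_on k S (\<lambda>x. F' x e)"
    by (rule Ck_on_SucE) (rule that)
  from Suc.prems(2) obtain G' where G': "\<And>x. x \<in> T \<Longrightarrow> (G has_derivative G' x) (at x)"
    "\<And>e. Ck_on k T (\<lambda>x. G' x e)"
    by (rule Ck_on_SucE) (rule that)
  \<comment> \<open>The induction hypothesis speaks of \<open>G'\<close> in a fixed direction only,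
    whereas the chain rule applies it in the moving direction \<open>F' x e\<close>. Expanding that
    direction in the basis leaves fixed directions with scalar coefficients.\<close>
  define H where "H x e = (\<Sum>b\<in>Basis. (F' x e \<bullet> b) *\<^sub>R G' (F x) b)" for x e
  have lin: "H x e = G' (F x) (F' x e)" if "x \<in> S" for x e
  proof -
    have "linear (G' (F x))"
      using G'(1) that Suc.prems(3) has_derivative_linear by blast
    then have "G' (F x) (\<Sum>b\<in>Basis. (F' x e \<bullet> b) *\<^sub>R b) = H x e"
      unfolding H_def by (simp add: linear_sum linear_scale)
    then show ?thesis by (simp add: euclidean_representation)
  qed
  have "((\<lambda>x. G (F x)) has_derivative H x) (at x)" if "x \<in> S" for x
  proof -
    have "F x \<in> T" using that Suc.prems(3) by blast
    moreover have "H x = (\<lambda>e. G' (F x) (F' x e))" using lin[OF that] by blast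
    ultimately show ?thesis using has_derivative_compose[OF F'(1) G'(1)] that by simp
  qed
  moreover have "Ck_on k S (\<lambda>x. H x e)" for e
    unfolding H_def
    by (intro Ck_on_sum Ck_on_bilinear[OF bounded_bilinear_scaleR]
        Ck_on_linear_comp[OF bounded_linear_inner_left] F' Suc.IH G' Suc.prems(3)
        Ck_on_Suc_imp[OF Suc.prems(1)])
  ultimately show ?case by auto
qed

lemma Cinf_on_const [simp]: "Cinf_on S (\<lambda>x. c)"
  by (simp add: Cinf_on_def)

lemma Cinf_on_subset: "Cinf_on S F \<Longrightarrow> T \<subseteq> S \<Longrightarrow> Cinf_on T F"
  unfolding Cinf_on_def using Ck_on_subset by blast

lemma Cinf_on_cong:
  "open S \<Longrightarrow> (\<And>x. x \<in> S \<Longrightarrow> F x = G x) \<Longrightarrow> Cinf_on S F \<longleftrightarrow> Cinf_on S G"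
  unfolding Cinf_on_def using Ck_on_cong[of S F G] Ck_on_cong[of S G F] by metis

lemma Cinf_on_bounded_linear: "bounded_linear L \<Longrightarrow> Cinf_on S L"
  by (simp add: Cinf_on_def Ck_on_bounded_linear)

lemma Cinf_on_linear_comp: "bounded_linear L \<Longrightarrow> Cinf_on S F \<Longrightarrow> Cinf_on S (\<lambda>x. L (F x))"
  by (simp add: Cinf_on_def Ck_on_linear_comp)

lemma Cinf_on_add: "Cinf_on S F \<Longrightarrow> Cinf_on S G \<Longrightarrow> Cinf_on S (\<lambda>x. F x + G x)"
  by (simp add: Cinf_on_def Ck_on_add)

lemma Cinf_on_bilinear:
  "bounded_bilinear pr \<Longrightarrow> Cinf_on S F \<Longrightarrow> Cinf_on S G \<Longrightarrow> Cinf_on S (\<lambda>x. pr (F x) (G x))"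
  by (simp add: Cinf_on_def Ck_on_bilinear)

lemma Cinf_on_compose:
  fixes F :: "'a::euclidean_space \<Rightarrow> 'b::euclidean_space"
  shows "Cinf_on S F \<Longrightarrow> Cinf_on T G \<Longrightarrow> F ` S \<subseteq> T \<Longrightarrow> Cinf_on S (\<lambda>x. G (F x))"
  unfolding Cinf_on_def using Ck_on_compose by blast

lemma Cinf_on_imp_continuous_on: "Cinf_on S F \<Longrightarrow> continuous_on S F"
  by (metis Cinf_on_def Ck_on.simps(1))

lemma Cinf_on_has_derivative:
  assumes "Cinf_on S F" "x \<in> S"
  shows "(F has_derivative frechet_derivative F (at x)) (at x)"
proof -
  have "Ck_on (Suc 0) S F" using assms(1) by (auto simp: Cinf_on_def)
  then show ?thesis
    using assms(2) frechet_derivative_works by (auto simp: differentiable_def)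
qed

lemma Cinf_on_frechet_derivative:
  assumes "open S" "Cinf_on S F"
  shows "Cinf_on S (\<lambda>x. frechet_derivative F (at x) e)"
  unfolding Cinf_on_def
proof
  fix k
  have "Ck_on (Suc k) S F" using assms(2) by (simp add: Cinf_on_def)
  then obtain F' where F': "\<And>x. x \<in> S \<Longrightarrow> (F has_derivative F' x) (at x)"
    "\<And>e. Ck_on k S (\<lambda>x. F' x e)"
    by auto
  show "Ck_on k S (\<lambda>x. frechet_derivative F (at x) e)"
    by (rule Ck_on_cong[OF assms(1) _ F'(2)]) (simp add: frechet_derivative_at[OF F'(1), symmetric])
qed

lemma Ck_on_inverse: "Ck_on k (- {0}) (inverse :: complex \<Rightarrow> complex)"
proof (induction k)
  case 0
  then show ?case by (auto intro!: continuous_intros)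
next
  case (Suc k)
  have "Ck_on k (- {0}) (\<lambda>x. - (inverse x * e * inverse x))" for e :: complex
    by (intro Ck_on_linear_comp[OF bounded_linear_minus[OF bounded_linear_ident]]
        Ck_on_bilinear[OF bounded_bilinear_mult] Suc Ck_on_const)
  then show ?case
    by (auto intro!: exI[of _ "\<lambda>x h. - (inverse x * h * inverse x)"] has_derivative_inverse'
        simp: has_derivative_inverse')
qed

lemma Cinf_on_inverse: "Cinf_on (- {0}) (inverse :: complex \<Rightarrow> complex)"
  by (simp add: Cinf_on_def Ck_on_inverse)

section \<open>Integrals along segments and Hadamard's lemma\<close>

lemma param_integral_has_derivative:
  fixes G :: "'e::euclidean_space \<Rightarrow> real"
  assumes "open B" "convex B" "a \<in> B" "continuous_on {0..1} w" "Cinf_on B G" "x \<in> B"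
  shows "((\<lambda>x. integral {0..1} (\<lambda>t. w t * G (a + t *\<^sub>R (x - a)))) has_derivative
          (\<lambda>e. integral {0..1} (\<lambda>t. (w t * t) * frechet_derivative G (at (a + t *\<^sub>R (x - a))) e))) (at x)"
proof -
  \<comment> \<open>\<open>leibniz_rule\<close> wants the derivative as a continuous map into
    bounded linear maps; in finite dimension continuity can be checked in each direction, which is
    what \<open>Cinf_on\<close> provides.\<close>
  define Gb where "Gb y = Blinfun (frechet_derivative G (at y))" for y
  have Gb: "blinfun_apply (Gb y) = frechet_derivative G (at y)" if "y \<in> B" for y
    unfolding Gb_def using Cinf_on_has_derivative[OF assms(5) that]
    by (simp add: bounded_linear_Blinfun_apply has_derivative_bounded_linear)
  have seg: "a + t *\<^sub>R (y - a) \<in> B" if "y \<in> B" "t \<in> {0..1}" for y t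
  proof -
    have "a + t *\<^sub>R (y - a) = (1 - t) *\<^sub>R a + t *\<^sub>R y" by (simp add: algebra_simps)
    then show ?thesis using that assms(2,3) by (simp add: convexD_alt)
  qed
  have contGb: "continuous_on B Gb"
  proof (rule continuous_on_blinfun_componentwise)
    fix i :: 'e
    have "continuous_on B (\<lambda>x. frechet_derivative G (at x) i)"
      by (intro Cinf_on_imp_continuous_on Cinf_on_frechet_derivative assms)
    then show "continuous_on B (\<lambda>x. blinfun_apply (Gb x) i)"
      using Gb by (simp cong: continuous_on_cong)
  qed
  define fx where "fx y t = (w t * t) *\<^sub>R Gb (a + t *\<^sub>R (y - a))" for y t
  have contfx: "continuous_on (B \<times> {0..1}) (\<lambda>(y, t). fx y t)"
    unfolding fx_def case_prod_unfold
    by (intro continuous_on_scaleR continuous_on_mult continuous_on_compose2[OF assms(4)]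
        continuous_on_compose2[OF contGb] continuous_intros) (auto intro: seg)
  have int: "(\<lambda>t. w t * G (a + t *\<^sub>R (y - a))) integrable_on {0..1}" if "y \<in> B" for y
    by (intro integrable_continuous_real continuous_on_mult assms(4)
        continuous_on_compose2[OF Cinf_on_imp_continuous_on[OF assms(5)]] continuous_intros)
      (auto intro: seg that)
  have der: "((\<lambda>y. w t * G (a + t *\<^sub>R (y - a))) has_derivative blinfun_apply (fx y t)) (at y within B)"
    if "y \<in> B" "t \<in> {0..1}" for y t
  proof -
    have *: "((\<lambda>y. a + t *\<^sub>R (y - a)) has_derivative (\<lambda>e. t *\<^sub>R e)) (at y within B)"
      by (auto intro!: derivative_eq_intros)
    have "(G has_derivative Gb (a + t *\<^sub>R (y - a))) (at (a + t *\<^sub>R (y - a)))"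
      using Gb[OF seg[OF that]] Cinf_on_has_derivative[OF assms(5) seg[OF that]] by simp
    from has_derivative_compose[OF * this]
    have "((\<lambda>y. w t * G (a + t *\<^sub>R (y - a))) has_derivative (\<lambda>e. w t * Gb (a + t *\<^sub>R (y - a)) (t *\<^sub>R e))) (at y within B)"
      by (rule has_derivative_mult_right)
    moreover have "(\<lambda>e. w t * Gb (a + t *\<^sub>R (y - a)) (t *\<^sub>R e)) = blinfun_apply (fx y t)"
      by (auto simp: fx_def blinfun.bilinear_simps)
    ultimately show ?thesis by simp
  qed
  have "((\<lambda>x. integral (cbox 0 1) (\<lambda>t. w t * G (a + t *\<^sub>R (x - a)))) has_derivative
      integral (cbox 0 1) (fx x)) (at x within B)"
    by (rule leibniz_rule) (use der int contfx assms in \<open>auto simp: cbox_interval\<close>)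
  moreover have "blinfun_apply (integral (cbox 0 1) (fx x)) =
     (\<lambda>e. integral {0..1} (\<lambda>t. (w t * t) * frechet_derivative G (at (a + t *\<^sub>R (x - a))) e))"
  proof
    fix e
    have "continuous_on {0..1} (\<lambda>t. (\<lambda>(y, t). fx y t) (x, t))"
      by (rule continuous_on_compose2[OF contfx continuous_on_Pair[OF continuous_on_const continuous_on_id]])
        (use assms(6) in blast)
    then have "continuous_on {0..1} (fx x)" by simp
    then have "fx x integrable_on {0..1}"
      by (rule integrable_continuous_real)
    then have "blinfun_apply (integral {0..1} (fx x)) e = integral {0..1} (\<lambda>t. fx x t e)"
      by (rule blinfun_apply_integral)
    also have "\<dots> = integral {0..1} (\<lambda>t. (w t * t) * frechet_derivative G (at (a + t *\<^sub>R (x - a))) e)"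
      by (rule integral_cong) (simp add: fx_def blinfun.bilinear_simps Gb seg assms(6))
    finally show "blinfun_apply (integral (cbox 0 1) (fx x)) e = \<dots>" by (simp add: cbox_interval)
  qed
  ultimately show ?thesis
    unfolding at_within_open[OF assms(6,1)] cbox_interval by (simp only:)
qed

text \<open>The weight \<open>w\<close> makes the class of integrals closed under differentiation:
  each derivative only replaces \<open>w t\<close> by \<open>w t * t\<close> and \<open>G\<close> by
  a directional derivative, so the induction needs both to be arbitrary.\<close>

lemma Cinf_on_param_integral:
  fixes G :: "'e::euclidean_space \<Rightarrow> real"
  assumes "open B" "convex B" "a \<in> B" "continuous_on {0..1} w" "Cinf_on B G"
  shows "Cinf_on B (\<lambda>x. integral {0..1} (\<lambda>t. w t * G (a + t *\<^sub>R (x - a))))"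
  unfolding Cinf_on_def
proof
  fix k
  show "Ck_on k B (\<lambda>x. integral {0..1} (\<lambda>t. w t * G (a + t *\<^sub>R (x - a))))"
    using assms(4,5)
  proof (induction k arbitrary: w G)
    case 0
    have "continuous (at x) (\<lambda>x. integral {0..1} (\<lambda>t. w t * G (a + t *\<^sub>R (x - a))))" if "x \<in> B" for x
      using param_integral_has_derivative[OF assms(1-3) 0 that] has_derivative_continuous by blast
    then show ?case by (auto intro!: continuous_at_imp_continuous_on)
  next
    case (Suc k)
    have "Ck_on k B (\<lambda>x. integral {0..1} (\<lambda>t. (w t * t) * frechet_derivative G (at (a + t *\<^sub>R (x - a))) e))" for e
      by (rule Suc.IH) (auto intro!: continuous_intros Suc.prems Cinf_on_frechet_derivative assms)
    then show ?case
      using param_integral_has_derivative[OF assms(1-3) Suc.prems]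
      by (auto intro!: exI[of _ "\<lambda>x e. integral {0..1}
        (\<lambda>t. (w t * t) * frechet_derivative G (at (a + t *\<^sub>R (x - a))) e)"])
  qed
qed

text \<open>Integrate the derivative of \<open>h\<close> along the segment from \<open>a\<close> to
  \<open>x\<close>, which stays in the convex set \<open>B\<close>. Since the factors
  \<open>(x - a) \<bullet> b\<close> vanish at \<open>a\<close>, the Leibniz rule lets a derivation
  at \<open>a\<close> see only the numbers \<open>g b a\<close>, the partial derivatives of
  \<open>h\<close>.\<close>

lemma Hadamard:
  fixes h :: "'e::euclidean_space \<Rightarrow> real"
  assumes "open B" "convex B" "a \<in> B" "Cinf_on B h"
  obtains g where "\<And>b. Cinf_on B (g b)" "\<And>b. g b a = frechet_derivative h (at a) b"
    "\<And>x. x \<in> B \<Longrightarrow> h x = h a + (\<Sum>b\<in>Basis. ((x - a) \<bullet> b) * g b x)"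
proof
  define g where "g b x = integral {0..1} (\<lambda>t. 1 * frechet_derivative h (at (a + t *\<^sub>R (x - a))) b)" for b x
  show "Cinf_on B (g b)" for b
    unfolding g_def
    by (intro Cinf_on_param_integral Cinf_on_frechet_derivative assms continuous_intros)
  show "g b a = frechet_derivative h (at a) b" for b
    by (simp add: g_def)
  fix x assume x: "x \<in> B"
  have seg: "a + t *\<^sub>R (x - a) \<in> B" if "t \<in> {0..1}" for t
  proof -
    have "a + t *\<^sub>R (x - a) = (1 - t) *\<^sub>R a + t *\<^sub>R x" by (simp add: algebra_simps)
    then show ?thesis using that x assms(2,3) by (simp add: convexD_alt)
  qed
  have "((\<lambda>t. frechet_derivative h (at (a + t *\<^sub>R (x - a))) (x - a)) has_integral
      h (a + 1 *\<^sub>R (x - a)) - h (a + 0 *\<^sub>R (x - a))) {0..1}"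
  proof (rule fundamental_theorem_of_calculus)
    fix t :: real assume t: "t \<in> {0..1}"
    have *: "((\<lambda>t. a + t *\<^sub>R (x - a)) has_derivative (\<lambda>s. s *\<^sub>R (x - a))) (at t within {0..1})"
      by (auto intro!: derivative_eq_intros)
    note hd = Cinf_on_has_derivative[OF assms(4) seg[OF t]]
    show "((\<lambda>t. h (a + t *\<^sub>R (x - a))) has_vector_derivative
        frechet_derivative h (at (a + t *\<^sub>R (x - a))) (x - a)) (at t within {0..1})"
      unfolding has_vector_derivative_def
      using has_derivative_compose[OF * hd] linear_scale[OF has_derivative_linear[OF hd]]
      by simp
  qed simp
  then have "h x - h a = integral {0..1} (\<lambda>t. frechet_derivative h (at (a + t *\<^sub>R (x - a))) (x - a))"
    by (simp add: integral_unique)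
  also have "\<dots> = integral {0..1} (\<lambda>t. \<Sum>b\<in>Basis. ((x - a) \<bullet> b) * frechet_derivative h (at (a + t *\<^sub>R (x - a))) b)"
  proof (rule integral_cong)
    fix t :: real assume t: "t \<in> {0..1}"
    note l = has_derivative_linear[OF Cinf_on_has_derivative[OF assms(4) seg[OF t]]]
    have "frechet_derivative h (at (a + t *\<^sub>R (x - a))) (\<Sum>b\<in>Basis. ((x - a) \<bullet> b) *\<^sub>R b) =
      (\<Sum>b\<in>Basis. ((x - a) \<bullet> b) * frechet_derivative h (at (a + t *\<^sub>R (x - a))) b)"
      by (simp add: linear_sum[OF l] linear_scale[OF l])
    then show "frechet_derivative h (at (a + t *\<^sub>R (x - a))) (x - a) =
      (\<Sum>b\<in>Basis. ((x - a) \<bullet> b) * frechet_derivative h (at (a + t *\<^sub>R (x - a))) b)"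
      by (simp add: euclidean_representation)
  qed
  also have "\<dots> = (\<Sum>b\<in>Basis. integral {0..1} (\<lambda>t. ((x - a) \<bullet> b) * frechet_derivative h (at (a + t *\<^sub>R (x - a))) b))"
    by (intro integral_sum finite_Basis integrable_continuous_real continuous_on_mult
        continuous_on_compose2[OF Cinf_on_imp_continuous_on[OF Cinf_on_frechet_derivative[OF assms(1,4)]]]
        continuous_intros) (auto intro: seg)
  also have "\<dots> = (\<Sum>b\<in>Basis. ((x - a) \<bullet> b) * g b x)"
    by (simp add: g_def)
  finally show "h x = h a + (\<Sum>b\<in>Basis. ((x - a) \<bullet> b) * g b x)" by simp
qed


section \<open>Functions on manifolds\<close>

text \<open>A smooth manifold without the separation and countability axioms, so that closure under
  products only concerns charts.\<close>

definition smooth_atlas :: "('a, 'e::euclidean_space) mfd \<Rightarrow> bool" where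
  "smooth_atlas M \<longleftrightarrow> (\<Union>c\<in>atlas M. fst c) = pts M \<and>
     (\<forall>c\<in>atlas M. is_chart (mtop M) c) \<and>
     (\<forall>c\<in>atlas M. \<forall>d\<in>atlas M. compatible_charts c d)"

lemma smooth_manifold_imp_atlas: "smooth_manifold M \<Longrightarrow> smooth_atlas M"
  by (simp add: smooth_manifold_def smooth_atlas_def)

lemma smooth_atlasE:
  assumes "smooth_atlas M" "p \<in> pts M"
  obtains U \<phi> where "(U, \<phi>) \<in> atlas M" "p \<in> U"
  using assms unfolding smooth_atlas_def by (metis (no_types, lifting) UN_E prod.collapse)

lemma openin_pts: "openin (mtop M) U \<Longrightarrow> p \<in> U \<Longrightarrow> p \<in> pts M"
  using openin_subset by (fastforce simp: pts_def)

lemma openin_pts_self [simp]: "openin (mtop M) (pts M)"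
  by (simp add: pts_def)

locale smooth_chart =
  fixes M :: "('a, 'e::euclidean_space) mfd" and U :: "'a set" and \<phi> :: "'a \<Rightarrow> 'e"
  assumes atl: "smooth_atlas M" and chart: "(U, \<phi>) \<in> atlas M"
begin

lemma is_chart: "is_chart (mtop M) (U, \<phi>)"
  using atl chart by (auto simp: smooth_atlas_def)

lemma openin_U: "openin (mtop M) U"
  using is_chart by (simp add: is_chart_def)

lemma topspace_U: "topspace (subtopology (mtop M) U) = U"
  using openin_subset[OF openin_U] by (auto simp: topspace_subtopology)

lemma U_pts: "U \<subseteq> pts M"
  using openin_subset[OF openin_U] by (simp add: pts_def)

lemma homeo: "homeomorphic_map (subtopology (mtop M) U) (top_of_set (\<phi> ` U)) \<phi>"
  using is_chart by (simp add: is_chart_def)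

lemma open_image_U: "open (\<phi> ` U)"
  using is_chart by (simp add: is_chart_def)

lemma inj: "inj_on \<phi> U"
  using homeomorphic_imp_injective_map[OF homeo] by (simp only: topspace_U)

lemma inv_chart [simp]: "q \<in> U \<Longrightarrow> inv_into U \<phi> (\<phi> q) = q"
  by (simp add: inj)

lemma open_image:
  assumes "openin (mtop M) S" "S \<subseteq> U"
  shows "open (\<phi> ` S)"
proof -
  have "openin (subtopology (mtop M) U) S"
    using assms by (simp add: openin_open_subtopology openin_U)
  then have "openin (top_of_set (\<phi> ` U)) (\<phi> ` S)"
    using homeomorphic_imp_open_map[OF homeo] by (simp add: open_map_def)
  then show ?thesis
    using open_image_U openin_open_eq by blast
qed

lemma openin_vimage:
  assumes "open W"
  shows "openin (mtop M) {q \<in> U. \<phi> q \<in> W}"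
proof -
  have "openin (subtopology (mtop M) U) {q \<in> topspace (subtopology (mtop M) U). \<phi> q \<in> \<phi> ` U \<inter> W}"
    by (rule openin_continuous_map_preimage[OF homeomorphic_imp_continuous_map[OF homeo]])
      (use assms in \<open>auto intro: openin_open_Int\<close>)
  moreover have "{q \<in> topspace (subtopology (mtop M) U). \<phi> q \<in> \<phi> ` U \<inter> W} = {q \<in> U. \<phi> q \<in> W}"
    unfolding topspace_U by auto
  ultimately show ?thesis
    using openin_trans_full openin_U by metis
qed

lemma smooth_atI:
  assumes "p \<in> U" "open W" "\<phi> p \<in> W" "W \<subseteq> \<phi> ` U" "Cinf_on W (h \<circ> inv_into U \<phi>)"
  shows "smooth_at M p h"
  unfolding smooth_at_def using chart assms by blast

text \<open>\<open>smooth_at\<close> only provides some chart. Compatibility of charts transfers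
  smoothness to the given one, after shrinking to the part of the overlap where the known coordinate
  expression is smooth.\<close>

lemma smooth_atE:
  assumes "smooth_at M p h" "p \<in> U"
  obtains W where "open W" "\<phi> p \<in> W" "W \<subseteq> \<phi> ` U" "Cinf_on W (h \<circ> inv_into U \<phi>)"
proof -
  from assms(1) obtain U' \<psi> W' where c': "(U', \<psi>) \<in> atlas M" "p \<in> U'" "open W'" "\<psi> p \<in> W'"
    "W' \<subseteq> \<psi> ` U'" "Cinf_on W' (h \<circ> inv_into U' \<psi>)"
    unfolding smooth_at_def by auto
  interpret c': smooth_chart M U' \<psi> by unfold_locales (auto simp: atl c')
  define S where "S = U \<inter> {q \<in> U'. \<psi> q \<in> W'}"
  have S: "openin (mtop M) S"
    unfolding S_def by (intro openin_Int openin_U c'.openin_vimage c')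
  have "compatible_charts (U, \<phi>) (U', \<psi>)"
    using atl chart c'(1) unfolding smooth_atlas_def by blast
  then have "Cinf_on (\<phi> ` (U \<inter> U')) (\<psi> \<circ> inv_into U \<phi>)"
    by (simp add: compatible_charts_def)
  then have 1: "Cinf_on (\<phi> ` S) (\<psi> \<circ> inv_into U \<phi>)"
    by (rule Cinf_on_subset) (auto simp: S_def)
  have o: "open (\<phi> ` S)" by (rule open_image[OF S]) (auto simp: S_def)
  have "Cinf_on (\<phi> ` S) (\<lambda>x. (h \<circ> inv_into U' \<psi>) ((\<psi> \<circ> inv_into U \<phi>) x))"
    by (rule Cinf_on_compose[OF 1 c'(6)]) (auto simp: S_def)
  moreover have "(h \<circ> inv_into U' \<psi>) ((\<psi> \<circ> inv_into U \<phi>) x) = (h \<circ> inv_into U \<phi>) x" if "x \<in> \<phi> ` S" for x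
    using that by (auto simp: S_def)
  ultimately have "Cinf_on (\<phi> ` S) (h \<circ> inv_into U \<phi>)"
    using Cinf_on_cong[OF o] by metis
  then show thesis
    using that[OF o] assms(2) c'(2,4) by (auto simp: S_def)
qed

lemma smooth_at_comp_chart:
  assumes "p \<in> U" "open W" "\<phi> p \<in> W" "Cinf_on W g"
  shows "smooth_at M p (\<lambda>q. g (\<phi> q))"
proof (rule smooth_atI[OF assms(1), of "W \<inter> \<phi> ` U"])
  show o: "open (W \<inter> \<phi> ` U)" using assms(2) open_image_U by blast
  have "Cinf_on (W \<inter> \<phi> ` U) g" using assms(4) Cinf_on_subset by blast
  then show "Cinf_on (W \<inter> \<phi> ` U) ((\<lambda>q. g (\<phi> q)) \<circ> inv_into U \<phi>)"
    by (subst Cinf_on_cong[OF o, of _ g]) auto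
qed (use assms in auto)

lemma smooth_at_chart: "p \<in> U \<Longrightarrow> smooth_at M p \<phi>"
  using smooth_at_comp_chart[of p UNIV "\<lambda>x. x"] by (simp add: Cinf_on_bounded_linear[OF bounded_linear_ident])

end

lemma smooth_at_pts:
  assumes "smooth_atlas M" "smooth_at M p h"
  shows "p \<in> pts M"
  using assms unfolding smooth_at_def smooth_atlas_def by fastforce

lemma smooth_at_cong_imp:
  assumes "smooth_atlas M" "openin (mtop M) S" "p \<in> S" "\<And>q. q \<in> S \<Longrightarrow> g q = h q" "smooth_at M p g"
  shows "smooth_at M p h"
proof -
  obtain U \<phi> where c: "(U, \<phi>) \<in> atlas M" "p \<in> U"
    using assms(1) openin_pts[OF assms(2,3)] by (rule smooth_atlasE)
  interpret smooth_chart M U \<phi> by unfold_locales (use assms c in auto)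
  obtain W where W: "open W" "\<phi> p \<in> W" "W \<subseteq> \<phi> ` U" "Cinf_on W (g \<circ> inv_into U \<phi>)"
    using smooth_atE[OF assms(5) c(2)] by blast
  have o: "open (W \<inter> \<phi> ` (S \<inter> U))"
    using W(1) assms(2) openin_U by (intro open_Int open_image) auto
  show ?thesis
  proof (rule smooth_atI[OF c(2) o])
    have "Cinf_on (W \<inter> \<phi> ` (S \<inter> U)) (g \<circ> inv_into U \<phi>)"
      using W(4) Cinf_on_subset by blast
    then show "Cinf_on (W \<inter> \<phi> ` (S \<inter> U)) (h \<circ> inv_into U \<phi>)"
      by (subst Cinf_on_cong[OF o, of _ "g \<circ> inv_into U \<phi>"]) (auto simp: assms(4))
  qed (use c W assms in auto)
qed

lemma smooth_at_cong:
  assumes "smooth_atlas M" "openin (mtop M) S" "p \<in> S" "\<And>q. q \<in> S \<Longrightarrow> g q = h q"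
  shows "smooth_at M p g \<longleftrightarrow> smooth_at M p h"
  using smooth_at_cong_imp[OF assms(1-3), of g h] smooth_at_cong_imp[OF assms(1-3), of h g] assms(4)
  by metis

lemma smooth_at_nbhd:
  assumes "smooth_atlas M" "smooth_at M p h"
  obtains S where "openin (mtop M) S" "p \<in> S" "\<And>q. q \<in> S \<Longrightarrow> smooth_at M q h"
proof -
  obtain U \<phi> where c: "(U, \<phi>) \<in> atlas M" "p \<in> U"
    using assms(1) smooth_at_pts[OF assms] by (rule smooth_atlasE)
  interpret smooth_chart M U \<phi> by unfold_locales (use assms c in auto)
  obtain W where W: "open W" "\<phi> p \<in> W" "W \<subseteq> \<phi> ` U" "Cinf_on W (h \<circ> inv_into U \<phi>)"
    using smooth_atE[OF assms(2) c(2)] by blast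
  show thesis
    by (rule that[OF openin_vimage[OF W(1)]]) (use c W smooth_atI in auto)
qed

lemma smooth_at_const [simp]:
  assumes "smooth_atlas M" "p \<in> pts M"
  shows "smooth_at M p (\<lambda>q. c)"
proof -
  obtain U \<phi> where c: "(U, \<phi>) \<in> atlas M" "p \<in> U"
    using assms by (rule smooth_atlasE)
  interpret smooth_chart M U \<phi> by unfold_locales (use assms c in auto)
  show ?thesis
    using smooth_at_comp_chart[OF c(2) open_UNIV UNIV_I, of "\<lambda>x. c"] by simp
qed

text \<open>The common coordinate domain is found once for all pointwise operations; a unary
  operation is the case where \<open>opr\<close> ignores its second argument.\<close>

lemma smooth_at_combine:
  fixes M :: "('a, 'e::euclidean_space) mfd"
  assumes "smooth_atlas M" "smooth_at M p g" "smooth_at M p h"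
    and opr: "\<And>(S :: 'e set) F G. Cinf_on S F \<Longrightarrow> Cinf_on S G \<Longrightarrow> Cinf_on S (\<lambda>x. opr (F x) (G x))"
  shows "smooth_at M p (\<lambda>q. opr (g q) (h q))"
proof -
  obtain U \<phi> where c: "(U, \<phi>) \<in> atlas M" "p \<in> U"
    using assms(1) smooth_at_pts[OF assms(1,2)] by (rule smooth_atlasE)
  interpret smooth_chart M U \<phi> by unfold_locales (use assms c in auto)
  obtain W where W: "open W" "\<phi> p \<in> W" "W \<subseteq> \<phi> ` U" "Cinf_on W (g \<circ> inv_into U \<phi>)"
    using smooth_atE[OF assms(2) c(2)] by blast
  obtain W' where W': "open W'" "\<phi> p \<in> W'" "W' \<subseteq> \<phi> ` U" "Cinf_on W' (h \<circ> inv_into U \<phi>)"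
    using smooth_atE[OF assms(3) c(2)] by blast
  have "Cinf_on (W \<inter> W') (\<lambda>x. opr ((g \<circ> inv_into U \<phi>) x) ((h \<circ> inv_into U \<phi>) x))"
    by (intro opr Cinf_on_subset[OF W(4)] Cinf_on_subset[OF W'(4)]) auto
  then show ?thesis
    using c W W' by (intro smooth_atI[OF c(2), of "W \<inter> W'"]) (auto simp: o_def)
qed

lemma smooth_at_bilinear:
  assumes "smooth_atlas M" "bounded_bilinear pr" "smooth_at M p g" "smooth_at M p h"
  shows "smooth_at M p (\<lambda>q. pr (g q) (h q))"
  by (rule smooth_at_combine[OF assms(1,3,4) Cinf_on_bilinear[OF assms(2)]])

lemma smooth_at_add:
  assumes "smooth_atlas M" "smooth_at M p g" "smooth_at M p h"
  shows "smooth_at M p (\<lambda>q. g q + h q)"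
  by (rule smooth_at_combine[OF assms Cinf_on_add])

lemma smooth_at_linear_comp:
  assumes "smooth_atlas M" "bounded_linear L" "smooth_at M p h"
  shows "smooth_at M p (\<lambda>q. L (h q))"
  by (rule smooth_at_combine[OF assms(1,3,3), of "\<lambda>x y. L x"]) (rule Cinf_on_linear_comp[OF assms(2)])

lemma smooth_at_Cinf_comp:
  fixes h :: "'a \<Rightarrow> 'b::euclidean_space"
  assumes "smooth_atlas M" "smooth_at M p h" "open T" "h p \<in> T" "Cinf_on T g"
  shows "smooth_at M p (\<lambda>q. g (h q))"
proof -
  obtain U \<phi> where c: "(U, \<phi>) \<in> atlas M" "p \<in> U"
    using assms(1) smooth_at_pts[OF assms(1,2)] by (rule smooth_atlasE)
  interpret smooth_chart M U \<phi> by unfold_locales (use assms c in auto)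
  obtain W where W: "open W" "\<phi> p \<in> W" "W \<subseteq> \<phi> ` U" "Cinf_on W (h \<circ> inv_into U \<phi>)"
    using smooth_atE[OF assms(2) c(2)] by blast
  define W' where "W' = {x \<in> W. (h \<circ> inv_into U \<phi>) x \<in> T}"
  have o: "open W'"
    unfolding W'_def
    using continuous_openin_preimage[OF Cinf_on_imp_continuous_on[OF W(4)], of UNIV T]
      continuous_open_preimage[OF Cinf_on_imp_continuous_on[OF W(4)] W(1) assms(3)]
    by (simp add: vimage_def Int_def)
  have "Cinf_on W' (\<lambda>x. g ((h \<circ> inv_into U \<phi>) x))"
    by (intro Cinf_on_compose[OF Cinf_on_subset[OF W(4)] assms(5)]) (auto simp: W'_def)
  then show ?thesis
    using c W o assms(4) by (intro smooth_atI[OF c(2), of W']) (auto simp: o_def W'_def)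
qed

lemma smooth_at_sum:
  assumes "smooth_atlas M" "p \<in> pts M" "\<And>i. i \<in> A \<Longrightarrow> smooth_at M p (h i)"
  shows "smooth_at M p (\<lambda>q. \<Sum>i\<in>A. h i q)"
  using assms(3)
proof (induction A rule: infinite_finite_induct)
  case (insert i A)
  then show ?case by (simp add: smooth_at_add[OF assms(1)])
qed (use assms in auto)

lemma smooth_at_componentwise:
  fixes h :: "'a \<Rightarrow> 'b::euclidean_space"
  assumes "smooth_atlas M" "p \<in> pts M" "\<And>b. b \<in> Basis \<Longrightarrow> smooth_at M p (\<lambda>q. h q \<bullet> b)"
  shows "smooth_at M p h"
proof -
  have "smooth_at M p (\<lambda>q. \<Sum>b\<in>Basis. (h q \<bullet> b) *\<^sub>R b)"
    using assms by (intro smooth_at_sum smooth_at_bilinear[OF _ bounded_bilinear_scaleR]) auto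
  then show ?thesis by (simp add: euclidean_representation)
qed

section \<open>Smooth maps between manifolds\<close>

lemma smooth_map_on_openin: "smooth_map_on M U M' F \<Longrightarrow> openin (mtop M) U"
  by (simp add: smooth_map_on_def)

lemma smooth_map_on_pts:
  assumes "smooth_map_on M U M' F" "p \<in> U"
  shows "p \<in> pts M" "F p \<in> pts M'"
proof -
  show "p \<in> pts M" using assms openin_pts smooth_map_on_openin by metis
  then have "p \<in> topspace (subtopology (mtop M) U)"
    using assms by (simp add: pts_def)
  then show "F p \<in> pts M'"
    using assms(1) unfolding smooth_map_on_def continuous_map_def pts_def by blast
qed

lemma smooth_map_on_vimage:
  assumes "smooth_map_on M U M' F" "openin (mtop M') S"
  shows "openin (mtop M) {q \<in> U. F q \<in> S}"
proof -
  have "openin (subtopology (mtop M) U) {q \<in> topspace (subtopology (mtop M) U). F q \<in> S}"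
    using assms by (intro openin_continuous_map_preimage) (auto simp: smooth_map_on_def)
  moreover have "topspace (subtopology (mtop M) U) = U"
    using openin_subset[OF smooth_map_on_openin[OF assms(1)]] by (auto simp: topspace_subtopology)
  ultimately show ?thesis
    using openin_trans_full smooth_map_on_openin[OF assms(1)] by metis
qed

lemma smooth_at_comp:
  assumes "smooth_atlas M" "smooth_atlas M'" "smooth_map_on M U M' F" "p \<in> U" "smooth_at M' (F p) h"
  shows "smooth_at M p (\<lambda>q. h (F q))"
proof -
  obtain W \<psi> where c: "(W, \<psi>) \<in> atlas M'" "F p \<in> W"
    using assms(2) smooth_map_on_pts(2)[OF assms(3,4)] by (rule smooth_atlasE)
  interpret smooth_chart M' W \<psi> by unfold_locales (use assms c in auto)
  obtain T where T: "open T" "\<psi> (F p) \<in> T" "T \<subseteq> \<psi> ` W" "Cinf_on T (h \<circ> inv_into W \<psi>)"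
    using smooth_atE[OF assms(5) c(2)] by blast
  have "smooth_at M p (\<psi> \<circ> F)"
    using assms(3,4) c by (auto simp: smooth_map_on_def)
  then have "smooth_at M p (\<lambda>q. (h \<circ> inv_into W \<psi>) ((\<psi> \<circ> F) q))"
    by (rule smooth_at_Cinf_comp[OF assms(1) _ T(1) _ T(4)]) (simp add: T(2))
  then show ?thesis
    by (rule smooth_at_cong_imp[OF assms(1) smooth_map_on_vimage[OF assms(3) openin_U], rotated 2])
      (use assms(4) c in auto)
qed

lemma smooth_map_onI:
  assumes "smooth_atlas M" "smooth_atlas M'" "openin (mtop M) U" "F ` U \<subseteq> pts M'"
    and "\<And>S. openin (mtop M') S \<Longrightarrow> openin (mtop M) {q \<in> U. F q \<in> S}"
    and "\<And>p W \<psi>. p \<in> U \<Longrightarrow> (W, \<psi>) \<in> atlas M' \<Longrightarrow> F p \<in> W \<Longrightarrow> smooth_at M p (\<lambda>q. \<psi> (F q))"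
  shows "smooth_map_on M U M' F"
proof -
  have t: "topspace (subtopology (mtop M) U) = U"
    using openin_subset[OF assms(3)] by (auto simp: topspace_subtopology)
  have "continuous_map (subtopology (mtop M) U) (mtop M') F"
    unfolding continuous_map_def t
  proof (intro conjI allI impI)
    show "F \<in> U \<rightarrow> topspace (mtop M')" using assms(4) by (auto simp: pts_def)
    fix S assume "openin (mtop M') S"
    then have "openin (mtop M) {q \<in> U. F q \<in> S}" by (rule assms(5))
    then show "openin (subtopology (mtop M) U) {x \<in> U. F x \<in> S}"
      using openin_open_subtopology[OF assms(3)] by auto
  qed
  then show ?thesis
    using assms(3,6) unfolding smooth_map_on_def by (auto simp: o_def)
qed

lemma smooth_map_on_comp:
  assumes M: "smooth_atlas M" "smooth_atlas M'" "smooth_atlas M''"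
    and F: "smooth_map_on M U M' F" "smooth_map_on M' U' M'' G" "F ` U \<subseteq> U'"
  shows "smooth_map_on M U M'' (\<lambda>q. G (F q))"
proof (rule smooth_map_onI[OF M(1,3) smooth_map_on_openin[OF F(1)]])
  show "(\<lambda>q. G (F q)) ` U \<subseteq> pts M''"
    using smooth_map_on_pts(2)[OF F(2)] F(3) by blast
next
  fix S assume "openin (mtop M'') S"
  then have "openin (mtop M') {q \<in> U'. G q \<in> S}" by (rule smooth_map_on_vimage[OF F(2)])
  from smooth_map_on_vimage[OF F(1) this]
  show "openin (mtop M) {q \<in> U. G (F q) \<in> S}"
    using F(3) by (simp add: image_subset_iff cong: conj_cong)
next
  fix p W \<psi> assume p: "p \<in> U" "(W, \<psi>) \<in> atlas M''" "G (F p) \<in> W"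
  have "smooth_at M' (F p) (\<lambda>q. \<psi> (G q))"
    using F(2,3) p unfolding smooth_map_on_def by (fastforce simp: o_def)
  then show "smooth_at M p (\<lambda>q. \<psi> (G (F q)))"
    by (rule smooth_at_comp[OF M(1,2) F(1) p(1)])
qed


section \<open>Tangent vectors\<close>

lemma tspace_add:
  "v \<in> tspace M p \<Longrightarrow> smooth_at M p g \<Longrightarrow> smooth_at M p h \<Longrightarrow> v (\<lambda>x. g x + h x) = v g + v h"
  by (simp add: tspace_def)

lemma tspace_mult:
  "v \<in> tspace M p \<Longrightarrow> smooth_at M p g \<Longrightarrow> smooth_at M p h \<Longrightarrow>
    v (\<lambda>x. g x * h x) = v g * h p + g p * v h"
  by (simp add: tspace_def)

lemma tspace_scale: "v \<in> tspace M p \<Longrightarrow> smooth_at M p h \<Longrightarrow> v (\<lambda>x. c * h x) = c * v h"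
  by (simp add: tspace_def)

lemma tspace_nonsmooth: "v \<in> tspace M p \<Longrightarrow> \<not> smooth_at M p h \<Longrightarrow> v h = 0"
  by (simp add: tspace_def)

lemma tspace_const:
  assumes "smooth_atlas M" "p \<in> pts M" "v \<in> tspace M p"
  shows "v (\<lambda>x. c) = 0"
proof -
  have "v (\<lambda>x. 1 * 1) = v (\<lambda>x. 1) * 1 + 1 * v (\<lambda>x. 1)"
    using assms by (intro tspace_mult) auto
  then have "v (\<lambda>x. 1) = 0" by simp
  moreover have "v (\<lambda>x. c * 1) = c * v (\<lambda>x. 1)"
    using assms by (intro tspace_scale) auto
  ultimately show ?thesis by simp
qed

lemma tspace_cong:
  assumes "smooth_atlas M" "v \<in> tspace M p" "openin (mtop M) S" "p \<in> S" "\<And>q. q \<in> S \<Longrightarrow> g q = h q"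
  shows "v g = v h"
proof (cases "smooth_at M p g")
  case False
  then have "\<not> smooth_at M p h"
    using smooth_at_cong[OF assms(1,3,4), of g h] assms(5) by auto
  with False show ?thesis using tspace_nonsmooth[OF assms(2)] by metis
next
  case True
  then have h: "smooth_at M p h"
    using smooth_at_cong[OF assms(1,3,4), of g h] assms(5) by auto
  have p: "p \<in> pts M" using assms openin_pts by metis
  define k :: "_ \<Rightarrow> real" where "k q = (if q \<in> S then 0 else 1)" for q
  have k: "smooth_at M p k"
    by (rule smooth_at_cong_imp[OF assms(1,3,4) _ smooth_at_const[OF assms(1) p, of 0]]) (simp add: k_def)
  define d where "d = (\<lambda>q. g q + (-1) * h q)"
  have mh: "smooth_at M p (\<lambda>q. (-1) * h q)"
    by (rule smooth_at_bilinear[OF assms(1) bounded_bilinear_mult smooth_at_const[OF assms(1) p] h])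
  have d: "smooth_at M p d"
    unfolding d_def by (rule smooth_at_add[OF assms(1) True mh])
  have "d = (\<lambda>q. d q * k q)"
    using assms(5) by (auto simp: d_def k_def)
  then have "v d = v (\<lambda>q. d q * k q)" by simp
  also have "\<dots> = v d * k p + d p * v k" by (rule tspace_mult[OF assms(2) d k])
  also have "\<dots> = 0" using assms(4,5) by (simp add: k_def d_def)
  finally have "v d = 0" .
  moreover have "v d = v g + (-1) * v h"
    unfolding d_def tspace_add[OF assms(2) True mh] tspace_scale[OF assms(2) h] ..
  ultimately show ?thesis by simp
qed

lemma tspace_sum:
  assumes "smooth_atlas M" "p \<in> pts M" "v \<in> tspace M p" "\<And>i. i \<in> A \<Longrightarrow> smooth_at M p (h i)"
  shows "v (\<lambda>x. \<Sum>i\<in>A. h i x) = (\<Sum>i\<in>A. v (h i))"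
  using assms(4)
proof (induction A rule: infinite_finite_induct)
  case (insert i A)
  have "smooth_at M p (\<lambda>x. \<Sum>i\<in>A. h i x)"
    by (rule smooth_at_sum) (use assms insert in auto)
  then show ?case using insert tspace_add[OF assms(3)] by simp
qed (use tspace_const[OF assms(1-3)] in auto)

lemma tspace_diff:
  assumes "smooth_atlas M" "v \<in> tspace M p" "smooth_at M p g" "smooth_at M p h"
  shows "v (\<lambda>x. g x - h x) = v g - v h"
proof -
  have "v (\<lambda>x. g x + (-1) * h x) = v g + (-1) * v h"
    using tspace_add[OF assms(2,3) smooth_at_bilinear[OF assms(1) bounded_bilinear_mult
          smooth_at_const[OF assms(1) smooth_at_pts[OF assms(1,3)]] assms(4)]]
      tspace_scale[OF assms(2,4)]
    by metis
  then show ?thesis by simp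
qed

lemma smooth_at_diff:
  fixes g h :: "_ \<Rightarrow> 'v::real_normed_vector"
  assumes "smooth_atlas M" "smooth_at M p g" "smooth_at M p h"
  shows "smooth_at M p (\<lambda>x. g x - h x)"
proof -
  have "smooth_at M p (\<lambda>x. g x + - h x)"
    by (intro smooth_at_add smooth_at_linear_comp[OF _ bounded_linear_minus[OF bounded_linear_ident]] assms)
  then show ?thesis by simp
qed

lemma lincomb_tspace:
  assumes "u \<in> tspace M p" "v \<in> tspace M p"
  shows "lincomb a u b v \<in> tspace M p"
  using assms unfolding tspace_def lincomb_def by (auto simp: algebra_simps)

lemma tzero_tspace: "tzero \<in> tspace M p"
  by (simp add: tspace_def tzero_def)

section \<open>Derivatives of vector-valued functions and coordinate vectors\<close>

lemma vapply_real: "vapply v (h :: 'a \<Rightarrow> real) = v h"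
  by (simp add: vapply_def)

lemma vapply_inner: "b \<in> Basis \<Longrightarrow> vapply v h \<bullet> b = v (\<lambda>x. h x \<bullet> b)"
  by (simp add: vapply_def inner_sum_left inner_Basis if_distrib cong: if_cong)

lemma vapply_lincomb: "vapply (lincomb a u b v) h = a *\<^sub>R vapply u h + b *\<^sub>R vapply v h"
  by (simp add: vapply_def lincomb_def scaleR_add_left sum.distrib scaleR_sum_right)

lemma vapply_tzero [simp]: "vapply tzero h = 0"
  by (simp add: vapply_def tzero_def)

lemma vapply_cong:
  assumes "smooth_atlas M" "v \<in> tspace M p" "openin (mtop M) S" "p \<in> S" "\<And>q. q \<in> S \<Longrightarrow> g q = h q"
  shows "vapply v g = vapply v h"
  unfolding vapply_def
  by (intro sum.cong refl arg_cong2[of _ _ _ _ scaleR] tspace_cong[OF assms(1-4)]) (simp add: assms(5))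

text \<open>The coordinate derivation in direction \<open>e\<close> of the chart. The value 0 off
  the smooth functions is forced by the convention in \<open>tspace\<close>.\<close>

definition cvec :: "('a, 'e::euclidean_space) mfd \<Rightarrow> 'a set \<Rightarrow> ('a \<Rightarrow> 'e) \<Rightarrow> 'e \<Rightarrow> 'a \<Rightarrow> 'a tvec" where
  "cvec M U \<phi> e p =
     (\<lambda>h. if smooth_at M p h then frechet_derivative (h \<circ> inv_into U \<phi>) (at (\<phi> p)) e else 0)"

context smooth_chart
begin

lemma has_derivative_smooth_at:
  assumes "p \<in> U" "smooth_at M p h"
  shows "((h \<circ> inv_into U \<phi>) has_derivative frechet_derivative (h \<circ> inv_into U \<phi>) (at (\<phi> p))) (at (\<phi> p))"
proof -
  obtain W where W: "open W" "\<phi> p \<in> W" "W \<subseteq> \<phi> ` U" "Cinf_on W (h \<circ> inv_into U \<phi>)"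
    using smooth_atE[OF assms(2,1)] by blast
  show ?thesis by (rule Cinf_on_has_derivative[OF W(4,2)])
qed

lemma cvecI:
  assumes "((h \<circ> inv_into U \<phi>) has_derivative D) (at (\<phi> p))" "smooth_at M p h"
  shows "cvec M U \<phi> e p h = D e"
  using assms frechet_derivative_at by (fastforce simp: cvec_def)

lemma cvec_tspace:
  assumes "p \<in> U"
  shows "cvec M U \<phi> e p \<in> tspace M p"
proof -
  have p: "p \<in> pts M" using assms U_pts by auto
  note d = has_derivative_smooth_at[OF assms]
  have add: "cvec M U \<phi> e p (\<lambda>x. g x + h x) = cvec M U \<phi> e p g + cvec M U \<phi> e p h"
    if "smooth_at M p g" "smooth_at M p h" for g h
    using has_derivative_add[OF d[OF that(1)] d[OF that(2)]] smooth_at_add[OF atl that] that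
    by (subst cvecI) (auto simp: cvec_def o_def)
  have mult: "cvec M U \<phi> e p (\<lambda>x. g x * h x) = cvec M U \<phi> e p g * h p + g p * cvec M U \<phi> e p h"
    if "smooth_at M p g" "smooth_at M p h" for g h
    using has_derivative_mult[OF d[OF that(1)] d[OF that(2)]] assms that
      smooth_at_bilinear[OF atl bounded_bilinear_mult that]
    by (subst cvecI) (auto simp: cvec_def o_def add.commute)
  have scale: "cvec M U \<phi> e p (\<lambda>x. c * h x) = c * cvec M U \<phi> e p h"
    if "smooth_at M p h" for c h
  proof -
    have "cvec M U \<phi> e p (\<lambda>x. c) = 0"
      using frechet_derivative_at[OF has_derivative_const[of c "at (\<phi> p)"]]
      by (simp add: cvec_def o_def)
    then show ?thesis using mult[OF smooth_at_const[OF atl p] that] by simp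
  qed
  show ?thesis
    unfolding tspace_def using add mult scale by (auto simp: cvec_def)
qed

lemma vapply_cvec:
  assumes "p \<in> U" "smooth_at M p h"
  shows "vapply (cvec M U \<phi> e p) h = frechet_derivative (h \<circ> inv_into U \<phi>) (at (\<phi> p)) e"
proof -
  have "cvec M U \<phi> e p (\<lambda>x. h x \<bullet> b) = frechet_derivative (h \<circ> inv_into U \<phi>) (at (\<phi> p)) e \<bullet> b" for b
  proof (rule cvecI)
    show "smooth_at M p (\<lambda>x. h x \<bullet> b)"
      by (rule smooth_at_linear_comp[OF atl bounded_linear_inner_left assms(2)])
    show "((\<lambda>x. h x \<bullet> b) \<circ> inv_into U \<phi> has_derivative
       (\<lambda>e. frechet_derivative (h \<circ> inv_into U \<phi>) (at (\<phi> p)) e \<bullet> b)) (at (\<phi> p))"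
      using has_derivative_inner_left[OF has_derivative_smooth_at[OF assms], of b] by (simp add: o_def)
  qed
  then show ?thesis by (simp add: vapply_def euclidean_representation)
qed

lemma vapply_cvec_chart:
  assumes "p \<in> U"
  shows "vapply (cvec M U \<phi> e p) \<phi> = e"
proof -
  have "((\<lambda>x. x) has_derivative (\<lambda>x. x)) (at (\<phi> p))" by (rule has_derivative_ident)
  then have "((\<phi> \<circ> inv_into U \<phi>) has_derivative (\<lambda>x. x)) (at (\<phi> p))"
    by (rule has_derivative_transform_within_open[OF _ open_image_U]) (use assms in auto)
  then have "frechet_derivative (\<phi> \<circ> inv_into U \<phi>) (at (\<phi> p)) = (\<lambda>x. x)"
    using frechet_derivative_at by metis
  then show ?thesis
    using vapply_cvec[OF assms smooth_at_chart[OF assms]] by simp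
qed

text \<open>Write \<open>h\<close> near \<open>p\<close> by Hadamard's lemma as its value plus a sum
  of products of coordinate differences and smooth coefficients. The derivation kills the constant,
  and in each product only the coefficient at \<open>p\<close>, a partial derivative of
  \<open>h\<close>, survives.\<close>

theorem tspace_eq_cvec:
  assumes "p \<in> U" "v \<in> tspace M p"
  shows "v = cvec M U \<phi> (vapply v \<phi>) p"
proof
  fix h
  have p: "p \<in> pts M" using assms U_pts by auto
  show "v h = cvec M U \<phi> (vapply v \<phi>) p h"
  proof (cases "smooth_at M p h")
    case False
    then show ?thesis using tspace_nonsmooth[OF assms(2)] by (simp add: cvec_def)
  next
    case True
    obtain W where W: "open W" "\<phi> p \<in> W" "W \<subseteq> \<phi> ` U" "Cinf_on W (h \<circ> inv_into U \<phi>)"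
      using smooth_atE[OF True assms(1)] by blast
    then obtain r where r: "r > 0" "ball (\<phi> p) r \<subseteq> W"
      using openE by blast
    obtain g where g: "\<And>b. Cinf_on (ball (\<phi> p) r) (g b)"
      "\<And>b. g b (\<phi> p) = frechet_derivative (h \<circ> inv_into U \<phi>) (at (\<phi> p)) b"
      "\<And>x. x \<in> ball (\<phi> p) r \<Longrightarrow> (h \<circ> inv_into U \<phi>) x = (h \<circ> inv_into U \<phi>) (\<phi> p) + (\<Sum>b\<in>Basis. ((x - \<phi> p) \<bullet> b) * g b x)"
    proof (rule Hadamard)
      show "Cinf_on (ball (\<phi> p) r) (h \<circ> inv_into U \<phi>)" using W r Cinf_on_subset by blast
    qed (use r in auto)
    have g1: "smooth_at M p (\<lambda>q. g b (\<phi> q))" for b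
      by (rule smooth_at_comp_chart[OF assms(1) open_ball _ g(1)]) (use r in auto)
    have g2: "smooth_at M p (\<lambda>q. \<phi> q \<bullet> b)" for b
      by (intro smooth_at_linear_comp[OF atl bounded_linear_inner_left] smooth_at_chart assms)
    have g3: "smooth_at M p (\<lambda>q. (\<phi> q - \<phi> p) \<bullet> b)" for b
      unfolding inner_diff_left by (intro smooth_at_diff atl g2 smooth_at_const p)
    have vg3: "v (\<lambda>q. (\<phi> q - \<phi> p) \<bullet> b) = v (\<lambda>q. \<phi> q \<bullet> b)" for b
      unfolding inner_diff_left
      using tspace_diff[OF atl assms(2) g2 smooth_at_const[OF atl p]] tspace_const[OF atl p assms(2)]
      by simp
    have g4: "smooth_at M p (\<lambda>q. ((\<phi> q - \<phi> p) \<bullet> b) * g b (\<phi> q))" for b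
      by (rule smooth_at_bilinear[OF atl bounded_bilinear_mult g3 g1])
    have "v h = v (\<lambda>q. h p + (\<Sum>b\<in>Basis. ((\<phi> q - \<phi> p) \<bullet> b) * g b (\<phi> q)))"
    proof (rule tspace_cong[OF atl assms(2) openin_vimage[OF open_ball[of "\<phi> p" r]]])
      fix q assume "q \<in> {q \<in> U. \<phi> q \<in> ball (\<phi> p) r}"
      then show "h q = h p + (\<Sum>b\<in>Basis. (\<phi> q - \<phi> p) \<bullet> b * g b (\<phi> q))"
        using g(3)[of "\<phi> q"] assms(1) by simp
    qed (use r assms in auto)
    also have "\<dots> = (\<Sum>b\<in>Basis. v (\<lambda>q. ((\<phi> q - \<phi> p) \<bullet> b) * g b (\<phi> q)))"
    proof -
      have "smooth_at M p (\<lambda>q. \<Sum>b\<in>Basis. ((\<phi> q - \<phi> p) \<bullet> b) * g b (\<phi> q))"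
        by (rule smooth_at_sum[OF atl p]) (rule g4)
      from tspace_add[OF assms(2) smooth_at_const[OF atl p] this]
      have "v (\<lambda>q. h p + (\<Sum>b\<in>Basis. ((\<phi> q - \<phi> p) \<bullet> b) * g b (\<phi> q))) =
          v (\<lambda>q. \<Sum>b\<in>Basis. ((\<phi> q - \<phi> p) \<bullet> b) * g b (\<phi> q))"
        by (simp add: tspace_const[OF atl p assms(2)])
      also have "\<dots> = (\<Sum>b\<in>Basis. v (\<lambda>q. ((\<phi> q - \<phi> p) \<bullet> b) * g b (\<phi> q)))"
        by (rule tspace_sum[OF atl p assms(2)]) (rule g4)
      finally show ?thesis .
    qed
    also have "\<dots> = (\<Sum>b\<in>Basis. v (\<lambda>q. \<phi> q \<bullet> b) * frechet_derivative (h \<circ> inv_into U \<phi>) (at (\<phi> p)) b)"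
      by (intro sum.cong refl) (simp add: tspace_mult[OF assms(2) g3 g1] vg3 g(2))
    also have "\<dots> = frechet_derivative (h \<circ> inv_into U \<phi>) (at (\<phi> p)) (vapply v \<phi>)"
      using has_derivative_linear[OF has_derivative_smooth_at[OF assms(1) True]]
      unfolding vapply_def by (simp add: linear_sum linear_scale)
    also have "\<dots> = cvec M U \<phi> (vapply v \<phi>) p h" by (simp add: cvec_def True)
    finally show ?thesis .
  qed
qed

lemma tspace_eqI:
  assumes "p \<in> U" "u \<in> tspace M p" "v \<in> tspace M p" "vapply u \<phi> = vapply v \<phi>"
  shows "u = v"
  using tspace_eq_cvec assms by metis

lemma vapply_eq_frechet:
  assumes "p \<in> U" "v \<in> tspace M p" "smooth_at M p h"
  shows "vapply v h = frechet_derivative (h \<circ> inv_into U \<phi>) (at (\<phi> p)) (vapply v \<phi>)"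
  using vapply_cvec[OF assms(1,3)] tspace_eq_cvec[OF assms(1,2)] by metis

lemma cvec_lincomb:
  assumes "p \<in> U"
  shows "cvec M U \<phi> (a *\<^sub>R e + b *\<^sub>R e') p = lincomb a (cvec M U \<phi> e p) b (cvec M U \<phi> e' p)"
  by (rule tspace_eqI[OF assms])
    (simp_all add: cvec_tspace lincomb_tspace assms vapply_cvec_chart vapply_lincomb)

lemma vfield_cvec: "vfield M U (cvec M U \<phi> e)"
  unfolding vfield_def
proof (intro conjI ballI openin_U cvec_tspace allI impI)
  fix p and h :: "'a \<Rightarrow> real" assume p: "p \<in> U" and h: "smooth_at M p h"
  obtain W where W: "open W" "\<phi> p \<in> W" "W \<subseteq> \<phi> ` U" "Cinf_on W (h \<circ> inv_into U \<phi>)"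
    using smooth_atE[OF h p] by blast
  have "smooth_at M p (\<lambda>q. frechet_derivative (h \<circ> inv_into U \<phi>) (at (\<phi> q)) e)"
    by (rule smooth_at_comp_chart[OF p W(1,2) Cinf_on_frechet_derivative[OF W(1,4)]])
  then show "smooth_at M p (\<lambda>q. cvec M U \<phi> e q h)"
  proof (rule smooth_at_cong_imp[OF atl openin_vimage[OF W(1)], rotated 2])
    fix q assume "q \<in> {q \<in> U. \<phi> q \<in> W}"
    then have "smooth_at M q h" using W smooth_atI by auto
    then show "frechet_derivative (h \<circ> inv_into U \<phi>) (at (\<phi> q)) e = cvec M U \<phi> e q h"
      by (simp add: cvec_def)
  qed (use p W in auto)
qed

end

lemma vapply_add:
  assumes "smooth_atlas M" "v \<in> tspace M p" "smooth_at M p g" "smooth_at M p h"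
  shows "vapply v (\<lambda>x. g x + h x) = vapply v g + vapply v h"
  unfolding vapply_def sum.distrib[symmetric] inner_add_left
  using smooth_at_linear_comp[OF assms(1) bounded_linear_inner_left assms(3)]
    smooth_at_linear_comp[OF assms(1) bounded_linear_inner_left assms(4)]
  by (intro sum.cong refl) (simp add: tspace_add[OF assms(2)] scaleR_add_left)

lemma vapply_const:
  assumes "smooth_atlas M" "p \<in> pts M" "v \<in> tspace M p"
  shows "vapply v (\<lambda>x. c) = 0"
  by (simp add: vapply_def tspace_const[OF assms])

lemma vapply_bilinear:
  assumes "smooth_atlas M" "v \<in> tspace M p" "bounded_bilinear pr" "smooth_at M p g" "smooth_at M p h"
  shows "vapply v (\<lambda>x. pr (g x) (h x)) = pr (g p) (vapply v h) + pr (vapply v g) (h p)"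
proof -
  have p: "p \<in> pts M" by (rule smooth_at_pts[OF assms(1,4)])
  obtain U \<phi> where c: "(U, \<phi>) \<in> atlas M" "p \<in> U" using assms(1) p by (rule smooth_atlasE)
  interpret smooth_chart M U \<phi> by unfold_locales (use assms c in auto)
  note d = has_derivative_smooth_at[OF c(2)]
  note * = bounded_bilinear.FDERIV[OF assms(3) d[OF assms(4)] d[OF assms(5)]]
  have "((\<lambda>x. pr (g x) (h x)) \<circ> inv_into U \<phi>) = (\<lambda>x. pr ((g \<circ> inv_into U \<phi>) x) ((h \<circ> inv_into U \<phi>) x))"
    by auto
  then show ?thesis
    unfolding vapply_eq_frechet[OF c(2) assms(2) smooth_at_bilinear[OF atl assms(3,4,5)]]
      vapply_eq_frechet[OF c(2) assms(2,4)] vapply_eq_frechet[OF c(2) assms(2,5)]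
    using c(2) by (simp only: frechet_derivative_at[OF *, symmetric]) simp
qed

lemma vapply_linear:
  assumes "smooth_atlas M" "v \<in> tspace M p" "bounded_linear L" "smooth_at M p h"
  shows "vapply v (\<lambda>x. L (h x)) = L (vapply v h)"
proof -
  note p = smooth_at_pts[OF assms(1,4)]
  have "bounded_bilinear (\<lambda>c x. c *\<^sub>R L x)"
    by (rule bounded_bilinear.comp[OF bounded_bilinear_scaleR bounded_linear_ident assms(3)])
  from vapply_bilinear[OF assms(1,2) this smooth_at_const[OF assms(1) p] assms(4), of 1] show ?thesis
    by (simp add: vapply_const[OF assms(1) p assms(2)])
qed

lemma vapply_sum:
  assumes "smooth_atlas M" "p \<in> pts M" "v \<in> tspace M p" "\<And>i. i \<in> A \<Longrightarrow> smooth_at M p (h i)"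
  shows "vapply v (\<lambda>x. \<Sum>i\<in>A. h i x) = (\<Sum>i\<in>A. vapply v (h i))"
  using assms(4)
proof (induction A rule: infinite_finite_induct)
  case (insert i A)
  have "smooth_at M p (\<lambda>x. \<Sum>i\<in>A. h i x)"
    by (rule smooth_at_sum) (use assms insert in auto)
  have "vapply v (\<lambda>x. h i x + (\<Sum>i\<in>A. h i x)) = vapply v (h i) + vapply v (\<lambda>x. \<Sum>i\<in>A. h i x)"
    using vapply_add[OF assms(1,3) _ \<open>smooth_at M p (\<lambda>x. \<Sum>i\<in>A. h i x)\<close>, of "h i"] insert.prems by auto
  then show ?case using insert by simp
qed (use vapply_const[OF assms(1-3)] in auto)

section \<open>Vector fields and their brackets\<close>

lemma vfield_openin: "vfield M U X \<Longrightarrow> openin (mtop M) U"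
  by (simp add: vfield_def)

lemma vfield_tspace: "vfield M U X \<Longrightarrow> p \<in> U \<Longrightarrow> X p \<in> tspace M p"
  by (simp add: vfield_def)

lemma vfield_smooth: "vfield M U X \<Longrightarrow> p \<in> U \<Longrightarrow> smooth_at M p h \<Longrightarrow> smooth_at M p (\<lambda>q. X q h)"
  by (simp add: vfield_def)

lemma vfield_subset: "vfield M U X \<Longrightarrow> openin (mtop M) W \<Longrightarrow> W \<subseteq> U \<Longrightarrow> vfield M W X"
  by (auto simp: vfield_def)

lemma vfield_smooth_vapply:
  assumes "smooth_atlas M" "vfield M U X" "p \<in> U" "smooth_at M p h"
  shows "smooth_at M p (\<lambda>q. vapply (X q) h)"
proof (rule smooth_at_componentwise[OF assms(1)])
  show "p \<in> pts M" by (rule smooth_at_pts[OF assms(1,4)])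
  fix b :: 'c assume "b \<in> Basis"
  then show "smooth_at M p (\<lambda>q. vapply (X q) h \<bullet> b)"
    using vfield_smooth[OF assms(2,3) smooth_at_linear_comp[OF assms(1) bounded_linear_inner_left assms(4)]]
    by (simp add: vapply_inner)
qed

text \<open>Exterior derivatives and holomorphy of forms are defined through fields; a constant
  combination of coordinate fields passes from a single vector to a field.\<close>

lemma tspace_extend:
  assumes "smooth_atlas M" "v \<in> tspace M p" "p \<in> pts M"
  obtains U X where "vfield M U X" "p \<in> U" "X p = v"
proof -
  obtain U \<phi> where c: "(U, \<phi>) \<in> atlas M" "p \<in> U" using assms(1,3) by (rule smooth_atlasE)
  interpret smooth_chart M U \<phi> by unfold_locales (use assms c in auto)
  show thesis
    by (rule that[OF vfield_cvec c(2)]) (rule tspace_eq_cvec[OF c(2) assms(2), symmetric])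
qed

lemma bracket_tspace:
  assumes "smooth_atlas M" "vfield M W X" "vfield M W Y" "p \<in> W"
  shows "bracket M X Y p \<in> tspace M p"
proof -
  have p: "p \<in> pts M" using openin_pts[OF vfield_openin[OF assms(2)] assms(4)] .
  note Xp = vfield_tspace[OF assms(2,4)] and Yp = vfield_tspace[OF assms(3,4)]
  note XS = vfield_smooth[OF assms(2,4)] and YS = vfield_smooth[OF assms(3,4)]
  note mul = smooth_at_bilinear[OF assms(1) bounded_bilinear_mult]
  note ad = smooth_at_add[OF assms(1)]
  \<comment> \<open>One order of composition is treated for both. In the product rule the cross
    terms \<open>Y' p g * X' p h\<close> and \<open>X' p g * Y' p h\<close> are symmetric in the two
    fields, so they cancel in the commutator.\<close>
  have half: "X' p (\<lambda>q. Y' q (\<lambda>x. g x + h x)) = X' p (\<lambda>q. Y' q g) + X' p (\<lambda>q. Y' q h)"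
    "X' p (\<lambda>q. Y' q (\<lambda>x. g x * h x)) = X' p (\<lambda>q. Y' q g) * h p + Y' p g * X' p h +
        (X' p g * Y' p h + g p * X' p (\<lambda>q. Y' q h))"
    if v: "vfield M W X'" "vfield M W Y'" and gh: "smooth_at M p g" "smooth_at M p h" for X' Y' g h
  proof -
    obtain S where S: "openin (mtop M) S" "p \<in> S" "\<And>q. q \<in> S \<Longrightarrow> smooth_at M q g"
      using smooth_at_nbhd[OF assms(1) gh(1)] by blast
    obtain T where T: "openin (mtop M) T" "p \<in> T" "\<And>q. q \<in> T \<Longrightarrow> smooth_at M q h"
      using smooth_at_nbhd[OF assms(1) gh(2)] by blast
    have o: "openin (mtop M) (S \<inter> T \<inter> W)" using S T vfield_openin[OF assms(2)] by blast
    note Xp' = vfield_tspace[OF v(1) assms(4)]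
    note Ys = vfield_smooth[OF v(2) assms(4)]
    have "X' p (\<lambda>q. Y' q (\<lambda>x. g x + h x)) = X' p (\<lambda>q. Y' q g + Y' q h)"
      by (rule tspace_cong[OF assms(1) Xp' o])
        (use S T assms v in \<open>auto intro!: tspace_add vfield_tspace[OF v(2)]\<close>)
    then show "X' p (\<lambda>q. Y' q (\<lambda>x. g x + h x)) = X' p (\<lambda>q. Y' q g) + X' p (\<lambda>q. Y' q h)"
      using tspace_add[OF Xp' Ys[OF gh(1)] Ys[OF gh(2)]] by simp
    have "X' p (\<lambda>q. Y' q (\<lambda>x. g x * h x)) = X' p (\<lambda>q. Y' q g * h q + g q * Y' q h)"
      by (rule tspace_cong[OF assms(1) Xp' o])
        (use S T assms v in \<open>auto intro!: tspace_mult vfield_tspace[OF v(2)]\<close>)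
    then show "X' p (\<lambda>q. Y' q (\<lambda>x. g x * h x)) = X' p (\<lambda>q. Y' q g) * h p + Y' p g * X' p h +
        (X' p g * Y' p h + g p * X' p (\<lambda>q. Y' q h))"
      using tspace_add[OF Xp' mul[OF Ys[OF gh(1)] gh(2)] mul[OF gh(1) Ys[OF gh(2)]]]
        tspace_mult[OF Xp' Ys[OF gh(1)] gh(2)] tspace_mult[OF Xp' gh(1) Ys[OF gh(2)]] by simp
  qed
  note h1 = half[OF assms(2,3)] and h2 = half[OF assms(3,2)]
  have br: "bracket M X Y p h = X p (\<lambda>q. Y q h) - Y p (\<lambda>q. X q h)" if "smooth_at M p h" for h
    using that by (simp add: bracket_def)
  have mult: "bracket M X Y p (\<lambda>x. g x * h x) = bracket M X Y p g * h p + g p * bracket M X Y p h"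
    if "smooth_at M p g" "smooth_at M p h" for g h
    using that by (simp add: br mul h1 h2 algebra_simps)
  have add: "bracket M X Y p (\<lambda>x. g x + h x) = bracket M X Y p g + bracket M X Y p h"
    if "smooth_at M p g" "smooth_at M p h" for g h
    using that by (simp add: br ad h1 h2)
  have const: "bracket M X Y p (\<lambda>x. c) = 0" for c
  proof -
    have "Z' p (\<lambda>q. Z q (\<lambda>x. c)) = 0" if "vfield M W Z" "vfield M W Z'" for Z Z'
    proof -
      have "Z' p (\<lambda>q. Z q (\<lambda>x. c)) = Z' p (\<lambda>q. 0)"
        by (rule tspace_cong[OF assms(1) vfield_tspace[OF that(2) assms(4)] vfield_openin[OF that(1)] assms(4)])
          (use tspace_const[OF assms(1)] that openin_pts vfield_tspace vfield_openin in metis)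
      then show ?thesis using tspace_const[OF assms(1) p vfield_tspace[OF that(2) assms(4)]] by simp
    qed
    from this[OF assms(2,3)] this[OF assms(3,2)] show ?thesis
      by (simp add: br smooth_at_const[OF assms(1) p])
  qed
  have scale: "bracket M X Y p (\<lambda>x. c * h x) = c * bracket M X Y p h" if "smooth_at M p h" for c h
    using mult[OF smooth_at_const[OF assms(1) p] that] const by simp
  show ?thesis
    unfolding tspace_def using add mult scale by (auto simp: bracket_def)
qed

lemma vapply_bracket:
  assumes "smooth_atlas M" "smooth_at M p h"
  shows "vapply (bracket M X Y p) h = vapply (X p) (\<lambda>q. vapply (Y q) h) - vapply (Y p) (\<lambda>q. vapply (X q) h)"
proof -
  have "(\<lambda>x. vapply v h \<bullet> b) = (\<lambda>x. v (\<lambda>x. h x \<bullet> b))" if "b \<in> Basis" for b v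
    using that by (simp add: vapply_inner)
  then show ?thesis
    unfolding vapply_def[of "bracket M X Y p" h] vapply_def[of "X p"] vapply_def[of "Y p"]
    using smooth_at_linear_comp[OF assms(1) bounded_linear_inner_left assms(2)]
    by (simp add: bracket_def sum_subtractf scaleR_diff_left vapply_inner)
qed

text \<open>Coordinate fields have constant components in their chart, and a tangent vector is
  determined by its components.\<close>

lemma (in smooth_chart) bracket_cvec:
  assumes "p \<in> U"
  shows "bracket M (cvec M U \<phi> e) (cvec M U \<phi> e') p = tzero"
proof -
  have z: "vapply (cvec M U \<phi> e p) (\<lambda>q. vapply (cvec M U \<phi> e' q) \<phi>) = 0" for e e'
  proof -
    have "vapply (cvec M U \<phi> e p) (\<lambda>q. vapply (cvec M U \<phi> e' q) \<phi>) = vapply (cvec M U \<phi> e p) (\<lambda>q. e')"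
      by (rule vapply_cong[OF atl cvec_tspace[OF assms] openin_U assms]) (simp add: vapply_cvec_chart)
    then show ?thesis using vapply_const[OF atl _ cvec_tspace[OF assms]] assms U_pts by auto
  qed
  show ?thesis
    by (rule tspace_eqI[OF assms bracket_tspace[OF atl vfield_cvec vfield_cvec assms] tzero_tspace])
      (simp add: vapply_bracket[OF atl smooth_at_chart[OF assms]] z)
qed

section \<open>Differentials of maps\<close>

lemma push_lincomb: "push M' F p (lincomb a u b v) = lincomb a (push M' F p u) b (push M' F p v)"
  by (auto simp: push_def lincomb_def)

lemma push_tspace:
  fixes F :: "'a \<Rightarrow> 'b"
  assumes "smooth_atlas M" "smooth_atlas M'" "smooth_map_on M U M' F" "p \<in> U" "v \<in> tspace M p"
  shows "push M' F p v \<in> tspace M' (F p)"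
proof -
  have s: "smooth_at M p (\<lambda>q. h (F q))" if "smooth_at M' (F p) h" for h :: "'b \<Rightarrow> real"
    using smooth_at_comp[OF assms(1-4)] that by blast
  have ad: "smooth_at M' (F p) (\<lambda>x. g x + h x)" "smooth_at M' (F p) (\<lambda>x. g x * h x)"
    if "smooth_at M' (F p) g" "smooth_at M' (F p) h" for g h :: "'b \<Rightarrow> real"
    using smooth_at_add[OF assms(2) that] smooth_at_bilinear[OF assms(2) bounded_bilinear_mult that]
    by simp_all
  have sc: "smooth_at M' (F p) (\<lambda>x. c * h x)" if "smooth_at M' (F p) h" for c :: real and h
    using smooth_at_const[OF assms(2) smooth_map_on_pts(2)[OF assms(3,4)]] that by (rule ad(2))
  show ?thesis
    unfolding tspace_def push_def comp_def
    by (simp add: ad sc s tspace_add[OF assms(5)] tspace_mult[OF assms(5)] tspace_scale[OF assms(5)])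
qed

lemma vapply_push:
  assumes "smooth_atlas M'" "smooth_at M' (F p) h"
  shows "vapply (push M' F p v) h = vapply v (\<lambda>q. h (F q))"
  using smooth_at_linear_comp[OF assms(1) bounded_linear_inner_left assms(2)]
  by (simp add: vapply_def push_def o_def)

lemma push_push:
  assumes "smooth_atlas M'" "smooth_atlas M''" "smooth_map_on M' U' M'' G" "F p \<in> U'"
  shows "push M'' G (F p) (push M' F p v) = push M'' (\<lambda>q. G (F q)) p v"
  using smooth_at_comp[OF assms] by (auto simp: push_def comp_def fun_eq_iff)

lemma push_cong:
  assumes "smooth_atlas M" "v \<in> tspace M p" "openin (mtop M) S" "p \<in> S" "\<And>q. q \<in> S \<Longrightarrow> F q = G q"
  shows "push M' F p v = push M' G p v"
  unfolding push_def using assms(4,5) by (auto intro!: ext tspace_cong[OF assms(1-4)])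

lemma push_ident:
  assumes "v \<in> tspace M p"
  shows "push M (\<lambda>q. q) p v = v"
  using tspace_nonsmooth[OF assms] by (auto simp: push_def o_def)


section \<open>Pullback of differential forms\<close>

lemma form1_lincomb:
  assumes "is_form1 M U \<alpha>" "p \<in> U" "u \<in> tspace M p" "v \<in> tspace M p"
  shows "\<alpha> p (lincomb a u b v) = a *\<^sub>R \<alpha> p u + b *\<^sub>R \<alpha> p v"
  using assms by (simp add: is_form1_def)

lemma form1_smooth:
  "is_form1 M U \<alpha> \<Longrightarrow> vfield M W X \<Longrightarrow> W \<subseteq> U \<Longrightarrow> p \<in> W \<Longrightarrow> smooth_at M p (\<lambda>q. \<alpha> q (X q))"
  by (simp add: is_form1_def)

lemma lincomb_0_0: "lincomb 0 u 0 v = tzero"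
  by (simp add: lincomb_def tzero_def)

lemma form1_tzero:
  assumes "is_form1 M U \<alpha>" "p \<in> U"
  shows "\<alpha> p tzero = 0"
  using form1_lincomb[OF assms tzero_tspace tzero_tspace, of 0 0] by (simp add: lincomb_0_0)

lemma linear_euclidean_sum:
  assumes "linear L"
  shows "L e = (\<Sum>b\<in>Basis. (e \<bullet> b) *\<^sub>R L b)"
proof -
  have "L (\<Sum>b\<in>Basis. (e \<bullet> b) *\<^sub>R b) = (\<Sum>b\<in>Basis. (e \<bullet> b) *\<^sub>R L b)"
    using assms by (simp add: linear_sum linear_scale)
  then show ?thesis by (simp add: euclidean_representation)
qed

context smooth_chart
begin

lemma linear_cvec:
  assumes "p \<in> U" "\<And>u v a b. u \<in> tspace M p \<Longrightarrow> v \<in> tspace M p \<Longrightarrow>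
    L (lincomb a u b v) = a *\<^sub>R L u + b *\<^sub>R L v"
  shows "linear (\<lambda>e. L (cvec M U \<phi> e p))"
proof
  note l = assms(2)[OF cvec_tspace[OF assms(1)] cvec_tspace[OF assms(1)], folded cvec_lincomb[OF assms(1)]]
  show "L (cvec M U \<phi> (e + e') p) = L (cvec M U \<phi> e p) + L (cvec M U \<phi> e' p)" for e e'
    using l[of 1 e 1 e'] by simp
  show "L (cvec M U \<phi> (r *\<^sub>R e) p) = r *\<^sub>R L (cvec M U \<phi> e p)" for r e
    using l[of r e 0 e] by simp
qed

lemma form1_components:
  assumes "is_form1 M (pts M) \<alpha>" "p \<in> U" "v \<in> tspace M p"
  shows "\<alpha> p v = (\<Sum>b\<in>Basis. (vapply v \<phi> \<bullet> b) *\<^sub>R \<alpha> p (cvec M U \<phi> b p))"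
proof -
  have "p \<in> pts M" using assms U_pts by auto
  then have "linear (\<lambda>e. \<alpha> p (cvec M U \<phi> e p))"
    using form1_lincomb[OF assms(1)] by (intro linear_cvec assms) auto
  from linear_euclidean_sum[OF this, of "vapply v \<phi>"] show ?thesis
    using tspace_eq_cvec[OF assms(2,3)] by simp
qed

lemma form1_cvec_smooth:
  "is_form1 M (pts M) \<alpha> \<Longrightarrow> p \<in> U \<Longrightarrow> smooth_at M p (\<lambda>q. \<alpha> q (cvec M U \<phi> b q))"
  by (rule form1_smooth[OF _ vfield_cvec U_pts])

lemma vapply_components:
  assumes "p \<in> U" "v \<in> tspace M p"
  shows "vapply v h = (\<Sum>b\<in>Basis. (vapply v \<phi> \<bullet> b) *\<^sub>R vapply (cvec M U \<phi> b p) h)"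
proof -
  have "linear (\<lambda>e. vapply (cvec M U \<phi> e p) h)"
    by (intro linear_cvec assms vapply_lincomb)
  from linear_euclidean_sum[OF this, of "vapply v \<phi>"] show ?thesis
    using tspace_eq_cvec[OF assms] by simp
qed

lemma form2_components:
  fixes \<beta> :: "('a, 'v::real_vector) form2"
  assumes "p \<in> U" "u \<in> tspace M p" "v \<in> tspace M p"
    and bil: "\<And>u v w a b. u \<in> tspace M p \<Longrightarrow> v \<in> tspace M p \<Longrightarrow> w \<in> tspace M p \<Longrightarrow>
      \<beta> p (lincomb a u b v) w = a *\<^sub>R \<beta> p u w + b *\<^sub>R \<beta> p v w \<and>
      \<beta> p w (lincomb a u b v) = a *\<^sub>R \<beta> p w u + b *\<^sub>R \<beta> p w v"
  shows "\<beta> p u v = (\<Sum>c\<in>Basis. \<Sum>b\<in>Basis. ((vapply u \<phi> \<bullet> c) * (vapply v \<phi> \<bullet> b)) *\<^sub>R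
    \<beta> p (cvec M U \<phi> c p) (cvec M U \<phi> b p))"
proof -
  have "linear (\<lambda>e. \<beta> p (cvec M U \<phi> e p) v)"
    by (rule linear_cvec[of p "\<lambda>u. \<beta> p u v"]) (use assms in auto)
  from linear_euclidean_sum[OF this, of "vapply u \<phi>"]
  have 1: "\<beta> p u v = (\<Sum>c\<in>Basis. (vapply u \<phi> \<bullet> c) *\<^sub>R \<beta> p (cvec M U \<phi> c p) v)"
    using tspace_eq_cvec[OF assms(1,2)] by simp
  have 2: "\<beta> p (cvec M U \<phi> c p) v =
      (\<Sum>b\<in>Basis. (vapply v \<phi> \<bullet> b) *\<^sub>R \<beta> p (cvec M U \<phi> c p) (cvec M U \<phi> b p))" for c
  proof -
    have "linear (\<lambda>e. \<beta> p (cvec M U \<phi> c p) (cvec M U \<phi> e p))"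
      by (rule linear_cvec[of p "\<lambda>u. \<beta> p (cvec M U \<phi> c p) u"]) (use assms cvec_tspace in auto)
    from linear_euclidean_sum[OF this, of "vapply v \<phi>"] show ?thesis
      using tspace_eq_cvec[OF assms(1,3)] by simp
  qed
  show ?thesis unfolding 1 by (subst 2) (simp add: scaleR_sum_right)
qed

end

lemma smooth_at_inner_basis:
  assumes "smooth_atlas M" "smooth_at M p h"
  shows "smooth_at M p (\<lambda>q. h q \<bullet> b)"
  by (rule smooth_at_linear_comp[OF assms(1) bounded_linear_inner_left assms(2)])

text \<open>Pushing a field forward along \<open>s\<close> need not give a field on
  \<open>M'\<close>, so smoothness of \<open>\<alpha>\<close> on fields cannot be applied directly.
  In target coordinates the value is a sum of derivatives of the components of \<open>s\<close>
  times the coefficients of \<open>\<alpha>\<close> composed with \<open>s\<close>, and each factor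
  is smooth.\<close>

lemma pullback_form1:
  assumes M: "smooth_atlas M" "smooth_atlas M'" and s: "smooth_map_on M U M' s"
    and \<alpha>: "is_form1 M' (pts M') \<alpha>"
  shows "is_form1 M U (\<lambda>p v. \<alpha> (s p) (push M' s p v))"
  unfolding is_form1_def
proof (intro conjI ballI allI impI)
  fix p u v a b assume p: "p \<in> U" and uv: "u \<in> tspace M p" "v \<in> tspace M p"
  show "\<alpha> (s p) (push M' s p (lincomb a u b v)) =
      a *\<^sub>R \<alpha> (s p) (push M' s p u) + b *\<^sub>R \<alpha> (s p) (push M' s p v)"
    unfolding push_lincomb
    by (intro form1_lincomb[OF \<alpha>] smooth_map_on_pts(2)[OF s p] push_tspace[OF M s p] uv)
next
  fix W X p assume W: "W \<subseteq> U" "vfield M W X" "p \<in> W"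
  then have pU: "p \<in> U" by auto
  obtain A \<psi> where c: "(A, \<psi>) \<in> atlas M'" "s p \<in> A"
    using M(2) smooth_map_on_pts(2)[OF s pU] by (rule smooth_atlasE)
  interpret smooth_chart M' A \<psi> by unfold_locales (use M c in auto)
  define S where "S = W \<inter> {q \<in> U. s q \<in> A}"
  have S: "openin (mtop M) S"
    unfolding S_def using vfield_openin[OF W(2)] smooth_map_on_vimage[OF s openin_U] by blast
  have "smooth_at M p (\<lambda>q. \<Sum>b\<in>Basis. (vapply (X q) (\<lambda>r. \<psi> (s r)) \<bullet> b) *\<^sub>R \<alpha> (s q) (cvec M' A \<psi> b (s q)))"
  proof (rule smooth_at_sum[OF M(1) smooth_map_on_pts(1)[OF s pU]])
    fix b :: 'd
    show "smooth_at M p (\<lambda>q. (vapply (X q) (\<lambda>r. \<psi> (s r)) \<bullet> b) *\<^sub>R \<alpha> (s q) (cvec M' A \<psi> b (s q)))"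
      by (intro smooth_at_bilinear[OF M(1) bounded_bilinear_scaleR] smooth_at_inner_basis[OF M(1)]
          vfield_smooth_vapply[OF M(1) W(2,3)] smooth_at_comp[OF M s pU]
          smooth_at_chart c form1_cvec_smooth \<alpha>)
  qed
  then show "smooth_at M p (\<lambda>q. \<alpha> (s q) (push M' s q (X q)))"
  proof (rule smooth_at_cong_imp[OF M(1) S, rotated 2])
    fix q assume q: "q \<in> S"
    then have qU: "q \<in> U" "s q \<in> A" "q \<in> W" by (auto simp: S_def)
    show "(\<Sum>b\<in>Basis. (vapply (X q) (\<lambda>r. \<psi> (s r)) \<bullet> b) *\<^sub>R \<alpha> (s q) (cvec M' A \<psi> b (s q))) =
        \<alpha> (s q) (push M' s q (X q))"
      using form1_components[OF \<alpha> qU(2) push_tspace[OF M s qU(1) vfield_tspace[OF W(2) qU(3)]]]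
      by (simp add: vapply_push[where F = s, OF M(2) smooth_at_chart[OF qU(2)]])
  qed (use W c in \<open>auto simp: S_def\<close>)
qed

text \<open>The hypothesis on \<open>d\<close> is used only for coordinate fields of
  \<open>M'\<close>, whose brackets vanish. On the source, with \<open>\<rho>\<close> the coordinate
  expression of \<open>s\<close> and \<open>a b\<close> the coefficients of \<open>\<alpha>\<close>,
  the second derivatives of \<open>\<rho>\<close> form exactly the bracket term and cancel; the
  first derivatives of the coefficients give \<open>\<beta>\<close>.\<close>

lemma pullback_ext_deriv:
  fixes \<alpha> :: "('b, 'v::euclidean_space) form1" and M' :: "('b, 'd::euclidean_space) mfd"
  assumes M: "smooth_atlas M" "smooth_atlas M'" and s: "smooth_map_on M U M' s"
    and \<alpha>: "is_form1 M' (pts M') \<alpha>" and d: "has_ext_deriv M' (pts M') \<alpha> \<beta>"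
    and bil: "\<And>y u v w a b. y \<in> pts M' \<Longrightarrow> u \<in> tspace M' y \<Longrightarrow> v \<in> tspace M' y \<Longrightarrow> w \<in> tspace M' y \<Longrightarrow>
      \<beta> y (lincomb a u b v) w = a *\<^sub>R \<beta> y u w + b *\<^sub>R \<beta> y v w \<and>
      \<beta> y w (lincomb a u b v) = a *\<^sub>R \<beta> y w u + b *\<^sub>R \<beta> y w v"
  shows "has_ext_deriv M U (\<lambda>p v. \<alpha> (s p) (push M' s p v))
    (\<lambda>p u v. \<beta> (s p) (push M' s p u) (push M' s p v))"
  unfolding has_ext_deriv_def
proof (intro allI impI ballI)
  fix W X Y p assume W: "W \<subseteq> U" "vfield M W X" "vfield M W Y" "p \<in> W"
  then have pU: "p \<in> U" by auto
  obtain A \<psi> where c: "(A, \<psi>) \<in> atlas M'" "s p \<in> A"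
    using M(2) smooth_map_on_pts(2)[OF s pU] by (rule smooth_atlasE)
  interpret smooth_chart M' A \<psi> by unfold_locales (use M c in auto)
  define S where "S = W \<inter> {q \<in> U. s q \<in> A}"
  have S: "openin (mtop M) S" "p \<in> S"
    unfolding S_def using vfield_openin[OF W(2)] smooth_map_on_vimage[OF s openin_U] W c by auto
  define \<rho> where "\<rho> = (\<lambda>q. \<psi> (s q))"
  define a where "a b y = \<alpha> y (cvec M' A \<psi> b y)" for b y
  define D where "D c b = vapply (cvec M' A \<psi> c (s p)) (a b)" for c b
  have \<rho>: "smooth_at M p \<rho>"
    unfolding \<rho>_def by (intro smooth_at_comp[OF M s pU] smooth_at_chart c)
  have a: "smooth_at M' (s p) (a b)" for b
    unfolding a_def by (intro form1_cvec_smooth \<alpha> c)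
  have as: "smooth_at M p (\<lambda>q. a b (s q))" for b
    by (rule smooth_at_comp[OF M s pU a])
  have vp: "vapply (push M' s q v) \<psi> = vapply v \<rho>" if "q \<in> S" for q v
    unfolding \<rho>_def using that by (intro vapply_push[where F = s, OF M(2)] smooth_at_chart) (auto simp: S_def)
  have comp: "\<alpha> (s q) (push M' s q (Z q)) = (\<Sum>b\<in>Basis. (vapply (Z q) \<rho> \<bullet> b) *\<^sub>R a b (s q))"
    if "vfield M W Z" "q \<in> S" for Z q
    using form1_components[OF \<alpha> _ push_tspace[OF M s _ vfield_tspace[OF that(1)]], of q] that(2)
    by (simp add: vp[OF that(2)] a_def S_def)
  \<comment> \<open>Product rule for component times coefficient: the first sum differentiates the
    coefficients, the second the components. The second sums for the two orders combine to the
    bracket term \<open>br\<close>.\<close>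
  have deriv_sum: "vapply (X' p) (\<lambda>q. \<alpha> (s q) (push M' s q (Y' q))) =
      (\<Sum>b\<in>Basis. (vapply (Y' p) \<rho> \<bullet> b) *\<^sub>R (\<Sum>c\<in>Basis. (vapply (X' p) \<rho> \<bullet> c) *\<^sub>R D c b)) +
      (\<Sum>b\<in>Basis. (vapply (X' p) (\<lambda>q. vapply (Y' q) \<rho>) \<bullet> b) *\<^sub>R a b (s p))"
    if v: "vfield M W X'" "vfield M W Y'" for X' Y'
  proof -
    note Xp = vfield_tspace[OF v(1) W(4)]
    have Y\<rho>: "smooth_at M p (\<lambda>q. vapply (Y' q) \<rho>)"
      by (rule vfield_smooth_vapply[OF M(1) v(2) W(4) \<rho>])
    have sb: "smooth_at M p (\<lambda>q. vapply (Y' q) \<rho> \<bullet> b)" for b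
      by (rule smooth_at_inner_basis[OF M(1) Y\<rho>])
    have "vapply (X' p) (\<lambda>q. \<alpha> (s q) (push M' s q (Y' q))) =
        vapply (X' p) (\<lambda>q. \<Sum>b\<in>Basis. (vapply (Y' q) \<rho> \<bullet> b) *\<^sub>R a b (s q))"
      by (rule vapply_cong[OF M(1) Xp S]) (rule comp[OF v(2)])
    also have "\<dots> = (\<Sum>b\<in>Basis. vapply (X' p) (\<lambda>q. (vapply (Y' q) \<rho> \<bullet> b) *\<^sub>R a b (s q)))"
      by (rule vapply_sum[OF M(1) smooth_map_on_pts(1)[OF s pU] Xp])
        (rule smooth_at_bilinear[OF M(1) bounded_bilinear_scaleR sb as])
    also have "\<dots> = (\<Sum>b\<in>Basis. (vapply (Y' p) \<rho> \<bullet> b) *\<^sub>R (\<Sum>c\<in>Basis. (vapply (X' p) \<rho> \<bullet> c) *\<^sub>R D c b) +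
        (vapply (X' p) (\<lambda>q. vapply (Y' q) \<rho>) \<bullet> b) *\<^sub>R a b (s p))"
    proof (rule sum.cong[OF refl])
      fix b :: 'd
      have "vapply (X' p) (\<lambda>q. a b (s q)) = vapply (push M' s p (X' p)) (a b)"
        by (rule vapply_push[where F = s, OF M(2) a, symmetric])
      also have "\<dots> = (\<Sum>c\<in>Basis. (vapply (X' p) \<rho> \<bullet> c) *\<^sub>R D c b)"
        using vapply_components[OF c(2) push_tspace[OF M s pU Xp], of "a b"]
        by (simp add: vp[OF S(2)] D_def)
      finally show "vapply (X' p) (\<lambda>q. (vapply (Y' q) \<rho> \<bullet> b) *\<^sub>R a b (s q)) =
        (vapply (Y' p) \<rho> \<bullet> b) *\<^sub>R (\<Sum>c\<in>Basis. (vapply (X' p) \<rho> \<bullet> c) *\<^sub>R D c b) +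
        (vapply (X' p) (\<lambda>q. vapply (Y' q) \<rho>) \<bullet> b) *\<^sub>R a b (s p)"
        using vapply_bilinear[OF M(1) Xp bounded_bilinear_scaleR sb as, of b b]
          vapply_linear[OF M(1) Xp bounded_linear_inner_left Y\<rho>, of b] by simp
    qed
    finally show ?thesis by (simp add: sum.distrib)
  qed
  have br: "\<alpha> (s p) (push M' s p (bracket M X Y p)) =
      (\<Sum>b\<in>Basis. (vapply (X p) (\<lambda>q. vapply (Y q) \<rho>) \<bullet> b) *\<^sub>R a b (s p)) -
      (\<Sum>b\<in>Basis. (vapply (Y p) (\<lambda>q. vapply (X q) \<rho>) \<bullet> b) *\<^sub>R a b (s p))"
    using form1_components[OF \<alpha> c(2) push_tspace[OF M s pU bracket_tspace[OF M(1) W(2-4)]]]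
    by (simp add: vp[OF S(2)] vapply_bracket[OF M(1) \<rho>] a_def inner_diff_left scaleR_diff_left sum_subtractf)
  \<comment> \<open>On coordinate fields Cartan's formula loses its bracket term, which leaves the
    antisymmetrized partial derivatives of the coefficients.\<close>
  have \<beta>: "\<beta> (s p) (cvec M' A \<psi> c (s p)) (cvec M' A \<psi> b (s p)) = D c b - D b c" for c b
  proof -
    have "\<beta> (s p) (cvec M' A \<psi> c (s p)) (cvec M' A \<psi> b (s p)) =
      D c b - D b c - \<alpha> (s p) (bracket M' (cvec M' A \<psi> c) (cvec M' A \<psi> b) (s p))"
      using d vfield_cvec U_pts \<open>s p \<in> A\<close> unfolding has_ext_deriv_def D_def a_def by blast
    then show ?thesis
      using bracket_cvec[OF \<open>s p \<in> A\<close>] form1_tzero[OF \<alpha> smooth_map_on_pts(2)[OF s pU]] by simp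
  qed
  have "\<beta> (s p) (push M' s p (X p)) (push M' s p (Y p)) =
    (\<Sum>c\<in>Basis. \<Sum>b\<in>Basis. ((vapply (X p) \<rho> \<bullet> c) * (vapply (Y p) \<rho> \<bullet> b)) *\<^sub>R (D c b - D b c))"
    using form2_components[OF c(2) push_tspace[OF M s pU vfield_tspace[OF W(2,4)]]
        push_tspace[OF M s pU vfield_tspace[OF W(3,4)]], of \<beta>] bil[OF smooth_map_on_pts(2)[OF s pU]]
    by (simp add: vp[OF S(2)] \<beta>)
  also have "\<dots> = (\<Sum>c\<in>Basis. \<Sum>b\<in>Basis. ((vapply (X p) \<rho> \<bullet> c) * (vapply (Y p) \<rho> \<bullet> b)) *\<^sub>R D c b) -
     (\<Sum>c\<in>Basis. \<Sum>b\<in>Basis. ((vapply (X p) \<rho> \<bullet> c) * (vapply (Y p) \<rho> \<bullet> b)) *\<^sub>R D b c)"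
    by (simp add: scaleR_diff_right sum_subtractf)
  also have "(\<Sum>c\<in>Basis. \<Sum>b\<in>Basis. ((vapply (X p) \<rho> \<bullet> c) * (vapply (Y p) \<rho> \<bullet> b)) *\<^sub>R D c b) =
      (\<Sum>b\<in>Basis. (vapply (Y p) \<rho> \<bullet> b) *\<^sub>R (\<Sum>c\<in>Basis. (vapply (X p) \<rho> \<bullet> c) *\<^sub>R D c b))"
    by (subst sum.swap) (simp add: scaleR_sum_right mult.commute)
  also have "(\<Sum>c\<in>Basis. \<Sum>b\<in>Basis. ((vapply (X p) \<rho> \<bullet> c) * (vapply (Y p) \<rho> \<bullet> b)) *\<^sub>R D b c) =
      (\<Sum>b\<in>Basis. (vapply (X p) \<rho> \<bullet> b) *\<^sub>R (\<Sum>c\<in>Basis. (vapply (Y p) \<rho> \<bullet> c) *\<^sub>R D c b))"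
    by (simp add: scaleR_sum_right)
  finally show "\<beta> (s p) (push M' s p (X p)) (push M' s p (Y p)) =
      vapply (X p) (\<lambda>q. \<alpha> (s q) (push M' s q (Y q))) - vapply (Y p) (\<lambda>q. \<alpha> (s q) (push M' s q (X q))) -
      \<alpha> (s p) (push M' s p (bracket M X Y p))"
    unfolding deriv_sum[OF W(2,3)] deriv_sum[OF W(3,2)] br by simp
qed


section \<open>Open submanifolds and products\<close>

lemma Cinf_on_Pair:
  fixes F :: "'a::euclidean_space \<Rightarrow> 'b::real_normed_vector" and G :: "'a \<Rightarrow> 'c::real_normed_vector"
  assumes "Cinf_on S F" "Cinf_on S G"
  shows "Cinf_on S (\<lambda>x. (F x, G x))"
proof -
  have "bounded_linear (\<lambda>x::'b. (x, 0::'c))" "bounded_linear (\<lambda>x::'c. (0::'b, x))"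
    by (intro bounded_linear_Pair bounded_linear_ident bounded_linear_zero)+
  from Cinf_on_add[OF Cinf_on_linear_comp[OF this(1) assms(1)] Cinf_on_linear_comp[OF this(2) assms(2)]]
  show ?thesis by simp
qed

lemma smooth_at_Pair:
  assumes "smooth_atlas M" "smooth_at M p g" "smooth_at M p h"
  shows "smooth_at M p (\<lambda>x. (g x, h x))"
  by (rule smooth_at_combine[OF assms Cinf_on_Pair])

lemma pts_open_mfd [simp]: "pts (open_mfd S) = S"
  by (simp add: pts_def open_mfd_def)

lemma pts_mprod [simp]: "pts (mprod M M') = pts M \<times> pts M'"
  by (simp add: pts_def mprod_def)

lemma smooth_atlas_open_mfd:
  assumes "open S"
  shows "smooth_atlas (open_mfd S)"
proof -
  have "Cinf_on S (id \<circ> inv_into S id)"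
    using Cinf_on_cong[OF assms, of "id \<circ> inv_into S id" "\<lambda>x. x"]
      Cinf_on_bounded_linear[OF bounded_linear_ident, of S] f_inv_into_f[of _ id S] by (simp add: id_def)
  then have "compatible_charts (S, id) (S, id)"
    by (simp add: compatible_charts_def)
  moreover have "is_chart (top_of_set S) (S, id)"
    using assms by (simp add: is_chart_def subtopology_subtopology homeomorphic_map_id[unfolded id_def] id_def)
  ultimately show ?thesis
    by (simp add: smooth_atlas_def open_mfd_def pts_def)
qed

lemma open_mfd_chart: "open S \<Longrightarrow> smooth_chart (open_mfd S) S id"
  by unfold_locales (auto simp: smooth_atlas_open_mfd, simp add: open_mfd_def)

section \<open>Product charts and the factors of a product manifold\<close>

lemma inv_into_map_prod:
  assumes "inj_on \<phi> U" "inj_on \<psi> W" "a \<in> \<phi> ` U" "b \<in> \<psi> ` W"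
  shows "inv_into (U \<times> W) (map_prod \<phi> \<psi>) (a, b) = (inv_into U \<phi> a, inv_into W \<psi> b)"
proof (rule inv_into_f_eq)
  show "inj_on (map_prod \<phi> \<psi>) (U \<times> W)" using assms by (simp add: map_prod_inj_on)
  show "(inv_into U \<phi> a, inv_into W \<psi> b) \<in> U \<times> W" using assms by (simp add: inv_into_into)
  show "map_prod \<phi> \<psi> (inv_into U \<phi> a, inv_into W \<psi> b) = (a, b)"
    using assms by (simp add: f_inv_into_f)
qed

lemma is_chart_map_prod:
  assumes "is_chart T (U, \<phi>)" "is_chart T' (W, \<psi>)"
  shows "is_chart (prod_topology T T') (U \<times> W, map_prod \<phi> \<psi>)"
proof -
  from assms have h: "homeomorphic_map (subtopology T U) (top_of_set (\<phi> ` U)) \<phi>"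
    "homeomorphic_map (subtopology T' W) (top_of_set (\<psi> ` W)) \<psi>"
    and o: "openin T U" "open (\<phi> ` U)" "openin T' W" "open (\<psi> ` W)"
    by (auto simp: is_chart_def)
  have "homeomorphic_map (prod_topology (subtopology T U) (subtopology T' W))
      (prod_topology (top_of_set (\<phi> ` U)) (top_of_set (\<psi> ` W))) (\<lambda>(x, y). (\<phi> x, \<psi> y))"
    using h unfolding homeomorphic_map_maps using homeomorphic_maps_prod by blast
  then have "homeomorphic_map (subtopology (prod_topology T T') (U \<times> W))
      (top_of_set (\<phi> ` U \<times> \<psi> ` W)) (map_prod \<phi> \<psi>)"
    by (simp add: subtopology_Times map_prod_def)
  then show ?thesis
    using o by (simp add: is_chart_def openin_prod_Times_iff map_prod_surj_on[OF refl refl] open_Times)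
qed

lemma Cinf_on_map_prod:
  fixes F :: "'a::euclidean_space \<Rightarrow> 'b::euclidean_space" and G :: "'c::euclidean_space \<Rightarrow> 'd::euclidean_space"
  assumes "Cinf_on A F" "Cinf_on B G"
  shows "Cinf_on (A \<times> B) (map_prod F G)"
proof -
  have "Cinf_on (A \<times> B) (\<lambda>x. (F (fst x), G (snd x)))"
    by (intro Cinf_on_Pair Cinf_on_compose[OF Cinf_on_bounded_linear[OF bounded_linear_fst] assms(1)]
        Cinf_on_compose[OF Cinf_on_bounded_linear[OF bounded_linear_snd] assms(2)]) auto
  then show ?thesis by (simp add: map_prod_def case_prod_unfold)
qed

text \<open>Only one of the two transition maps is treated; exchanging the roles of the charts gives
  the other half of compatibility.\<close>

lemma compatible_charts_map_prod:
  assumes c: "is_chart T (U, \<phi>)" "is_chart T' (W, \<psi>)" "is_chart T (U2, \<phi>2)" "is_chart T' (W2, \<psi>2)"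
    and "compatible_charts (U, \<phi>) (U2, \<phi>2)" "compatible_charts (W, \<psi>) (W2, \<psi>2)"
    and "smooth_chart M U \<phi>" "smooth_chart M U2 \<phi>2" "smooth_chart M' W \<psi>" "smooth_chart M' W2 \<psi>2"
  shows "Cinf_on (map_prod \<phi> \<psi> ` ((U \<times> W) \<inter> (U2 \<times> W2)))
    (map_prod \<phi>2 \<psi>2 \<circ> inv_into (U \<times> W) (map_prod \<phi> \<psi>))"
proof -
  interpret a: smooth_chart M U \<phi> by fact
  interpret b: smooth_chart M U2 \<phi>2 by fact
  interpret a': smooth_chart M' W \<psi> by fact
  interpret b': smooth_chart M' W2 \<psi>2 by fact
  have im: "map_prod \<phi> \<psi> ` ((U \<times> W) \<inter> (U2 \<times> W2)) = \<phi> ` (U \<inter> U2) \<times> \<psi> ` (W \<inter> W2)"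
    by (simp add: Times_Int_Times map_prod_surj_on[OF refl refl])
  have o: "open (\<phi> ` (U \<inter> U2) \<times> \<psi> ` (W \<inter> W2))"
    using a.openin_U b.openin_U a'.openin_U b'.openin_U
    by (intro open_Times a.open_image a'.open_image) auto
  have "Cinf_on (\<phi> ` (U \<inter> U2) \<times> \<psi> ` (W \<inter> W2)) (map_prod (\<phi>2 \<circ> inv_into U \<phi>) (\<psi>2 \<circ> inv_into W \<psi>))"
    using assms(5,6) by (intro Cinf_on_map_prod) (auto simp: compatible_charts_def)
  then show ?thesis
    unfolding im
  proof (subst Cinf_on_cong[OF o, of _ "map_prod (\<phi>2 \<circ> inv_into U \<phi>) (\<psi>2 \<circ> inv_into W \<psi>)"])
    fix x assume "x \<in> \<phi> ` (U \<inter> U2) \<times> \<psi> ` (W \<inter> W2)"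
    then obtain u w where uw: "u \<in> U" "w \<in> W" "x = (\<phi> u, \<psi> w)" by auto
    then show "(map_prod \<phi>2 \<psi>2 \<circ> inv_into (U \<times> W) (map_prod \<phi> \<psi>)) x =
        map_prod (\<phi>2 \<circ> inv_into U \<phi>) (\<psi>2 \<circ> inv_into W \<psi>) x"
      using inv_into_map_prod[OF a.inj a'.inj, of "\<phi> u" "\<psi> w"] by simp
  qed
qed

lemma smooth_atlas_mprod:
  assumes "smooth_atlas M" "smooth_atlas M'"
  shows "smooth_atlas (mprod M M')"
  unfolding smooth_atlas_def
proof (intro conjI ballI)
  show "(\<Union>c\<in>atlas (mprod M M'). fst c) = pts (mprod M M')"
  proof (intro equalityI subsetI)
    fix x assume "x \<in> (\<Union>c\<in>atlas (mprod M M'). fst c)"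
    then show "x \<in> pts (mprod M M')"
      using assms unfolding smooth_atlas_def by (fastforce simp: mprod_def pts_def)
  next
    fix x assume "x \<in> pts (mprod M M')"
    then obtain U \<phi> W \<psi> where "(U, \<phi>) \<in> atlas M" "fst x \<in> U" "(W, \<psi>) \<in> atlas M'" "snd x \<in> W"
      using smooth_atlasE[OF assms(1), of "fst x"] smooth_atlasE[OF assms(2), of "snd x"]
      by (metis mem_Times_iff pts_mprod)
    then have "(U \<times> W, map_prod \<phi> \<psi>) \<in> atlas (mprod M M')" "x \<in> U \<times> W"
      by (auto simp: mprod_def mem_Times_iff)
    then show "x \<in> (\<Union>c\<in>atlas (mprod M M'). fst c)" by force
  qed
next
  fix c assume "c \<in> atlas (mprod M M')"
  then show "is_chart (mtop (mprod M M')) c"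
    using assms unfolding smooth_atlas_def by (auto simp: mprod_def intro!: is_chart_map_prod)
next
  fix c c' assume c: "c \<in> atlas (mprod M M')" "c' \<in> atlas (mprod M M')"
  then obtain U \<phi> W \<psi> U2 \<phi>2 W2 \<psi>2 where
    e: "c = (U \<times> W, map_prod \<phi> \<psi>)" "c' = (U2 \<times> W2, map_prod \<phi>2 \<psi>2)"
    and a: "(U, \<phi>) \<in> atlas M" "(W, \<psi>) \<in> atlas M'" "(U2, \<phi>2) \<in> atlas M" "(W2, \<psi>2) \<in> atlas M'"
    by (auto simp: mprod_def)
  have ch: "smooth_chart M U \<phi>" "smooth_chart M' W \<psi>" "smooth_chart M U2 \<phi>2" "smooth_chart M' W2 \<psi>2"
    by (unfold_locales; use assms a in blast)+
  have "compatible_charts (U, \<phi>) (U2, \<phi>2)" "compatible_charts (W, \<psi>) (W2, \<psi>2)"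
    "compatible_charts (U2, \<phi>2) (U, \<phi>)" "compatible_charts (W2, \<psi>2) (W, \<psi>)"
    using assms a unfolding smooth_atlas_def by blast+
  then show "compatible_charts c c'"
    unfolding e compatible_charts_def[of "(U \<times> W, map_prod \<phi> \<psi>)"]
    using compatible_charts_map_prod[OF ch[THEN smooth_chart.is_chart]]
      compatible_charts_map_prod[OF ch(3,4,1,2)[THEN smooth_chart.is_chart]] ch
    by (simp add: Int_commute)
qed

lemma mprod_chart:
  assumes "smooth_chart M U \<phi>" "smooth_chart M' W \<psi>"
  shows "smooth_chart (mprod M M') (U \<times> W) (map_prod \<phi> \<psi>)"
proof
  show "smooth_atlas (mprod M M')"
    using assms by (intro smooth_atlas_mprod) (auto simp: smooth_chart_def)
  show "(U \<times> W, map_prod \<phi> \<psi>) \<in> atlas (mprod M M')"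
    using assms by (auto simp: mprod_def smooth_chart_def)
qed

lemma smooth_at_fst:
  assumes "smooth_atlas M" "smooth_atlas M'" "smooth_at M (fst y) h" "snd y \<in> pts M'"
  shows "smooth_at (mprod M M') y (\<lambda>y. h (fst y))"
proof -
  obtain U \<phi> where c: "(U, \<phi>) \<in> atlas M" "fst y \<in> U"
    using assms(1) smooth_at_pts[OF assms(1,3)] by (rule smooth_atlasE)
  obtain W \<psi> where c': "(W, \<psi>) \<in> atlas M'" "snd y \<in> W"
    using assms(2,4) by (rule smooth_atlasE)
  interpret a: smooth_chart M U \<phi> by unfold_locales (use assms c in auto)
  interpret b: smooth_chart M' W \<psi> by unfold_locales (use assms c' in auto)
  interpret smooth_chart "mprod M M'" "U \<times> W" "map_prod \<phi> \<psi>"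
    by (rule mprod_chart[OF a.smooth_chart_axioms b.smooth_chart_axioms])
  obtain S where S: "open S" "\<phi> (fst y) \<in> S" "S \<subseteq> \<phi> ` U" "Cinf_on S (h \<circ> inv_into U \<phi>)"
    using a.smooth_atE[OF assms(3) c(2)] by blast
  have "Cinf_on (S \<times> UNIV) (\<lambda>x. (h \<circ> inv_into U \<phi>) (fst x))"
    using S(4) by (rule Cinf_on_compose[OF Cinf_on_bounded_linear[OF bounded_linear_fst]]) auto
  then have "smooth_at (mprod M M') y (\<lambda>q. (h \<circ> inv_into U \<phi>) (fst (map_prod \<phi> \<psi> q)))"
    by (intro smooth_at_comp_chart[of _ "S \<times> UNIV"] open_Times S(1) open_UNIV)
      (use c c' S in \<open>auto simp: mem_Times_iff\<close>)
  then show ?thesis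
    by (rule smooth_at_cong_imp[OF atl openin_U, rotated 2]) (use c c' in \<open>auto simp: mem_Times_iff\<close>)
qed

lemma smooth_at_snd:
  assumes "smooth_atlas M" "smooth_atlas M'" "smooth_at M' (snd y) h" "fst y \<in> pts M"
  shows "smooth_at (mprod M M') y (\<lambda>y. h (snd y))"
proof -
  obtain U \<phi> where c: "(U, \<phi>) \<in> atlas M" "fst y \<in> U"
    using assms(1,4) by (rule smooth_atlasE)
  obtain W \<psi> where c': "(W, \<psi>) \<in> atlas M'" "snd y \<in> W"
    using assms(2) smooth_at_pts[OF assms(2,3)] by (rule smooth_atlasE)
  interpret a: smooth_chart M U \<phi> by unfold_locales (use assms c in auto)
  interpret b: smooth_chart M' W \<psi> by unfold_locales (use assms c' in auto)
  interpret smooth_chart "mprod M M'" "U \<times> W" "map_prod \<phi> \<psi>"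
    by (rule mprod_chart[OF a.smooth_chart_axioms b.smooth_chart_axioms])
  obtain S where S: "open S" "\<psi> (snd y) \<in> S" "S \<subseteq> \<psi> ` W" "Cinf_on S (h \<circ> inv_into W \<psi>)"
    using b.smooth_atE[OF assms(3) c'(2)] by blast
  have "Cinf_on (UNIV \<times> S) (\<lambda>x. (h \<circ> inv_into W \<psi>) (snd x))"
    using S(4) by (rule Cinf_on_compose[OF Cinf_on_bounded_linear[OF bounded_linear_snd]]) auto
  then have "smooth_at (mprod M M') y (\<lambda>q. (h \<circ> inv_into W \<psi>) (snd (map_prod \<phi> \<psi> q)))"
    by (intro smooth_at_comp_chart[of _ "UNIV \<times> S"] open_Times S(1) open_UNIV)
      (use c c' S in \<open>auto simp: mem_Times_iff\<close>)
  then show ?thesis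
    by (rule smooth_at_cong_imp[OF atl openin_U, rotated 2]) (use c c' in \<open>auto simp: mem_Times_iff\<close>)
qed

lemma mtop_mprod: "mtop (mprod M M') = prod_topology (mtop M) (mtop M')"
  by (simp add: mprod_def)

lemma smooth_map_on_fst:
  assumes "smooth_atlas M" "smooth_atlas M'" "openin (mtop (mprod M M')) U"
  shows "smooth_map_on (mprod M M') U M fst"
proof -
  have "smooth_at (mprod M M') p (\<phi> \<circ> fst)" if "p \<in> U" "(W, \<phi>) \<in> atlas M" "fst p \<in> W" for p W \<phi>
  proof -
    interpret smooth_chart M W \<phi> by unfold_locales (use assms that in auto)
    show ?thesis
      using smooth_at_fst[OF assms(1,2) smooth_at_chart[OF that(3)]] openin_pts[OF assms(3) that(1)]
      by (auto simp: o_def)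
  qed
  then show ?thesis
    using assms(3) unfolding smooth_map_on_def mtop_mprod by (auto intro: continuous_intros)
qed

lemma smooth_map_on_snd:
  assumes "smooth_atlas M" "smooth_atlas M'" "openin (mtop (mprod M M')) U"
  shows "smooth_map_on (mprod M M') U M' snd"
proof -
  have "smooth_at (mprod M M') p (\<phi> \<circ> snd)" if "p \<in> U" "(W, \<phi>) \<in> atlas M'" "snd p \<in> W" for p W \<phi>
  proof -
    interpret smooth_chart M' W \<phi> by unfold_locales (use assms that in auto)
    show ?thesis
      using smooth_at_snd[OF assms(1,2) smooth_at_chart[OF that(3)]] openin_pts[OF assms(3) that(1)]
      by (auto simp: o_def)
  qed
  then show ?thesis
    using assms(3) unfolding smooth_map_on_def mtop_mprod by (auto intro: continuous_intros)
qed

lemma smooth_map_on_Pair: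
  assumes M: "smooth_atlas M" and F: "smooth_map_on M U M1 F" and G: "smooth_map_on M U M2 G"
  shows "smooth_map_on M U (mprod M1 M2) (\<lambda>q. (F q, G q))"
  unfolding smooth_map_on_def mtop_mprod
proof (intro conjI ballI)
  show "openin (mtop M) U" by (rule smooth_map_on_openin[OF F])
  show "continuous_map (subtopology (mtop M) U) (prod_topology (mtop M1) (mtop M2)) (\<lambda>q. (F q, G q))"
    using F G by (auto simp: smooth_map_on_def intro: continuous_intros)
  fix p c assume p: "p \<in> U" and "c \<in> atlas (mprod M1 M2)"
  then obtain A \<phi> B \<psi> where c: "c = (A \<times> B, map_prod \<phi> \<psi>)" "(A, \<phi>) \<in> atlas M1" "(B, \<psi>) \<in> atlas M2"
    by (auto simp: mprod_def)
  have "smooth_at M p (\<lambda>q. (\<phi> (F q), \<psi> (G q)))" if "F p \<in> A" "G p \<in> B"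
    using F G p c that unfolding smooth_map_on_def by (intro smooth_at_Pair M) (fastforce simp: o_def)+
  then show "case c of (W, \<psi>) \<Rightarrow> (F p, G p) \<in> W \<longrightarrow> smooth_at M p (\<psi> \<circ> (\<lambda>q. (F q, G q)))"
    by (auto simp: c o_def)
qed

lemma openin_smooth_vimage:
  assumes "smooth_atlas M" "openin (mtop M) U" "\<And>p. p \<in> U \<Longrightarrow> smooth_at M p F" "open T"
  shows "openin (mtop M) {q \<in> U. F q \<in> T}"
proof (subst openin_subopen, intro ballI)
  fix p assume "p \<in> {q \<in> U. F q \<in> T}"
  then have p: "p \<in> U" "F p \<in> T" by auto
  obtain A \<phi> where c: "(A, \<phi>) \<in> atlas M" "p \<in> A"
    using assms(1) openin_pts[OF assms(2) p(1)] by (rule smooth_atlasE)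
  interpret smooth_chart M A \<phi> by unfold_locales (use assms c in auto)
  obtain W where W: "open W" "\<phi> p \<in> W" "W \<subseteq> \<phi> ` A" "Cinf_on W (F \<circ> inv_into A \<phi>)"
    using smooth_atE[OF assms(3)[OF p(1)] c(2)] by blast
  have o: "open (W \<inter> (F \<circ> inv_into A \<phi>) -` T)"
    by (rule continuous_open_preimage[OF Cinf_on_imp_continuous_on[OF W(4)] W(1) assms(4)])
  show "\<exists>S. openin (mtop M) S \<and> p \<in> S \<and> S \<subseteq> {q \<in> U. F q \<in> T}"
    by (rule exI[of _ "U \<inter> {q \<in> A. \<phi> q \<in> W \<inter> (F \<circ> inv_into A \<phi>) -` T}"])
      (use openin_vimage[OF o] assms(2) p c W in auto)
qed

lemma smooth_map_on_open_mfd: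
  assumes "smooth_atlas M" "openin (mtop M) U" "open S" "F ` U \<subseteq> S" "\<And>p. p \<in> U \<Longrightarrow> smooth_at M p F"
  shows "smooth_map_on M U (open_mfd S) F"
proof (rule smooth_map_onI[OF assms(1) smooth_atlas_open_mfd[OF assms(3)] assms(2)])
  show "openin (mtop M) {q \<in> U. F q \<in> T}" if T: "openin (mtop (open_mfd S)) T" for T
    using openin_smooth_vimage[OF assms(1,2,5), of T] T openin_open_trans[OF _ assms(3)]
    by (simp add: open_mfd_def)
  show "smooth_at M p (\<lambda>q. \<psi> (F q))" if "p \<in> U" "(W, \<psi>) \<in> atlas (open_mfd S)" for p W \<psi>
    using assms(5)[OF that(1)] that(2) by (simp add: open_mfd_def)
qed (use assms in auto)


section \<open>Vectors and forms of type \<open>(1, 0)\<close>\<close>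

lemma almost_complexD:
  assumes "almost_complex M J" "p \<in> pts M" "u \<in> tspace M p"
  shows "J p u \<in> tspace M p" "J p (J p u) = lincomb (-1) u 0 u"
  using assms by (auto simp: almost_complex_def)

lemma almost_complex_lincomb:
  assumes "almost_complex M J" "p \<in> pts M" "u \<in> tspace M p" "v \<in> tspace M p"
  shows "J p (lincomb a u b v) = lincomb a (J p u) b (J p v)"
  using assms by (auto simp: almost_complex_def)

lemma almost_complex_tzero:
  assumes "almost_complex M J" "p \<in> pts M"
  shows "J p tzero = tzero"
  using almost_complex_lincomb[OF assms tzero_tspace tzero_tspace, of 0 0] by (simp add: lincomb_0_0)

lemma almost_complex_vfield: "almost_complex M J \<Longrightarrow> vfield M W X \<Longrightarrow> vfield M W (\<lambda>p. J p (X p))"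
  by (simp add: almost_complex_def)

text \<open>The vector u - iJu, twice the (1, 0)-part of u. Dropping the factor 1/2 makes the real
  part equal to \<open>u\<close>, so \<open>re_vec\<close> is the inverse map; the price is a factor
  2 for each argument in \<open>cext1_c10\<close> and \<open>cext2_c10\<close>.\<close>

definition c10 :: "'a endo \<Rightarrow> 'a \<Rightarrow> 'a tvec \<Rightarrow> 'a ctvec" where
  "c10 J p u = (\<lambda>h. Complex (u h) (- J p u h))"

lemma re_vec_c10 [simp]: "re_vec (c10 J p u) = u"
  by (simp add: re_vec_def c10_def)

lemma im_vec_c10: "im_vec (c10 J p u) = lincomb (-1) (J p u) 0 (J p u)"
  by (simp add: im_vec_def c10_def lincomb_def)

lemma c10_T10:
  assumes "almost_complex M J" "p \<in> pts M" "u \<in> tspace M p"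
  shows "c10 J p u \<in> T10 M J p"
proof -
  note Ju = almost_complexD[OF assms]
  have "J p (im_vec (c10 J p u)) h = u h" for h
    unfolding im_vec_c10 almost_complex_lincomb[OF assms(1,2) Ju(1) Ju(1)] Ju(2)
    by (simp add: lincomb_def)
  then show ?thesis
    unfolding T10_def using assms(3) Ju(1)
    by (auto simp: im_vec_c10 lincomb_tspace complex_eq_iff) (auto simp: c10_def)
qed

text \<open>The real part of the eigenvector equation already reads J(Re w) = - Im w, so the real
  part determines the vector.\<close>

lemma T10_eq_c10:
  assumes "w \<in> T10 M J p"
  shows "w = c10 J p (re_vec w)" "re_vec w \<in> tspace M p"
proof -
  have "Complex (J p (re_vec w) h) (J p (im_vec w) h) = \<i> * w h" for h
    using assms by (simp add: T10_def)
  then have "J p (re_vec w) h = - Im (w h)" for h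
    by (metis complex.sel(1) Re_i_times)
  then show "w = c10 J p (re_vec w)"
    by (auto simp: c10_def re_vec_def complex_eq_iff fun_eq_iff)
  show "re_vec w \<in> tspace M p" using assms by (simp add: T10_def)
qed

lemma push_c10:
  assumes "push M' F p (J p u) = J' (F p) (push M' F p u)"
  shows "push M' F p (c10 J p u) = c10 J' (F p) (push M' F p u)"
proof
  fix h
  show "push M' F p (c10 J p u) h = c10 J' (F p) (push M' F p u) h"
    using fun_cong[OF assms, of h] by (auto simp: push_def c10_def complex_eq_iff split: if_splits)
qed

lemma hol_map_onD:
  assumes "hol_map_on M J U M' J' F"
  shows "smooth_map_on M U M' F"
    "p \<in> U \<Longrightarrow> v \<in> tspace M p \<Longrightarrow> push M' F p (J p v) = J' (F p) (push M' F p v)"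
  using assms by (auto simp: hol_map_on_def)

lemma hol_map_push_T10:
  assumes "smooth_atlas M" "smooth_atlas M'" "almost_complex M' J'" "hol_map_on M J U M' J' F"
    "p \<in> U" "w \<in> T10 M J p"
  shows "push M' F p w \<in> T10 M' J' (F p)"
proof -
  note w = T10_eq_c10[OF assms(6)] and F = hol_map_onD[OF assms(4)]
  have "push M' F p w = c10 J' (F p) (push M' F p (re_vec w))"
    using push_c10[of M' F p J "re_vec w" J'] F(2)[OF assms(5) w(2)] w(1) by simp
  then show ?thesis
    using c10_T10[OF assms(3) smooth_map_on_pts(2)[OF F(1) assms(5)]
        push_tspace[OF assms(1,2) F(1) assms(5) w(2)]] by simp
qed

lemma cext1_c10:
  assumes "is_form1 M U \<alpha>" "p \<in> U" "u \<in> tspace M p" "J p u \<in> tspace M p" "\<alpha> p (J p u) = \<i> * \<alpha> p u"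
  shows "cext1 \<alpha> p (c10 J p u) = 2 * \<alpha> p u"
  unfolding cext1_def re_vec_c10 im_vec_c10 form1_lincomb[OF assms(1,2,4,4)] assms(5) by simp

text \<open>With \<open>\<beta>\<close> complex bilinear for \<open>J\<close>, each argument u - iJu
  counts as 2u.\<close>

lemma cext2_c10:
  fixes \<beta> :: "('a, complex) form2"
  assumes J: "almost_complex M J" "p \<in> pts M" "u \<in> tspace M p" "v \<in> tspace M p"
    and bil: "\<And>u v w a b. u \<in> tspace M p \<Longrightarrow> v \<in> tspace M p \<Longrightarrow> w \<in> tspace M p \<Longrightarrow>
      \<beta> p (lincomb a u b v) w = a *\<^sub>R \<beta> p u w + b *\<^sub>R \<beta> p v w \<and>
      \<beta> p w (lincomb a u b v) = a *\<^sub>R \<beta> p w u + b *\<^sub>R \<beta> p w v"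
    and \<beta>J: "\<And>u v. u \<in> tspace M p \<Longrightarrow> v \<in> tspace M p \<Longrightarrow>
      \<beta> p (J p u) v = \<i> * \<beta> p u v \<and> \<beta> p u (J p v) = \<i> * \<beta> p u v"
  shows "cext2 \<beta> p (c10 J p u) (c10 J p v) = 4 * \<beta> p u v"
proof -
  note Ju = almost_complexD(1)[OF J(1-3)] and Jv = almost_complexD(1)[OF J(1,2,4)]
  have n: "lincomb (-1) (J p w) 0 (J p w) \<in> tspace M p" if "w \<in> tspace M p" for w
    by (intro lincomb_tspace almost_complexD(1)[OF J(1,2)] that)
  have "\<beta> p u (lincomb (-1) (J p v) 0 (J p v)) = - (\<i> * \<beta> p u v)"
    "\<beta> p (lincomb (-1) (J p u) 0 (J p u)) v = - (\<i> * \<beta> p u v)"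
    "\<beta> p (lincomb (-1) (J p u) 0 (J p u)) (lincomb (-1) (J p v) 0 (J p v)) = - \<beta> p u v"
    using bil[OF Jv Jv J(3)] bil[OF Ju Ju J(4)] bil[OF Ju Ju n[OF J(4)]] bil[OF Jv Jv Ju]
      \<beta>J[OF J(3,4)] \<beta>J[OF J(3) Jv] \<beta>J[OF J(3) Jv]
    by (auto simp: mult.assoc[symmetric])
  then show ?thesis
    unfolding cext2_def re_vec_c10 im_vec_c10 by (simp add: mult.assoc[symmetric])
qed

lemma vfield_Int:
  assumes "vfield M U X" "vfield M W Y"
  shows "vfield M (U \<inter> W) X" "vfield M (U \<inter> W) Y"
  using assms openin_Int[OF assms[THEN vfield_openin]] by (auto intro: vfield_subset)

lemma has_ext_derivD:
  assumes "has_ext_deriv M U \<alpha> \<beta>" "W \<subseteq> U" "vfield M W X" "vfield M W Y" "p \<in> W"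
  shows "\<beta> p (X p) (Y p) =
    vapply (X p) (\<lambda>q. \<alpha> q (Y q)) - vapply (Y p) (\<lambda>q. \<alpha> q (X q)) - \<alpha> p (bracket M X Y p)"
  using assms by (auto simp: has_ext_deriv_def)

lemma ext_deriv_locals:
  fixes \<alpha> :: "('a, complex) form1"
  assumes "smooth_atlas M" "is_form1 M U \<alpha>" "has_ext_deriv M U \<alpha> \<beta>" "W \<subseteq> U" "vfield M W X" "vfield M W Y" "p \<in> W"
  shows "vapply (X p) (\<lambda>q. \<alpha> q (Y q)) = \<beta> p (X p) (Y p) + vapply (Y p) (\<lambda>q. \<alpha> q (X q)) + \<alpha> p (bracket M X Y p)"
  using has_ext_derivD[OF assms(3-7)] by simp

text \<open>For a holomorphic vector field \<open>X\<close>, Cartan's formula reduces the equation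
  \<open>(J Y)(\<alpha>(X)) = \<i> Y(\<alpha>(X))\<close> to \<open>d\<alpha>(J Y, X) = \<i> d\<alpha>(Y, X)\<close>.\<close>

lemma hol_form1I:
  assumes M: "smooth_atlas M" "almost_complex M J" and U: "openin (mtop M) U" and \<alpha>: "is_form1 M U \<alpha>"
    and \<alpha>J: "\<And>p v. p \<in> U \<Longrightarrow> v \<in> tspace M p \<Longrightarrow> \<alpha> p (J p v) = \<i> * \<alpha> p v"
    and d: "has_ext_deriv M U \<alpha> \<beta>"
    and \<beta>J: "\<And>p u v. p \<in> U \<Longrightarrow> u \<in> tspace M p \<Longrightarrow> v \<in> tspace M p \<Longrightarrow> \<beta> p (J p u) v = \<i> * \<beta> p u v"
  shows "hol_form1 M J U \<alpha>"
  unfolding hol_form1_def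
proof (intro conjI ballI allI impI)
  fix W X assume W: "W \<subseteq> U" "hol_vfield M J W X"
  then have X: "vfield M W X" by (simp add: hol_vfield_def)
  show "hol_fun_on M J W (\<lambda>p. \<alpha> p (X p))"
    unfolding hol_fun_on_def
  proof (intro conjI ballI)
    show "openin (mtop M) W" by (rule vfield_openin[OF X])
    fix p assume p: "p \<in> W"
    show "smooth_at M p (\<lambda>p. \<alpha> p (X p))" by (rule form1_smooth[OF \<alpha> X W(1) p])
    fix v assume v: "v \<in> tspace M p"
    have pU: "p \<in> U" using p W by auto
    have pM: "p \<in> pts M" by (rule openin_pts[OF U pU])
    obtain T Y' where "vfield M T Y'" "p \<in> T" "Y' p = v"
      using tspace_extend[OF M(1) v pM] by blast
    then obtain S Y where S: "vfield M S Y" "p \<in> S" "Y p = v" "S \<subseteq> W" "vfield M S X"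
      using vfield_Int[OF X] p by (metis IntI inf_le1)
    have SU: "S \<subseteq> U" using S W by auto
    note JY = almost_complex_vfield[OF M(2) S(1)]
    \<comment> \<open>\<open>hol_vfield\<close> controls the bracket of \<open>X\<close> with JY.
      Antisymmetry moves \<open>X\<close> to the second slot, where Cartan's formula for the pairs
      (JY, X) and (Y, X) needs it.\<close>
    have br: "bracket M (\<lambda>q. J q (Y q)) X p = J p (bracket M Y X p)"
    proof -
      have neg: "bracket M A B p = lincomb (-1) (bracket M B A p) 0 tzero" for A B
        by (auto simp: bracket_def lincomb_def)
      have "bracket M X (\<lambda>q. J q (Y q)) p = J p (bracket M X Y p)"
        using W(2) S unfolding hol_vfield_def by blast
      then show ?thesis
        unfolding neg[of "\<lambda>q. J q (Y q)" X] neg[of Y X]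
        using almost_complex_lincomb[OF M(2) pM bracket_tspace[OF M(1) S(5,1,2)] tzero_tspace, of "-1" 0]
          almost_complex_tzero[OF M(2) pM] by simp
    qed
    have "vapply (J p v) (\<lambda>p. \<alpha> p (X p)) = \<beta> p (J p v) (X p) +
       vapply (X p) (\<lambda>q. \<alpha> q (J q (Y q))) + \<alpha> p (J p (bracket M Y X p))"
      using ext_deriv_locals[OF M(1) \<alpha> d SU JY S(5,2)] S(3) br by simp
    also have "vapply (X p) (\<lambda>q. \<alpha> q (J q (Y q))) = vapply (X p) (\<lambda>q. \<i> * \<alpha> q (Y q))"
      by (rule vapply_cong[OF M(1) vfield_tspace[OF X p] vfield_openin[OF S(1)] S(2)])
        (use \<alpha>J SU vfield_tspace[OF S(1)] in auto)
    also have "\<dots> = \<i> * vapply (X p) (\<lambda>q. \<alpha> q (Y q))"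
      by (rule vapply_linear[OF M(1) vfield_tspace[OF X p] bounded_linear_mult_right form1_smooth[OF \<alpha> S(1) SU S(2)]])
    also have "\<beta> p (J p v) (X p) = \<i> * \<beta> p v (X p)"
      by (rule \<beta>J[OF pU v vfield_tspace[OF X p]])
    also have "\<alpha> p (J p (bracket M Y X p)) = \<i> * \<alpha> p (bracket M Y X p)"
      by (rule \<alpha>J[OF pU bracket_tspace[OF M(1) S(1,5,2)]])
    finally show "vapply (J p v) (\<lambda>p. \<alpha> p (X p)) = \<i> * vapply v (\<lambda>p. \<alpha> p (X p))"
      using ext_deriv_locals[OF M(1) \<alpha> d SU S(1,5,2)] S(3) by (simp add: algebra_simps)
  qed
qed (use assms in auto)

text \<open>From \<open>\<alpha> = k \<alpha>'\<close> we get \<open>dk \<and> \<alpha>' = d\<alpha> - k d\<alpha>'\<close>, which is of type \<open>(2, 0)\<close>; so \<open>dk\<close> is of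
  type \<open>(1, 0)\<close> where \<open>\<alpha>'\<close> does not vanish.\<close>

lemma hol_fun_on_quotient:
  fixes \<alpha> \<alpha>' :: "('a, complex) form1"
  assumes M: "smooth_atlas M" "almost_complex M J" and U: "openin (mtop M) U"
    and \<alpha>: "is_form1 M U \<alpha>" and \<alpha>': "is_form1 M U \<alpha>'"
    and \<alpha>J: "\<And>p v. p \<in> U \<Longrightarrow> v \<in> tspace M p \<Longrightarrow> \<alpha>' p (J p v) = \<i> * \<alpha>' p v"
    and d: "has_ext_deriv M U \<alpha> \<beta>" "has_ext_deriv M U \<alpha>' \<beta>'"
    and \<beta>J: "\<And>p u v. p \<in> U \<Longrightarrow> u \<in> tspace M p \<Longrightarrow> v \<in> tspace M p \<Longrightarrow>
      \<beta> p (J p u) v = \<i> * \<beta> p u v \<and> \<beta>' p (J p u) v = \<i> * \<beta>' p u v"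
    and k: "\<And>p v. p \<in> U \<Longrightarrow> v \<in> tspace M p \<Longrightarrow> \<alpha> p v = k p * \<alpha>' p v"
    and nz: "\<And>p. p \<in> U \<Longrightarrow> \<exists>v\<in>tspace M p. \<alpha>' p v \<noteq> 0"
  shows "hol_fun_on M J U k"
  unfolding hol_fun_on_def
proof (intro conjI ballI U)
  fix p assume p: "p \<in> U"
  have pM: "p \<in> pts M" by (rule openin_pts[OF U p])
  obtain v where v: "v \<in> tspace M p" "\<alpha>' p v \<noteq> 0" using nz[OF p] by blast
  obtain T Y where Y: "vfield M T Y" "p \<in> T" "Y p = v"
    using tspace_extend[OF M(1) v(1) pM] by blast
  define S where "S = T \<inter> U"
  have S: "vfield M S Y" "p \<in> S" "S \<subseteq> U"
    using vfield_subset[OF Y(1) openin_Int[OF vfield_openin[OF Y(1)] U]] Y p by (auto simp: S_def)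
  have sm: "smooth_at M q (\<lambda>q. \<alpha> q (Y q))" "smooth_at M q (\<lambda>q. \<alpha>' q (Y q))" if "q \<in> S" for q
    using form1_smooth[OF \<alpha> S(1,3) that] form1_smooth[OF \<alpha>' S(1,3) that] .
  \<comment> \<open>The regularity of \<open>k\<close> is not assumed. Near \<open>p\<close> it is
    recovered as the quotient of the values of the two forms on \<open>Y\<close>, where the
    denominator stays nonzero.\<close>
  have o: "openin (mtop M) {q \<in> S. \<alpha>' q (Y q) \<in> - {0}}"
    by (rule openin_smooth_vimage[OF M(1) vfield_openin[OF S(1)] sm(2)]) auto
  have "smooth_at M p (\<lambda>q. \<alpha> q (Y q) * inverse (\<alpha>' q (Y q)))"
    using sm[OF S(2)] v Y
    by (intro smooth_at_bilinear[OF M(1) bounded_bilinear_mult] smooth_at_Cinf_comp[OF M(1) _ _ _ Cinf_on_inverse]) auto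
  then show sk: "smooth_at M p k"
    by (rule smooth_at_cong_imp[OF M(1) o, rotated 2])
      (use S v Y k vfield_tspace[OF S(1)] in \<open>auto simp: field_simps\<close>)
  fix u assume u: "u \<in> tspace M p"
  obtain T' X' where "vfield M T' X'" "p \<in> T'" "X' p = u"
    using tspace_extend[OF M(1) u pM] by blast
  then obtain R X where R: "vfield M R X" "p \<in> R" "X p = u" "R \<subseteq> S" "vfield M R Y"
    using vfield_Int[OF S(1)] S(2) by (metis IntI inf_le1)
  have RU: "R \<subseteq> U" using R S by auto
  have main: "\<beta> p (A p) (B p) = vapply (A p) k * \<alpha>' p (B p) - vapply (B p) k * \<alpha>' p (A p) + k p * \<beta>' p (A p) (B p)"
    if AB: "vfield M R A" "vfield M R B" for A B
  proof -
    have half: "vapply (A p) (\<lambda>q. \<alpha> q (B q)) = k p * vapply (A p) (\<lambda>q. \<alpha>' q (B q)) + vapply (A p) k * \<alpha>' p (B p)"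
      if AB: "vfield M R A" "vfield M R B" for A B
    proof -
      note A = vfield_tspace[OF AB(1) R(2)]
      have "vapply (A p) (\<lambda>q. \<alpha> q (B q)) = vapply (A p) (\<lambda>q. k q * \<alpha>' q (B q))"
        by (rule vapply_cong[OF M(1) A vfield_openin[OF R(1)] R(2)])
          (use k RU vfield_tspace[OF AB(2)] in auto)
      then show ?thesis
        using vapply_bilinear[OF M(1) A bounded_bilinear_mult sk form1_smooth[OF \<alpha>' AB(2) RU R(2)]]
        by simp
    qed
    have "\<beta> p (A p) (B p) = vapply (A p) (\<lambda>q. \<alpha> q (B q)) - vapply (B p) (\<lambda>q. \<alpha> q (A q)) -
        k p * \<alpha>' p (bracket M A B p)"
      using has_ext_derivD[OF d(1) RU AB R(2)] k[OF p bracket_tspace[OF M(1) AB R(2)]] by simp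
    then show ?thesis
      unfolding half[OF AB] half[OF AB(2,1)] has_ext_derivD[OF d(2) RU AB R(2)]
      by (simp add: algebra_simps)
  qed
  have "\<beta> p (J p u) v = \<i> * \<beta> p u v" "\<beta>' p (J p u) v = \<i> * \<beta>' p u v"
    using \<beta>J[OF p u v(1)] by auto
  \<comment> \<open>Subtract \<open>\<i>\<close> times the identity for (X, Y) from the one for (JX,
    Y). Type (2, 0) removes the differentials, type (1, 0) of \<open>\<alpha>'\<close> removes the
    terms with the derivative of \<open>k\<close> along \<open>v\<close>, and
    \<open>\<alpha>' p v\<close> can be cancelled from the rest.\<close>
  with main[OF almost_complex_vfield[OF M(2) R(1)] R(5)] main[OF R(1,5)]
  have "vapply (J p u) k * \<alpha>' p v - vapply v k * (\<i> * \<alpha>' p u) =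
      \<i> * (vapply u k * \<alpha>' p v - vapply v k * \<alpha>' p u)"
    unfolding R(3) Y(3) \<alpha>J[OF p u] by algebra
  then have "(vapply (J p u) k - \<i> * vapply u k) * \<alpha>' p v = 0"
    by algebra
  then show "vapply (J p u) k = \<i> * vapply u k" using v(2) by simp
qed


section \<open>The contact form of a quotient by \<open>\<complex>\<^sup>\<times>\<close>\<close>

text \<open>A kernel vector outside the span of \<open>k1\<close> and \<open>k2\<close> would be a
  third independent one. Together with a complement of the kernel it would embed a space of
  dimension \<open>DIM('k) + 3\<close> into \<open>'m\<close>.\<close>

lemma kernel_span:
  fixes L :: "'m::euclidean_space \<Rightarrow> 'k::euclidean_space"
  assumes "linear L" "surj L" "L k1 = 0" "L k2 = 0"
    and ind: "\<And>a b. a *\<^sub>R k1 + b *\<^sub>R k2 = 0 \<Longrightarrow> a = 0 \<and> b = 0"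
    and dim: "DIM('m) \<le> DIM('k) + 2" and w: "L w = 0"
  shows "\<exists>a b. w = a *\<^sub>R k1 + b *\<^sub>R k2"
proof (rule ccontr)
  assume nex: "\<nexists>a b. w = a *\<^sub>R k1 + b *\<^sub>R k2"
  obtain R where R: "linear R" "L \<circ> R = id"
    using linear_surjective_right_inverse[OF assms(1,2)] by blast
  \<comment> \<open>The right inverse \<open>R\<close> supplies the complement of the kernel.
    Applying \<open>L\<close> to \<open>T x\<close> isolates \<open>z\<close>, so injectivity
    reduces to independence of \<open>k1\<close>, \<open>k2\<close> and \<open>w\<close>.\<close>
  define T :: "real \<times> real \<times> real \<times> 'k \<Rightarrow> 'm" where
    "T = (\<lambda>(a, b, c, z). a *\<^sub>R k1 + b *\<^sub>R k2 + c *\<^sub>R w + R z)"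
  have lin: "linear T"
    unfolding T_def by (rule linearI) (auto simp: linear_add[OF R(1)] linear_scale[OF R(1)] algebra_simps)
  have "inj T"
    unfolding linear_injective_0[OF lin]
  proof (intro allI impI)
    fix x assume x: "T x = 0"
    obtain a b c z where abc: "x = (a, b, c, z)" by (cases x)
    have "L (T x) = z"
      using R(2) by (simp add: T_def abc linear_add[OF assms(1)] linear_scale[OF assms(1)] assms w fun_eq_iff)
    then have z: "z = 0" using x linear_0[OF assms(1)] by simp
    then have e: "a *\<^sub>R k1 + b *\<^sub>R k2 + c *\<^sub>R w = 0"
      using x linear_0[OF R(1)] by (simp add: T_def abc)
    have "c = 0"
    proof (rule ccontr)
      assume c: "c \<noteq> 0"
      have "c *\<^sub>R w = (- a) *\<^sub>R k1 + (- b) *\<^sub>R k2" using e by (simp add: algebra_simps eq_neg_iff_add_eq_0)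
      then have "inverse c *\<^sub>R (c *\<^sub>R w) = (inverse c * (- a)) *\<^sub>R k1 + (inverse c * (- b)) *\<^sub>R k2"
        by (simp only: scaleR_add_right scaleR_scaleR)
      then have "w = (inverse c * (- a)) *\<^sub>R k1 + (inverse c * (- b)) *\<^sub>R k2"
        by (simp only: scaleR_scaleR left_inverse[OF c] scaleR_one)
      then show False using nex by blast
    qed
    then show "x = 0" using e ind z abc by (auto simp: zero_prod_def)
  qed
  then have "dim (T ` UNIV) = dim (UNIV :: (real \<times> real \<times> real \<times> 'k) set)"
    using lin by (intro dim_image_eq) auto
  then have "DIM('k) + 3 \<le> DIM('m)"
    using dim_subset_UNIV[of "T ` UNIV"] by simp
  then show False using dim by simp
qed

section \<open>Algebra of the hyperkaehler forms and of the complex symplectic form\<close>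

lemma pseudo_hyperkahler_almost_complex:
  "pseudo_hyperkahler M g J \<Longrightarrow> a \<in> {1, 2, 3} \<Longrightarrow> almost_complex M (J a)"
  unfolding pseudo_hyperkahler_def complex_structure_def by blast

lemma pseudo_hyperkahler_bilinear:
  assumes "pseudo_hyperkahler M g J" "y \<in> pts M" "u \<in> tspace M y" "v \<in> tspace M y" "w \<in> tspace M y"
  shows "g y (lincomb a u b v) w = a * g y u w + b * g y v w"
    "g y w (lincomb a u b v) = a * g y w u + b * g y w v"
  using assms by (auto simp: pseudo_hyperkahler_def pseudo_riemannian_def is_tensor2_def)

lemma varpi_bilinear:
  assumes hk: "pseudo_hyperkahler M g J"
    and y: "y \<in> pts M" "u \<in> tspace M y" "v \<in> tspace M y" "w \<in> tspace M y"
  shows "varpi g J y (lincomb a u b v) w = a *\<^sub>R varpi g J y u w + b *\<^sub>R varpi g J y v w \<and>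
    varpi g J y w (lincomb a u b v) = a *\<^sub>R varpi g J y w u + b *\<^sub>R varpi g J y w v"
proof -
  note ac = pseudo_hyperkahler_almost_complex[OF hk]
  note t = almost_complexD(1)[OF ac y(1)]
  show ?thesis
    using y t[OF _ y(2)] t[OF _ y(3)] t[OF _ y(4)]
    by (simp add: varpi_def kahler_form_def complex_eq_iff almost_complex_lincomb[OF ac]
        pseudo_hyperkahler_bilinear[OF hk])
qed

text \<open>These properties are all that the quotient needs to know about the cone, so no
  quaternions enter below. The relation between \<open>K\<close> and the action is kept only as
  weight two in \<open>lam_act\<close> and verticality in \<open>K_vert\<close>.\<close>

locale twistor_quotient =
  fixes Nh :: "('h, 'eh::euclidean_space) mfd"
    and gh :: "('h, real) form2"
    and Jh :: "nat \<Rightarrow> 'h endo"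
    and K :: "'h \<Rightarrow> 'h tvec"
    and act :: "complex \<Rightarrow> 'h \<Rightarrow> 'h"
    and lam :: "('h, complex) form1"
    and Z :: "('z, 'ez::euclidean_space) mfd"
    and I :: "'z endo"
    and pz :: "'h \<Rightarrow> 'z"
  assumes hk: "pseudo_hyperkahler Nh gh Jh"
    and act: "hol_Cx_action Nh (Jh 3) act"
    and lam: "is_form1 Nh (pts Nh) lam"
    and dlam: "has_ext_deriv Nh (pts Nh) lam (varpi gh Jh)"
    and quot: "complex_quotient Nh (Jh 3) act Z I pz"
    and K: "\<And>y. y \<in> pts Nh \<Longrightarrow> K y \<in> tspace Nh y"
    and lam_act: "\<And>x y v. x \<noteq> 0 \<Longrightarrow> y \<in> pts Nh \<Longrightarrow> v \<in> tspace Nh y \<Longrightarrow>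
      lam (act x y) (push Nh (act x) y v) = x\<^sup>2 * lam y v"
    and varpi_K: "\<And>y v. y \<in> pts Nh \<Longrightarrow> v \<in> tspace Nh y \<Longrightarrow> varpi gh Jh y (K y) v = 2 * \<i> * lam y v"
    and lam_nz: "\<And>y. y \<in> pts Nh \<Longrightarrow> \<exists>v\<in>tspace Nh y. lam y v \<noteq> 0"
    and K_vert: "\<And>y. y \<in> pts Nh \<Longrightarrow> push Z pz y (K y) = tzero"
begin

abbreviation "J \<equiv> Jh 3"
abbreviation "\<Omega> \<equiv> varpi gh Jh"

lemma atl: "smooth_atlas Nh" "smooth_atlas Z"
  using hk quot smooth_manifold_imp_atlas by (auto simp: pseudo_hyperkahler_def complex_quotient_def)

lemmas ac = pseudo_hyperkahler_almost_complex[OF hk]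

lemma acJ: "almost_complex Nh J" and acI: "almost_complex Z I"
  using ac[of 3] quot by (auto simp: complex_quotient_def complex_structure_def)

lemmas g_bilinear = pseudo_hyperkahler_bilinear[OF hk]

lemma g_sym: "y \<in> pts Nh \<Longrightarrow> u \<in> tspace Nh y \<Longrightarrow> v \<in> tspace Nh y \<Longrightarrow> gh y u v = gh y v u"
  using hk by (auto simp: pseudo_hyperkahler_def pseudo_riemannian_def)

lemma kahler_alternating:
  assumes "a \<in> {1, 2, 3}" "y \<in> pts Nh" "u \<in> tspace Nh y" "v \<in> tspace Nh y"
  shows "gh y (Jh a y u) v = - gh y (Jh a y v) u"
proof -
  note Ju = almost_complexD[OF ac[OF assms(1)] assms(2,3)] and Jv = almost_complexD[OF ac[OF assms(1)] assms(2,4)]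
  have "gh y (Jh a y u) v = gh y (Jh a y (Jh a y u)) (Jh a y v)"
    using hk assms Ju(1) unfolding pseudo_hyperkahler_def by metis
  also have "\<dots> = - gh y u (Jh a y v)"
    using g_bilinear(1)[OF assms(2,3,3) Jv(1)] Ju(2) by simp
  finally show ?thesis using g_sym[OF assms(2,3) Jv(1)] by simp
qed

lemmas \<Omega>_bilinear = varpi_bilinear[OF hk]

lemma \<Omega>_alternating:
  assumes "y \<in> pts Nh" "u \<in> tspace Nh y" "v \<in> tspace Nh y"
  shows "\<Omega> y u v = - \<Omega> y v u"
  using kahler_alternating[OF _ assms, of 1] kahler_alternating[OF _ assms, of 2]
  by (simp add: varpi_def kahler_form_def complex_eq_iff)

text \<open>The quaternion relations J1 J3 = - J2 and J2 J3 = J1 turn \<omega>1 + i \<omega>2 into -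
  \<omega>2 + i \<omega>1 when J3 is inserted, which is multiplication by i. Antisymmetry gives the
  second slot.\<close>

lemma \<Omega>_J:
  assumes "y \<in> pts Nh" "u \<in> tspace Nh y" "v \<in> tspace Nh y"
  shows "\<Omega> y (J y u) v = \<i> * \<Omega> y u v" "\<Omega> y u (J y v) = \<i> * \<Omega> y u v"
proof -
  have *: "\<Omega> y (J y u) v = \<i> * \<Omega> y u v" if u: "u \<in> tspace Nh y" and v: "v \<in> tspace Nh y" for u v
  proof -
    have J12: "Jh 1 y (Jh 2 y w) = J y w" if "w \<in> tspace Nh y" for w
      using hk assms(1) that by (auto simp: pseudo_hyperkahler_def)
    have J1: "Jh 1 y w \<in> tspace Nh y" "Jh 1 y (Jh 1 y w) = lincomb (-1) w 0 w" if "w \<in> tspace Nh y" for w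
      using almost_complexD[OF ac assms(1) that] by auto
    have J2: "Jh 2 y w \<in> tspace Nh y" if "w \<in> tspace Nh y" for w
      using almost_complexD[OF ac assms(1) that] by auto
    have J3: "J y w \<in> tspace Nh y" "J y (J y w) = lincomb (-1) w 0 w" if "w \<in> tspace Nh y" for w
      using almost_complexD[OF acJ assms(1) that] by auto
    have neg: "lincomb (-1) (lincomb (-1) w 0 w) 0 (lincomb (-1) w 0 w) = w" for w :: "'h tvec"
      by (simp add: lincomb_def)
    have 1: "Jh 1 y (J y u) = lincomb (-1) (Jh 2 y u) 0 (Jh 2 y u)"
      using J12[OF u] J1(2)[OF J2[OF u]] by simp
    \<comment> \<open>Among the quaternion relations only J1 J2 = J3 is available. It shows J1(J2 J3
      u) = - u, and one more application of J1 isolates J2 J3 u.\<close>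
    have "Jh 1 y (Jh 2 y (J y u)) = lincomb (-1) u 0 u"
      using J12[OF J3(1)[OF u]] J3(2)[OF u] by simp
    then have "Jh 1 y (Jh 1 y (Jh 2 y (J y u))) = lincomb (-1) (Jh 1 y u) 0 (Jh 1 y u)"
      using almost_complex_lincomb[OF ac assms(1) u u] by simp
    then have "lincomb (-1) (Jh 2 y (J y u)) 0 (Jh 2 y (J y u)) = lincomb (-1) (Jh 1 y u) 0 (Jh 1 y u)"
      using J1(2)[OF J2[OF J3(1)[OF u]]] by simp
    then have 2: "Jh 2 y (J y u) = Jh 1 y u"
      by (simp add: lincomb_def fun_eq_iff)
    show ?thesis
      unfolding varpi_def kahler_form_def 1 2 g_bilinear(1)[OF assms(1) J2[OF u] J2[OF u] v]
      by (simp add: complex_eq_iff)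
  qed
  show "\<Omega> y (J y u) v = \<i> * \<Omega> y u v" by (rule *[OF assms(2,3)])
  show "\<Omega> y u (J y v) = \<i> * \<Omega> y u v"
    using *[OF assms(3,2)] \<Omega>_alternating[OF assms]
      \<Omega>_alternating[OF assms(1,2) almost_complexD(1)[OF acJ assms(1,3)]] by simp
qed

lemma \<Omega>_tzero:
  assumes "y \<in> pts Nh" "v \<in> tspace Nh y"
  shows "\<Omega> y tzero v = 0"
  using \<Omega>_bilinear[OF assms(1) tzero_tspace tzero_tspace assms(2), of 0 0] by (simp add: lincomb_0_0)

text \<open>The real part \<omega>1 alone is nondegenerate, because the metric is and J1 is
  invertible.\<close>

lemma \<Omega>_nondegenerate:
  assumes "y \<in> pts Nh" "u \<in> tspace Nh y" "\<And>v. v \<in> tspace Nh y \<Longrightarrow> \<Omega> y u v = 0"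
  shows "u = tzero"
proof -
  note J1 = almost_complexD[OF ac[of 1] assms(1,2), simplified]
  have "gh y (Jh 1 y u) v = 0" if "v \<in> tspace Nh y" for v
    using assms(3)[OF that] by (simp add: varpi_def kahler_form_def complex_eq_iff)
  then have "Jh 1 y u = tzero"
    using hk assms(1) J1(1) by (auto simp: pseudo_hyperkahler_def pseudo_riemannian_def)
  then have "lincomb (-1) u 0 u = tzero"
    using J1(2) almost_complex_tzero[OF ac[of 1] assms(1)] by simp
  then show ?thesis by (simp add: lincomb_def tzero_def fun_eq_iff)
qed

lemma lam_lincomb:
  "y \<in> pts Nh \<Longrightarrow> u \<in> tspace Nh y \<Longrightarrow> v \<in> tspace Nh y \<Longrightarrow>
    lam y (lincomb a u b v) = a *\<^sub>R lam y u + b *\<^sub>R lam y v"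
  by (rule form1_lincomb[OF lam])

lemma lam_J:
  assumes "y \<in> pts Nh" "v \<in> tspace Nh y"
  shows "lam y (J y v) = \<i> * lam y v"
proof -
  have "2 * \<i> * lam y (J y v) = \<i> * (2 * \<i> * lam y v)"
    using \<Omega>_J(2)[OF assms(1) K[OF assms(1)] assms(2)] varpi_K[OF assms]
      varpi_K[OF assms(1) almost_complexD(1)[OF acJ assms]] by simp
  then have "(2 * \<i>) * lam y (J y v) = (2 * \<i>) * (\<i> * lam y v)" by (simp only: ac_simps)
  then show ?thesis by simp
qed

lemma lam_K:
  assumes "y \<in> pts Nh"
  shows "lam y (K y) = 0" "lam y (J y (K y)) = 0"
proof -
  have "\<Omega> y (K y) (K y) = 0"
    using \<Omega>_alternating[OF assms K[OF assms] K[OF assms]] by simp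
  then show 0: "lam y (K y) = 0" using varpi_K[OF assms K[OF assms]] by simp
  show "lam y (J y (K y)) = 0" using lam_J[OF assms K[OF assms]] 0 by simp
qed

section \<open>The projection to \<open>Z\<close>, its local sections and its fibres\<close>

lemma pz: "smooth_map_on Nh (pts Nh) Z pz"
  "y \<in> pts Nh \<Longrightarrow> v \<in> tspace Nh y \<Longrightarrow> push Z pz y (J y v) = I (pz y) (push Z pz y v)"
  using quot hol_map_onD[of Nh J "pts Nh" Z I pz] by (auto simp: complex_quotient_def)

lemma pz_pts: "y \<in> pts Nh \<Longrightarrow> pz y \<in> pts Z"
  by (rule smooth_map_on_pts(2)[OF pz(1)])

lemma pz_eq_iff: "y \<in> pts Nh \<Longrightarrow> y' \<in> pts Nh \<Longrightarrow> pz y = pz y' \<longleftrightarrow> (\<exists>x. x \<noteq> 0 \<and> y' = act x y)"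
  using quot by (auto simp: complex_quotient_def)

lemma section_through:
  assumes "y \<in> pts Nh"
  obtains U s where "pz y \<in> U" "hol_section Nh J Z I pz U s" "s (pz y) = y"
  using quot assms by (fastforce simp: complex_quotient_def)

lemma sectionD:
  assumes "hol_section Nh J Z I pz U s"
  shows "smooth_map_on Z U Nh s" "openin (mtop Z) U" "\<And>z. z \<in> U \<Longrightarrow> s z \<in> pts Nh"
    "\<And>z. z \<in> U \<Longrightarrow> pz (s z) = z" "\<And>z. z \<in> U \<Longrightarrow> z \<in> pts Z"
    "\<And>z v. z \<in> U \<Longrightarrow> v \<in> tspace Z z \<Longrightarrow> push Nh s z (I z v) = J (s z) (push Nh s z v)"
    "\<And>z v. z \<in> U \<Longrightarrow> v \<in> tspace Z z \<Longrightarrow> push Nh s z v \<in> tspace Nh (s z)"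
  using assms hol_map_onD[of Z I U Nh J s] unfolding hol_section_def
  by (auto dest: smooth_map_on_openin smooth_map_on_pts intro: push_tspace[OF atl(2,1)])

lemma push_pz_section:
  assumes "hol_section Nh J Z I pz U s" "z \<in> U" "v \<in> tspace Z z"
  shows "push Z pz (s z) (push Nh s z v) = v"
proof -
  note s = sectionD[OF assms(1)]
  have "push Z pz (s z) (push Nh s z v) = push Z (\<lambda>q. pz (s q)) z v"
    using push_push[OF atl(1,2) pz(1), of s] s(3)[OF assms(2)] by blast
  also have "\<dots> = push Z (\<lambda>q. q) z v"
    by (rule push_cong[OF atl(2) assms(3) s(2) assms(2) s(4)])
  finally show ?thesis by (simp add: push_ident[OF assms(3)])
qed

lemma actD:
  assumes "y \<in> pts Nh"
  shows "act 1 y = y" "a \<noteq> 0 \<Longrightarrow> b \<noteq> 0 \<Longrightarrow> act (a * b) y = act a (act b y)"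
    "x \<noteq> 0 \<Longrightarrow> act x y \<in> pts Nh"
proof -
  show "act 1 y = y" "a \<noteq> 0 \<Longrightarrow> b \<noteq> 0 \<Longrightarrow> act (a * b) y = act a (act b y)"
    using act assms by (auto simp: hol_Cx_action_def)
  have "smooth_map_on Nh (pts Nh) Nh (act x)" if "x \<noteq> 0"
    using act that hol_map_onD(1) unfolding hol_Cx_action_def by blast
  then show "x \<noteq> 0 \<Longrightarrow> act x y \<in> pts Nh"
    using smooth_map_on_pts(2) assms by metis
qed

lemma act_smooth: "x \<noteq> 0 \<Longrightarrow> smooth_map_on Nh (pts Nh) Nh (act x)"
  using act hol_map_onD(1) unfolding hol_Cx_action_def by blast

lemma pz_act: "x \<noteq> 0 \<Longrightarrow> y \<in> pts Nh \<Longrightarrow> pz (act x y) = pz y"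
  using pz_eq_iff[of y "act x y"] actD(3) by auto

lemma push_pz_act:
  assumes "x \<noteq> 0" "y \<in> pts Nh" "v \<in> tspace Nh y"
  shows "push Z pz (act x y) (push Nh (act x) y v) = push Z pz y v"
proof -
  have "push Z pz (act x y) (push Nh (act x) y v) = push Z (\<lambda>q. pz (act x q)) y v"
    using push_push[OF atl(1,2) pz(1), of "act x"] actD(3)[OF assms(2,1)] by blast
  also have "\<dots> = push Z pz y v"
    by (rule push_cong[OF atl(1) assms(3) _ assms(2)]) (use pz_act assms in auto)
  finally show ?thesis .
qed

text \<open>Near every point, \<open>(x, z) \<mapsto> x s(z)\<close> is a smooth map onto an open set, so it cannot raise the
  dimension.\<close>

lemma dim_le:
  assumes "y0 \<in> pts Nh"
  shows "DIM('eh) \<le> DIM('ez) + 2"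
proof (rule ccontr)
  assume "\<not> DIM('eh) \<le> DIM('ez) + 2"
  then have low: "DIM(complex \<times> 'ez) < DIM('eh)" by simp
  obtain U s where U: "pz y0 \<in> U" "hol_section Nh J Z I pz U s" "s (pz y0) = y0"
    using section_through[OF assms] by blast
  note s = sectionD[OF U(2)]
  obtain A \<psi> where A: "(A, \<psi>) \<in> atlas Nh" "y0 \<in> A" using atl(1) assms by (rule smooth_atlasE)
  obtain B \<xi> where B: "(B, \<xi>) \<in> atlas Z" "pz y0 \<in> B" using atl(2) pz_pts[OF assms] by (rule smooth_atlasE)
  interpret A: smooth_chart Nh A \<psi> by unfold_locales (use atl A in auto)
  interpret B: smooth_chart Z B \<xi> by unfold_locales (use atl B in auto)
  let ?C = "open_mfd (- {0 :: complex})"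
  have C: "open (- {0 :: complex})" by auto
  note Ca = smooth_atlas_open_mfd[OF C]
  interpret P: smooth_chart "mprod ?C Z" "(- {0}) \<times> B" "map_prod id \<xi>"
    by (rule mprod_chart[OF open_mfd_chart[OF C] B.smooth_chart_axioms])
  define D where "D = (- {0 :: complex}) \<times> U"
  have D: "openin (mtop (mprod ?C Z)) D"
    unfolding D_def mtop_mprod using s(2) openin_pts_self[of ?C]
    by (simp add: openin_prod_Times_iff del: openin_pts_self)
  have "smooth_map_on (mprod ?C Z) D ?C fst"
    by (rule smooth_map_on_fst[OF Ca atl(2) D])
  moreover have "smooth_map_on (mprod ?C Z) D Nh (\<lambda>q. s (snd q))"
    by (rule smooth_map_on_comp[OF P.atl atl(2,1) smooth_map_on_snd[OF Ca atl(2) D] s(1)]) (auto simp: D_def)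
  ultimately have "smooth_map_on (mprod ?C Z) D (mprod ?C Nh) (\<lambda>q. (fst q, s (snd q)))"
    by (rule smooth_map_on_Pair[OF P.atl])
  then have F: "smooth_map_on (mprod ?C Z) D Nh (\<lambda>q. case (fst q, s (snd q)) of (x, y) \<Rightarrow> act x y)"
  proof (rule smooth_map_on_comp[OF P.atl smooth_atlas_mprod[OF Ca atl(1)] atl(1)])
    show "smooth_map_on (mprod ?C Nh) ((- {0}) \<times> pts Nh) Nh (\<lambda>(x, y). act x y)"
      using act by (simp add: hol_Cx_action_def)
  qed (use s(3) in \<open>auto simp: D_def\<close>)
  define F where "F = (\<lambda>q. act (fst q) (s (snd q)))"
  have F: "smooth_map_on (mprod ?C Z) D Nh F"
    using F by (simp add: F_def)
  define G where "G = {q \<in> D. F q \<in> A} \<inter> ((- {0}) \<times> B)"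
  have G: "openin (mtop (mprod ?C Z)) G"
    unfolding G_def by (intro openin_Int smooth_map_on_vimage[OF F] A.openin_U P.openin_U)
  define f where "f = (\<lambda>q. \<psi> (F q)) \<circ> inv_into ((- {0}) \<times> B) (map_prod id \<xi>)"
  have "f differentiable (at x)" if "x \<in> map_prod id \<xi> ` G" for x
  proof -
    from that obtain q where q: "x = map_prod id \<xi> q" "q \<in> G" by (rule imageE)
    then have q': "q \<in> D" "F q \<in> A" "q \<in> (- {0}) \<times> B" by (auto simp: G_def)
    have "smooth_at (mprod ?C Z) q (\<lambda>q. \<psi> (F q))"
      by (rule smooth_at_comp[OF P.atl atl(1) F q'(1) A.smooth_at_chart[OF q'(2)]])
    from P.has_derivative_smooth_at[OF q'(3) this] show ?thesis
      unfolding f_def q(1) by (rule differentiableI)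
  qed
  then have "f differentiable_on (map_prod id \<xi> ` G)"
    by (simp add: differentiable_on_def differentiable_at_withinI)
  then have neg: "negligible (f ` (map_prod id \<xi> ` G))"
    by (rule negligible_differentiable_image_lowdim[OF low])
  \<comment> \<open>Every point of this open neighbourhood of \<open>y0\<close> has the form x s(z)
    with z in the domain of the section and of the chart, so the image of \<open>f\<close> covers an
    open set although it is negligible.\<close>
  define Q where "Q = {y \<in> pts Nh. pz y \<in> U \<inter> B} \<inter> A"
  have "openin (mtop Nh) Q"
    unfolding Q_def by (intro openin_Int smooth_map_on_vimage[OF pz(1)] A.openin_U s(2) B.openin_U)
  then have Q: "open (\<psi> ` Q)" by (rule A.open_image) (auto simp: Q_def)
  have "\<psi> ` Q \<subseteq> f ` (map_prod id \<xi> ` G)"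
  proof
    fix e assume "e \<in> \<psi> ` Q"
    then obtain y where y: "e = \<psi> y" "y \<in> pts Nh" "pz y \<in> U" "pz y \<in> B" "y \<in> A" by (auto simp: Q_def)
    obtain x where x: "x \<noteq> 0" "y = act x (s (pz y))"
      using pz_eq_iff[OF s(3)[OF y(3)] y(2)] s(4)[OF y(3)] by auto
    have q: "(x, pz y) \<in> G" using x y by (auto simp: G_def D_def F_def)
    then have "f (map_prod id \<xi> (x, pz y)) = \<psi> (F (x, pz y))"
      using P.inv_chart[of "(x, pz y)"] by (simp add: f_def G_def)
    also have "\<dots> = e" using x y by (simp add: F_def)
    finally show "e \<in> f ` (map_prod id \<xi> ` G)" using q by force
  qed
  then have "negligible (\<psi> ` Q)" using neg negligible_subset by blast
  moreover have "\<psi> y0 \<in> \<psi> ` Q" using assms U B A by (auto simp: Q_def)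
  ultimately show False using open_not_negligible[OF Q] by blast
qed

text \<open>In charts the differential of \<open>pz\<close> is a surjection \<open>L\<close> killing
  K and JK, and \<open>dim_le\<close> leaves no room for more. K and JK are independent over the
  reals: \<Omega>(aK + bJK, v) = (a + ib) \<Omega>(K, v), and \<Omega>(K, v) = 2i \<lambda>(v) is
  nonzero for some v.\<close>

lemma vertical:
  assumes y: "y \<in> pts Nh" and w: "w \<in> tspace Nh y" "push Z pz y w = tzero"
  obtains a b where "w = lincomb a (K y) b (J y (K y))"
proof -
  obtain A \<psi> where A: "(A, \<psi>) \<in> atlas Nh" "y \<in> A" using atl(1) y by (rule smooth_atlasE)
  obtain B \<xi> where B: "(B, \<xi>) \<in> atlas Z" "pz y \<in> B" using atl(2) pz_pts[OF y] by (rule smooth_atlasE)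
  interpret A: smooth_chart Nh A \<psi> by unfold_locales (use atl A in auto)
  interpret B: smooth_chart Z B \<xi> by unfold_locales (use atl B in auto)
  note Ky = K[OF y] and JKy = almost_complexD(1)[OF acJ y K[OF y]]
  define L where "L e = vapply (push Z pz y (cvec Nh A \<psi> e y)) \<xi>" for e
  have Lv: "L (vapply v \<psi>) = vapply (push Z pz y v) \<xi>" if "v \<in> tspace Nh y" for v
    unfolding L_def using A.tspace_eq_cvec[OF A(2) that] by simp
  have "linear L"
    unfolding L_def by (rule A.linear_cvec[OF A(2)]) (simp add: push_lincomb vapply_lincomb)
  moreover have "surj L"
    unfolding surj_def
  proof
    fix e
    have "cvec Z B \<xi> e (pz y) \<in> push Z pz y ` tspace Nh y"
      using quot y B.cvec_tspace[OF B(2)] by (auto simp: complex_quotient_def submersion_def)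
    then obtain v where "v \<in> tspace Nh y" "cvec Z B \<xi> e (pz y) = push Z pz y v" by blast
    then have "L (vapply v \<psi>) = e" using Lv B.vapply_cvec_chart[OF B(2)] by metis
    then show "\<exists>x. e = L x" by metis
  qed
  moreover have "L (vapply (K y) \<psi>) = 0" using Lv[OF Ky] K_vert[OF y] by simp
  moreover have "L (vapply (J y (K y)) \<psi>) = 0"
    using Lv[OF JKy] K_vert[OF y] pz(2)[OF y Ky] almost_complex_tzero[OF acI pz_pts[OF y]] by simp
  moreover have "L (vapply w \<psi>) = 0" using Lv[OF w(1)] w(2) by simp
  moreover have "a = 0 \<and> b = 0" if "a *\<^sub>R vapply (K y) \<psi> + b *\<^sub>R vapply (J y (K y)) \<psi> = 0" for a b
  proof -
    have "lincomb a (K y) b (J y (K y)) = tzero"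
      by (rule A.tspace_eqI[OF A(2) lincomb_tspace[OF Ky JKy] tzero_tspace])
        (simp add: vapply_lincomb that)
    then have "\<Omega> y (lincomb a (K y) b (J y (K y))) v = 0" if "v \<in> tspace Nh y" for v
      using \<Omega>_tzero[OF y that] by simp
    moreover obtain v where v: "v \<in> tspace Nh y" "lam y v \<noteq> 0" using lam_nz[OF y] by blast
    ultimately have "a *\<^sub>R \<Omega> y (K y) v + b *\<^sub>R (\<i> * \<Omega> y (K y) v) = 0"
      using \<Omega>_bilinear[OF y Ky JKy v(1), of a b] \<Omega>_J(1)[OF y Ky v(1)] by simp
    then have "(complex_of_real a + \<i> * complex_of_real b) * \<Omega> y (K y) v = 0"
      by (simp add: scaleR_conv_of_real algebra_simps)
    then have "complex_of_real a + \<i> * complex_of_real b = 0"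
      using varpi_K[OF y v(1)] v(2) by simp
    then show ?thesis by (simp add: complex_eq_iff)
  qed
  ultimately obtain a b where ab: "vapply w \<psi> = a *\<^sub>R vapply (K y) \<psi> + b *\<^sub>R vapply (J y (K y)) \<psi>"
    using kernel_span[of L] dim_le[OF y] by blast
  have "w = lincomb a (K y) b (J y (K y))"
    by (rule A.tspace_eqI[OF A(2) w(1) lincomb_tspace[OF Ky JKy]]) (simp add: vapply_lincomb ab)
  then show thesis by (rule that)
qed

lemma lam_cong:
  assumes y: "y \<in> pts Nh" "u \<in> tspace Nh y" "v \<in> tspace Nh y" "push Z pz y u = push Z pz y v"
  shows "lam y u = lam y v"
proof -
  have "push Z pz y (lincomb 1 u (-1) v) = tzero"
    unfolding push_lincomb assms(4) by (simp add: lincomb_def tzero_def)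
  then obtain a b where ab: "lincomb 1 u (-1) v = lincomb a (K y) b (J y (K y))"
    using vertical[OF y(1) lincomb_tspace[OF y(2,3)]] by blast
  have "lam y (lincomb 1 u (-1) v) = 0"
    unfolding ab using lam_lincomb[OF y(1) K[OF y(1)] almost_complexD(1)[OF acJ y(1) K[OF y(1)]]] lam_K[OF y(1)]
    by simp
  then show ?thesis using lam_lincomb[OF y(1-3), of 1 "-1"] by simp
qed

text \<open>If x fixes y, its differential changes a vector only by a vertical one, so \<lambda>
  keeps its value; weight two multiplies the same value by the square of x.\<close>

lemma stabilizer:
  assumes "y \<in> pts Nh" "x \<noteq> 0" "act x y = y"
  shows "x\<^sup>2 = 1"
proof -
  obtain v where v: "v \<in> tspace Nh y" "lam y v \<noteq> 0" using lam_nz[OF assms(1)] by blast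
  have "push Nh (act x) y v \<in> tspace Nh y"
    using push_tspace[OF atl(1,1) act_smooth[OF assms(2)] assms(1) v(1)] assms(3) by simp
  then have "lam y (push Nh (act x) y v) = lam y v"
    using push_pz_act[OF assms(2,1) v(1)] assms v by (intro lam_cong) auto
  then show ?thesis using lam_act[OF assms(2,1) v(1)] assms(3) v(2) by simp
qed

section \<open>Pullbacks along local holomorphic sections\<close>

definition alpha :: "('z \<Rightarrow> 'h) \<Rightarrow> ('z, complex) form1" where
  "alpha s z v = lam (s z) (push Nh s z v)"

definition beta :: "('z \<Rightarrow> 'h) \<Rightarrow> ('z, complex) form2" where
  "beta s z u v = \<Omega> (s z) (push Nh s z u) (push Nh s z v)"

text \<open>Project \<open>u\<close> to \<open>Z\<close>, lift by \<open>s\<close> and transport by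
  \<open>x\<close>: the result differs from \<open>u\<close> by a vertical vector, on which
  \<lambda> vanishes, and transport contributes the square of \<open>x\<close>. This recovers
  \<lambda> on whole fibres from its values along one section.\<close>

lemma lam_eq_alpha:
  assumes "hol_section Nh J Z I pz U s" "z \<in> U" "x \<noteq> 0" "u \<in> tspace Nh (act x (s z))"
  shows "lam (act x (s z)) u = x\<^sup>2 * alpha s z (push Z pz (act x (s z)) u)"
proof -
  note s = sectionD[OF assms(1)]
  note sz = s(3)[OF assms(2)] note y = actD(3)[OF sz assms(3)]
  have pzz: "pz (act x (s z)) = z" using pz_act[OF assms(3) sz] s(4)[OF assms(2)] by simp
  let ?v = "push Z pz (act x (s z)) u"
  have v: "?v \<in> tspace Z z" using push_tspace[OF atl pz(1) y assms(4)] pzz by simp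
  note sv = s(7)[OF assms(2) v]
  have "lam (act x (s z)) u = lam (act x (s z)) (push Nh (act x) (s z) (push Nh s z ?v))"
  proof (rule lam_cong[OF y assms(4)])
    show "push Nh (act x) (s z) (push Nh s z ?v) \<in> tspace Nh (act x (s z))"
      by (rule push_tspace[OF atl(1,1) act_smooth[OF assms(3)] sz sv])
    show "?v = push Z pz (act x (s z)) (push Nh (act x) (s z) (push Nh s z ?v))"
      by (simp add: push_pz_act[OF assms(3) sz sv] push_pz_section[OF assms(1,2) v])
  qed
  then show ?thesis by (simp add: lam_act[OF assms(3) sz sv] alpha_def)
qed

lemma lam_eq_alpha_1:
  assumes "hol_section Nh J Z I pz U s" "z \<in> U" "u \<in> tspace Nh (s z)"
  shows "lam (s z) u = alpha s z (push Z pz (s z) u)"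
  using lam_eq_alpha[OF assms(1,2), of 1 u] actD(1)[OF sectionD(3)[OF assms(1,2)]] assms(3) by simp

context
  fixes U s assumes sec: "hol_section Nh J Z I pz U s"
begin

lemmas section_facts = sectionD[OF sec]

lemma alpha_form1: "is_form1 Z U (alpha s)"
  unfolding alpha_def[abs_def] by (rule pullback_form1[OF atl(2,1) section_facts(1) lam])

lemma alpha_ext_deriv: "has_ext_deriv Z U (alpha s) (beta s)"
  unfolding alpha_def[abs_def] beta_def[abs_def]
  by (rule pullback_ext_deriv[OF atl(2,1) section_facts(1) lam dlam \<Omega>_bilinear])

lemma alpha_I: "z \<in> U \<Longrightarrow> v \<in> tspace Z z \<Longrightarrow> alpha s z (I z v) = \<i> * alpha s z v"
  by (simp add: alpha_def section_facts lam_J)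

lemma beta_I: "z \<in> U \<Longrightarrow> u \<in> tspace Z z \<Longrightarrow> v \<in> tspace Z z \<Longrightarrow>
    beta s z (I z u) v = \<i> * beta s z u v \<and> beta s z u (I z v) = \<i> * beta s z u v"
  by (simp add: beta_def section_facts \<Omega>_J)

lemma beta_bilinear:
  "z \<in> U \<Longrightarrow> u \<in> tspace Z z \<Longrightarrow> v \<in> tspace Z z \<Longrightarrow> w \<in> tspace Z z \<Longrightarrow>
    beta s z (lincomb a u b v) w = a *\<^sub>R beta s z u w + b *\<^sub>R beta s z v w \<and>
    beta s z w (lincomb a u b v) = a *\<^sub>R beta s z w u + b *\<^sub>R beta s z w v"
  unfolding beta_def push_lincomb by (rule \<Omega>_bilinear) (auto simp: section_facts)

lemma alpha_hol: "hol_form1 Z I U (alpha s)"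
  by (rule hol_form1I[OF atl(2) acI section_facts(2) alpha_form1 alpha_I alpha_ext_deriv]) (auto simp: beta_I)

lemma alpha_nz:
  assumes "z \<in> U"
  shows "\<exists>v\<in>tspace Z z. alpha s z v \<noteq> 0"
proof -
  obtain u where u: "u \<in> tspace Nh (s z)" "lam (s z) u \<noteq> 0" using lam_nz[OF section_facts(3)[OF assms]] by blast
  have "push Z pz (s z) u \<in> tspace Z z"
    using push_tspace[OF atl pz(1) section_facts(3)[OF assms] u(1)] section_facts(4)[OF assms] by simp
  then show ?thesis using lam_eq_alpha_1[OF sec assms u(1)] u(2) by metis
qed

lemma cext1_alpha:
  assumes "z \<in> U" "u \<in> tspace Z z"
  shows "cext1 (alpha s) z (c10 I z u) = 2 * alpha s z u"
  by (intro cext1_c10[OF alpha_form1] assms alpha_I almost_complexD(1)[OF acI section_facts(5)])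

lemma cext2_beta:
  assumes "z \<in> U" "u \<in> tspace Z z" "v \<in> tspace Z z"
  shows "cext2 (beta s) z (c10 I z u) (c10 I z v) = 4 * beta s z u v"
  by (rule cext2_c10[OF acI section_facts(5)[OF assms(1)] assms(2,3)]) (use beta_bilinear beta_I assms in auto)

text \<open>On \<open>s\<^sub>*\<close> of the kernel of \<open>\<alpha>\<close>, orthogonality to \<open>ker \<alpha>\<close> is orthogonality to \<open>ker \<lambda>\<close>,
  because \<open>ker \<lambda>\<close> is spanned by vertical vectors and \<open>s\<^sub>* ker \<alpha>\<close>. Such a vector is proportional to
  the vector \<open>K\<close> representing \<open>\<lambda>\<close>, and hence is vertical.\<close>

lemma beta_nondegenerate:
  assumes z: "z \<in> U" and u: "u \<in> tspace Z z" "alpha s z u = 0"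
    and orth: "\<And>v. v \<in> tspace Z z \<Longrightarrow> alpha s z v = 0 \<Longrightarrow> beta s z u v = 0"
  shows "u = tzero"
proof -
  define y where "y = s z"
  have y: "y \<in> pts Nh" by (simp add: y_def section_facts z)
  have pzy: "pz y = z" by (simp add: y_def section_facts z)
  define u0 where "u0 = push Nh s z u"
  have u0: "u0 \<in> tspace Nh y" by (simp add: u0_def y_def section_facts z u)
  note Ky = K[OF y] and JKy = almost_complexD(1)[OF acJ y K[OF y]]
  \<comment> \<open>Since \<open>\<Omega>\<close> pairs K with a vector as 2i \<lambda>,
    orthogonality to K is the condition \<open>alpha s z u = 0\<close>.\<close>
  have Ku0: "\<Omega> y u0 (K y) = 0"
    using \<Omega>_alternating[OF y u0 Ky] varpi_K[OF y u0] u(2) by (simp add: alpha_def y_def u0_def)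
  have orth': "\<Omega> y u0 w = 0" if w: "w \<in> tspace Nh y" "lam y w = 0" for w
  proof -
    let ?v = "push Z pz y w"
    have v: "?v \<in> tspace Z z" using push_tspace[OF atl pz(1) y w(1)] pzy by simp
    have "alpha s z ?v = 0" using lam_eq_alpha_1[OF sec z] w by (simp add: y_def)
    then have 0: "\<Omega> y u0 (push Nh s z ?v) = 0" using orth[OF v] by (simp add: beta_def y_def u0_def)
    have sv: "push Nh s z ?v \<in> tspace Nh y" using section_facts(7)[OF z v] by (simp add: y_def)
    have "push Z pz y (lincomb 1 w (-1) (push Nh s z ?v)) = tzero"
      unfolding push_lincomb using push_pz_section[OF sec z v] by (simp add: y_def lincomb_def tzero_def)
    then obtain a b where "lincomb 1 w (-1) (push Nh s z ?v) = lincomb a (K y) b (J y (K y))"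
      using vertical[OF y lincomb_tspace[OF w(1) sv]] by blast
    then have "\<Omega> y u0 (lincomb 1 w (-1) (push Nh s z ?v)) = 0"
      using \<Omega>_bilinear[OF y Ky JKy u0, of a b] \<Omega>_J(2)[OF y u0 Ky] Ku0 by simp
    then show ?thesis using \<Omega>_bilinear[OF y w(1) sv u0, of 1 "-1"] 0 by simp
  qed
  obtain w0 where w0: "w0 \<in> tspace Nh y" "lam y w0 \<noteq> 0" using lam_nz[OF y] by blast
  \<comment> \<open>By \<open>orth'\<close> the functional \<open>\<Omega> y u0\<close> vanishes on
    the kernel of \<lambda>. Both functionals are complex linear for \<open>J\<close>, so they are
    proportional, and one vector outside the kernel determines the factor.\<close>
  define c where "c = \<Omega> y u0 w0 / lam y w0"
  have Jw0: "J y w0 \<in> tspace Nh y" by (rule almost_complexD(1)[OF acJ y w0(1)])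
  have proportional: "\<Omega> y u0 w = c * lam y w" if w: "w \<in> tspace Nh y" for w
  proof -
    define t where "t = lam y w / lam y w0"
    \<comment> \<open>The complex multiple t w0, with multiplication by i carried out by
      \<open>J\<close>; it has the same \<lambda> as \<open>w\<close>.\<close>
    define w1 where "w1 = lincomb (Re t) w0 (Im t) (J y w0)"
    have w1: "w1 \<in> tspace Nh y" unfolding w1_def by (rule lincomb_tspace[OF w0(1) Jw0])
    have "lam y w1 = t * lam y w0"
      unfolding w1_def lam_lincomb[OF y w0(1) Jw0] lam_J[OF y w0(1)]
      by (simp add: complex_eq_iff algebra_simps)
    then have "lam y w1 = lam y w" using w0(2) by (simp add: t_def)
    then have "\<Omega> y u0 (lincomb 1 w (-1) w1) = 0"
      using lam_lincomb[OF y w w1, of 1 "-1"] by (intro orth' lincomb_tspace w w1) simp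
    then have "\<Omega> y u0 w = \<Omega> y u0 w1" using \<Omega>_bilinear[OF y w w1 u0, of 1 "-1"] by simp
    also have "\<dots> = t * \<Omega> y u0 w0"
      unfolding w1_def conjunct2[OF \<Omega>_bilinear[OF y w0(1) Jw0 u0]] \<Omega>_J(2)[OF y u0 w0(1)]
      by (simp add: complex_eq_iff algebra_simps)
    finally show ?thesis by (simp add: c_def t_def)
  qed
  \<comment> \<open>Contraction with K gives 2i \<lambda>, so dK represents c \<lambda> exactly when
    c = 2i d.\<close>
  define d where "d = c / (2 * \<i>)"
  have cd: "c = d * (2 * \<i>)" by (rule nonzero_eq_divide_eq[THEN iffD1, OF _ d_def, symmetric]) simp
  define k where "k = lincomb (Re d) (K y) (Im d) (J y (K y))"
  have k: "k \<in> tspace Nh y" unfolding k_def by (rule lincomb_tspace[OF Ky JKy])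
  have "\<Omega> y k w = d * \<Omega> y (K y) w" if w: "w \<in> tspace Nh y" for w
    unfolding k_def conjunct1[OF \<Omega>_bilinear[OF y Ky JKy w]] \<Omega>_J(1)[OF y Ky w]
    by (simp add: complex_eq_iff algebra_simps)
  then have "\<Omega> y k w = \<Omega> y u0 w" if w: "w \<in> tspace Nh y" for w
    using w proportional[OF w] varpi_K[OF y w] cd by simp
  then have "lincomb 1 u0 (-1) k = tzero"
    using \<Omega>_bilinear[OF y u0 k] by (intro \<Omega>_nondegenerate[OF y] lincomb_tspace u0 k) simp
  then have "u0 = k" by (simp add: lincomb_def tzero_def fun_eq_iff)
  then have "push Z pz y u0 = lincomb (Re d) tzero (Im d) tzero"
    unfolding k_def push_lincomb using K_vert[OF y] pz(2)[OF y Ky] almost_complex_tzero[OF acI pz_pts[OF y]]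
    by (simp add: push_lincomb)
  moreover have "push Z pz y u0 = u"
    using push_pz_section[OF sec z u(1)] by (simp add: u0_def y_def)
  ultimately show ?thesis by (simp add: lincomb_def tzero_def)
qed

end

lemma pz_surj:
  assumes "z \<in> pts Z"
  obtains y where "y \<in> pts Nh" "z = pz y"
  using quot assms unfolding complex_quotient_def by blast

lemma hol_map_pz: "hol_map_on Nh J (pts Nh) Z I pz"
  using quot by (simp add: complex_quotient_def)

section \<open>The associated line bundle\<close>

lemma assoc_class_act:
  assumes "y \<in> pts Nh" "x \<noteq> 0"
  shows "assoc_class act (act x y) (x\<^sup>2 * c) = assoc_class act y c"
proof (intro equalityI subsetI)
  fix l assume "l \<in> assoc_class act (act x y) (x\<^sup>2 * c)"
  then obtain t where t: "t \<noteq> 0" "l = (act t (act x y), t\<^sup>2 * (x\<^sup>2 * c))"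
    by (auto simp: assoc_class_def)
  then have "l = (act (t * x) y, (t * x)\<^sup>2 * c)"
    using actD(2)[OF assms(1) t(1) assms(2)] by (simp add: power_mult_distrib)
  then show "l \<in> assoc_class act y c"
    unfolding assoc_class_def using t assms(2) by (intro CollectI exI[of _ "t * x"]) simp
next
  fix l assume "l \<in> assoc_class act y c"
  then obtain t where t: "t \<noteq> 0" "l = (act t y, t\<^sup>2 * c)"
    by (auto simp: assoc_class_def)
  have "act ((t / x) * x) y = act (t / x) (act x y)"
    by (rule actD(2)[OF assms(1)]) (use t assms in auto)
  then have "l = (act (t / x) (act x y), (t / x)\<^sup>2 * (x\<^sup>2 * c))"
    using t assms(2) by (simp add: power_divide)
  then show "l \<in> assoc_class act (act x y) (x\<^sup>2 * c)"
    unfolding assoc_class_def using t assms(2) by (intro CollectI exI[of _ "t / x"]) simp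
qed

text \<open>Two representatives over the same point y differ by an x fixing y; the bound on
  stabilizers makes its square 1. This is why weight two gives lines as fibres even if the action is
  not free.\<close>

lemma assoc_class_inj:
  assumes "y \<in> pts Nh" "assoc_class act y c = assoc_class act y c'"
  shows "c = c'"
proof -
  have "(act 1 y, 1\<^sup>2 * c) \<in> assoc_class act y c"
    unfolding assoc_class_def by (intro CollectI exI[of _ 1]) simp
  then have "(y, c) \<in> assoc_class act y c'" using assms(2) actD(1)[OF assms(1)] by simp
  then obtain x where "x \<noteq> 0" "y = act x y" "c = x\<^sup>2 * c'" by (auto simp: assoc_class_def)
  then show ?thesis using stabilizer[OF assms(1)] by simp
qed

lemma assoc_proj_class:
  assumes "y \<in> pts Nh"
  shows "assoc_proj pz (assoc_class act y c) = pz y"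
proof -
  have "(pz \<circ> fst) ` assoc_class act y c = {pz y}"
  proof (intro equalityI subsetI)
    fix z assume "z \<in> (pz \<circ> fst) ` assoc_class act y c"
    then show "z \<in> {pz y}" using pz_act assms by (auto simp: assoc_class_def)
  next
    fix z assume "z \<in> {pz y}"
    moreover have "(act 1 y, 1\<^sup>2 * c) \<in> assoc_class act y c"
      unfolding assoc_class_def by (intro CollectI exI[of _ 1]) simp
    ultimately show "z \<in> (pz \<circ> fst) ` assoc_class act y c"
      using actD(1)[OF assms] by force
  qed
  then show ?thesis by (simp add: assoc_proj_def)
qed

lemma assoc_class_section:
  assumes "hol_section Nh J Z I pz U s" "y \<in> pts Nh" "pz y \<in> U"
  obtains x where "x \<noteq> 0" "y = act x (s (pz y))"
    "\<And>c. assoc_class act y (x\<^sup>2 * c) = assoc_class act (s (pz y)) c"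
proof -
  note s = sectionD[OF assms(1)]
  obtain x where x: "x \<noteq> 0" "y = act x (s (pz y))"
    using pz_eq_iff[OF s(3)[OF assms(3)] assms(2)] s(4)[OF assms(3)] by auto
  show thesis
    by (rule that[OF x]) (use assoc_class_act[OF s(3)[OF assms(3)] x(1)] x(2) in metis)
qed

text \<open>Over an overlap one section is x times the other, with x chosen separately at each
  point. The transition function is the inverse square of x, which is also the factor between
  \<open>alpha s\<close> and \<open>alpha s'\<close>; hence \<open>hol_fun_on_quotient\<close> makes
  it holomorphic.\<close>

lemma hol_line_bundle_assoc:
  "hol_line_bundle Z I (assoc_total Nh act) (assoc_proj pz) (assoc_trivs Nh J act Z I pz)"
  unfolding hol_line_bundle_def
proof (intro conjI)
  show "assoc_proj pz ` assoc_total Nh act \<subseteq> pts Z"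
    using assoc_proj_class pz_pts by (auto simp: assoc_total_def)
  show "(\<Union>t\<in>assoc_trivs Nh J act Z I pz. fst t) = pts Z"
  proof (intro equalityI subsetI)
    fix z assume "z \<in> (\<Union>t\<in>assoc_trivs Nh J act Z I pz. fst t)"
    then show "z \<in> pts Z" using sectionD(5) by (auto simp: assoc_trivs_def)
  next
    fix z assume "z \<in> pts Z"
    then obtain y where y: "y \<in> pts Nh" "z = pz y" by (rule pz_surj)
    obtain U s where "pz y \<in> U" "hol_section Nh J Z I pz U s" "s (pz y) = y"
      by (rule section_through[OF y(1)])
    then show "z \<in> (\<Union>t\<in>assoc_trivs Nh J act Z I pz. fst t)"
      using y(2) unfolding assoc_trivs_def by force
  qed
  show "\<forall>(U, \<tau>)\<in>assoc_trivs Nh J act Z I pz.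
     openin (mtop Z) U \<and> (\<forall>z\<in>U. bij_betw (\<tau> z) UNIV {l \<in> assoc_total Nh act. assoc_proj pz l = z})"
  proof clarify
    fix U \<tau> assume "(U, \<tau>) \<in> assoc_trivs Nh J act Z I pz"
    then obtain s where sec: "hol_section Nh J Z I pz U s" and \<tau>: "\<tau> = (\<lambda>z. assoc_class act (s z))"
      by (auto simp: assoc_trivs_def)
    note s = sectionD[OF sec]
    have "bij_betw (\<tau> z) UNIV {l \<in> assoc_total Nh act. assoc_proj pz l = z}" if z: "z \<in> U" for z
      unfolding bij_betw_def
    proof (intro conjI equalityI subsetI)
      show "inj (\<tau> z)" unfolding \<tau> using assoc_class_inj[OF s(3)[OF z]] by (auto intro: injI)
      fix l assume "l \<in> range (\<tau> z)"
      then show "l \<in> {l \<in> assoc_total Nh act. assoc_proj pz l = z}"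
        using assoc_proj_class s(3,4)[OF z] by (auto simp: \<tau> assoc_total_def)
    next
      fix l assume "l \<in> {l \<in> assoc_total Nh act. assoc_proj pz l = z}"
      then obtain y c where y: "y \<in> pts Nh" "l = assoc_class act y c" "pz y = z"
        using assoc_proj_class by (auto simp: assoc_total_def)
      obtain x where x: "x \<noteq> 0" "\<And>c. assoc_class act y (x\<^sup>2 * c) = assoc_class act (s (pz y)) c"
        by (rule assoc_class_section[OF sec y(1)]) (use y z in auto)
      have "l = \<tau> z (c / x\<^sup>2)" using x(2)[of "c / x\<^sup>2"] x(1) y by (simp add: \<tau>)
      then show "l \<in> range (\<tau> z)" by blast
    qed
    then show "openin (mtop Z) U \<and> (\<forall>z\<in>U. bij_betw (\<tau> z) UNIV {l \<in> assoc_total Nh act. assoc_proj pz l = z})"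
      using s(2) by blast
  qed
  show "\<forall>(U, \<tau>)\<in>assoc_trivs Nh J act Z I pz. \<forall>(U', \<tau>')\<in>assoc_trivs Nh J act Z I pz.
     \<exists>k. hol_fun_on Z I (U \<inter> U') k \<and> (\<forall>z\<in>U \<inter> U'. k z \<noteq> 0 \<and> (\<forall>c. \<tau>' z c = \<tau> z (k z * c)))"
  proof clarify
    fix U \<tau> U' \<tau>' assume "(U, \<tau>) \<in> assoc_trivs Nh J act Z I pz" "(U', \<tau>') \<in> assoc_trivs Nh J act Z I pz"
    then obtain s s' where sec: "hol_section Nh J Z I pz U s" "hol_section Nh J Z I pz U' s'"
      and \<tau>: "\<tau> = (\<lambda>z. assoc_class act (s z))" "\<tau>' = (\<lambda>z. assoc_class act (s' z))"
      by (auto simp: assoc_trivs_def)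
    note s = sectionD[OF sec(1)] and s' = sectionD[OF sec(2)]
    \<comment> \<open>With \<open>s' z = act x (s z)\<close> the class of \<open>(s' z, c)\<close>
      is that of s(z) with c divided by the square of x, whereas \<open>alpha s'\<close> is
      \<open>alpha s\<close> multiplied by it. So one \<open>k\<close> serves both
      conditions.\<close>
    have "\<exists>k. k \<noteq> 0 \<and> (\<forall>c. assoc_class act (s' z) c = assoc_class act (s z) (k * c)) \<and>
        (\<forall>v\<in>tspace Z z. alpha s z v = k * alpha s' z v)" if z: "z \<in> U \<inter> U'" for z
    proof -
      have z': "z \<in> U" "z \<in> U'" using z by auto
      obtain x where x: "x \<noteq> 0" "s' z = act x (s (pz (s' z)))"
        "\<And>c. assoc_class act (s' z) (x\<^sup>2 * c) = assoc_class act (s (pz (s' z))) c"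
        by (rule assoc_class_section[OF sec(1) s'(3)[OF z'(2)]]) (use s'(4) z' in auto)
      have x2: "s' z = act x (s z)" using x(2) s'(4)[OF z'(2)] by simp
      have "assoc_class act (s' z) c = assoc_class act (s z) (inverse (x\<^sup>2) * c)" for c
        using x(3)[of "inverse (x\<^sup>2) * c"] s'(4)[OF z'(2)] x(1) by (simp add: mult.assoc[symmetric])
      moreover have "alpha s z v = inverse (x\<^sup>2) * alpha s' z v" if v: "v \<in> tspace Z z" for v
      proof -
        have "alpha s' z v = x\<^sup>2 * alpha s z v"
          using lam_eq_alpha[OF sec(1) z'(1) x(1), of "push Nh s' z v"] s'(7)[OF z'(2) v]
            push_pz_section[OF sec(2) z'(2) v] by (simp add: alpha_def flip: x2)
        then show ?thesis using x(1) by simp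
      qed
      ultimately show ?thesis using x(1) by (intro exI[of _ "inverse (x\<^sup>2)"]) auto
    qed
    then obtain k where k: "\<And>z. z \<in> U \<inter> U' \<Longrightarrow> k z \<noteq> 0"
      "\<And>z c. z \<in> U \<inter> U' \<Longrightarrow> assoc_class act (s' z) c = assoc_class act (s z) (k z * c)"
      "\<And>z v. z \<in> U \<inter> U' \<Longrightarrow> v \<in> tspace Z z \<Longrightarrow> alpha s z v = k z * alpha s' z v"
      by metis
    have form_Int: "is_form1 Z (U \<inter> U') a" if "is_form1 Z U a \<or> is_form1 Z U' a" for a :: "('z, complex) form1"
      using that unfolding is_form1_def by blast
    have d_Int: "has_ext_deriv Z (U \<inter> U') a b" if "has_ext_deriv Z U a b \<or> has_ext_deriv Z U' a b"
      for a :: "('z, complex) form1" and b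
      using that unfolding has_ext_deriv_def by blast
    have "hol_fun_on Z I (U \<inter> U') k"
    proof (rule hol_fun_on_quotient[OF atl(2) acI])
      show "is_form1 Z (U \<inter> U') (alpha s)" "is_form1 Z (U \<inter> U') (alpha s')"
        using form_Int alpha_form1[OF sec(1)] alpha_form1[OF sec(2)] by blast+
      show "has_ext_deriv Z (U \<inter> U') (alpha s) (beta s)" "has_ext_deriv Z (U \<inter> U') (alpha s') (beta s')"
        using d_Int alpha_ext_deriv[OF sec(1)] alpha_ext_deriv[OF sec(2)] by blast+
    qed (use s(2) s'(2) k(3) alpha_I[OF sec(2)] beta_I[OF sec(1)] beta_I[OF sec(2)] alpha_nz[OF sec(2)] in auto)
    then show "\<exists>k. hol_fun_on Z I (U \<inter> U') k \<and> (\<forall>z\<in>U \<inter> U'. k z \<noteq> 0 \<and> (\<forall>c. \<tau>' z c = \<tau> z (k z * c)))"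
      using k unfolding \<tau> by blast
  qed
qed

section \<open>The bundle-valued form, its kernel and the canonical distribution\<close>

lemma cext1_lam:
  assumes "y \<in> pts Nh" "w \<in> T10 Nh J y"
  shows "cext1 lam y w = 2 * lam y (re_vec w)"
proof -
  note w = T10_eq_c10[OF assms(2)]
  have "cext1 lam y (c10 J y (re_vec w)) = 2 * lam y (re_vec w)"
    by (intro cext1_c10[OF lam] assms w lam_J almost_complexD(1)[OF acJ])
  then show ?thesis using w(1) by simp
qed

text \<open>Passing from s(z) to y = x s(z) multiplies \<lambda> by the square of x, and the
  equivalence relation of the bundle undoes precisely this factor. It makes the class independent of
  the lift, hence makes the form descend.\<close>

lemma assoc_class_cext1:
  assumes "hol_section Nh J Z I pz U s" "y \<in> pts Nh" "pz y \<in> U" "w \<in> T10 Nh J y"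
  shows "assoc_class act y (cext1 lam y w) =
    assoc_class act (s (pz y)) (cext1 (alpha s) (pz y) (push Z pz y w))"
proof -
  note w = T10_eq_c10[OF assms(4)]
  obtain x where x: "x \<noteq> 0" "y = act x (s (pz y))"
    "\<And>c. assoc_class act y (x\<^sup>2 * c) = assoc_class act (s (pz y)) c"
    by (rule assoc_class_section[OF assms(1-3)]) (rule that)
  have "lam y (re_vec w) = x\<^sup>2 * alpha s (pz y) (push Z pz y (re_vec w))"
    using lam_eq_alpha[OF assms(1,3) x(1), of "re_vec w"] w(2) by (simp flip: x(2))
  moreover have "push Z pz y w = c10 I (pz y) (push Z pz y (re_vec w))"
    using push_c10[of Z pz y J "re_vec w" I, OF pz(2)[OF assms(2) w(2)]] w(1) by simp
  moreover have "push Z pz y (re_vec w) \<in> tspace Z (pz y)"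
    by (rule push_tspace[OF atl pz(1) assms(2) w(2)])
  ultimately have "cext1 lam y w = x\<^sup>2 * cext1 (alpha s) (pz y) (push Z pz y w)"
    using cext1_alpha[OF assms(1,3)] cext1_lam[OF assms(2,4)] by simp
  then show ?thesis using x(3) by simp
qed

text \<open>Descent written literally: evaluate \<lambda> on any lift of \<open>w\<close> at any
  point over \<open>z\<close>. For \<open>w\<close> of type (1, 0) over a point of \<open>Z\<close>
  a lift exists and by \<open>assoc_class_cext1\<close> the choice is immaterial; elsewhere the
  value is arbitrary.\<close>

definition Lam :: "'z \<Rightarrow> 'z ctvec \<Rightarrow> ('h \<times> complex) set" where
  "Lam z w = (SOME l. \<exists>y\<in>pts Nh. \<exists>w'\<in>T10 Nh J y. pz y = z \<and> push Z pz y w' = w \<and>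
     l = assoc_class act y (cext1 lam y w'))"

lemma section_push_T10:
  assumes "hol_section Nh J Z I pz U s" "z \<in> U" "w \<in> T10 Z I z"
  shows "push Nh s z w \<in> T10 Nh J (s z)" "push Z pz (s z) (push Nh s z w) = w"
proof -
  note s = sectionD[OF assms(1)] and w = T10_eq_c10[OF assms(3)]
  have p: "push Nh s z w = c10 J (s z) (push Nh s z (re_vec w))"
    using push_c10[of Nh s z I "re_vec w" J, OF s(6)[OF assms(2) w(2)]] w(1) by simp
  note sw = s(7)[OF assms(2) w(2)]
  show "push Nh s z w \<in> T10 Nh J (s z)"
    unfolding p by (rule c10_T10[OF acJ s(3)[OF assms(2)] sw])
  show "push Z pz (s z) (push Nh s z w) = w"
    unfolding p push_c10[of Z pz "s z" J _ I, OF pz(2)[OF s(3)[OF assms(2)] sw]]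
    using push_pz_section[OF assms(1,2) w(2)] s(4)[OF assms(2)] w(1) by simp
qed

lemma Lam_section:
  assumes "hol_section Nh J Z I pz U s" "z \<in> U" "w \<in> T10 Z I z"
  shows "Lam z w = assoc_class act (s z) (cext1 (alpha s) z w)"
proof -
  note s = sectionD[OF assms(1)] and p = section_push_T10[OF assms]
  show ?thesis
    unfolding Lam_def
  proof (rule some_equality)
    show "\<exists>y\<in>pts Nh. \<exists>w'\<in>T10 Nh J y. pz y = z \<and> push Z pz y w' = w \<and>
       assoc_class act (s z) (cext1 (alpha s) z w) = assoc_class act y (cext1 lam y w')"
      using assoc_class_cext1[OF assms(1) s(3)[OF assms(2)] _ p(1)] p s(3,4)[OF assms(2)] assms(2)
      by (intro bexI[of _ "s z"] bexI[of _ "push Nh s z w"]) auto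
  next
    fix l assume "\<exists>y\<in>pts Nh. \<exists>w'\<in>T10 Nh J y. pz y = z \<and> push Z pz y w' = w \<and>
       l = assoc_class act y (cext1 lam y w')"
    then show "l = assoc_class act (s z) (cext1 (alpha s) z w)"
      using assoc_class_cext1[OF assms(1)] assms(2) by auto
  qed
qed

lemma Lam_push:
  assumes "y \<in> pts Nh" "w \<in> T10 Nh J y"
  shows "Lam (pz y) (push Z pz y w) = assoc_class act y (cext1 lam y w)"
proof -
  obtain U s where s: "pz y \<in> U" "hol_section Nh J Z I pz U s" "s (pz y) = y"
    by (rule section_through[OF assms(1)])
  show ?thesis
    using Lam_section[OF s(2,1) hol_map_push_T10[OF atl acI hol_map_pz assms]]
      assoc_class_cext1[OF s(2) assms(1) s(1) assms(2)] by simp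
qed

lemma hol_form1_with_values_Lam:
  "hol_form1_with_values Z I (assoc_trivs Nh J act Z I pz) Lam"
  unfolding hol_form1_with_values_def assoc_trivs_def
  using alpha_hol Lam_section by blast

text \<open>All points y over z define the same zero class, so the choice of y in
  \<open>form_kernel\<close> is harmless and vanishing can be read off in any
  trivialization.\<close>

lemma form_kernel_section:
  assumes "hol_section Nh J Z I pz U s" "z \<in> U"
  shows "form_kernel Nh act Z I pz Lam z = {w \<in> T10 Z I z. cext1 (alpha s) z w = 0}"
proof -
  note s = sectionD[OF assms(1)]
  have zero: "assoc_class act y 0 = assoc_class act (s z) 0" if y: "y \<in> pts Nh" "pz y = z" for y
  proof -
    obtain x where "\<And>c. assoc_class act y (x\<^sup>2 * c) = assoc_class act (s (pz y)) c"
      by (rule assoc_class_section[OF assms(1) y(1)]) (use y assms in auto)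
    from this[of 0] show ?thesis using y by simp
  qed
  have "(\<exists>y\<in>pts Nh. pz y = z \<and> Lam z w = assoc_class act y 0) \<longleftrightarrow> cext1 (alpha s) z w = 0"
    if w: "w \<in> T10 Z I z" for w
    unfolding Lam_section[OF assms w]
    using zero assoc_class_inj[OF s(3)[OF assms(2)]] s(3,4)[OF assms(2)] by metis
  then show ?thesis unfolding form_kernel_def by blast
qed

text \<open>The local contact form is \<open>alpha s\<close> with differential
  \<open>beta s\<close>. The real statement \<open>beta_nondegenerate\<close> passes to type (1, 0)
  by \<open>c10\<close>, whose factors 2 and 4 do not affect vanishing.\<close>

lemma hol_contact_distribution_Lam:
  "hol_contact_distribution Z I (form_kernel Nh act Z I pz Lam)"
  unfolding hol_contact_distribution_def
proof
  fix z assume "z \<in> pts Z"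
  then obtain y where y: "y \<in> pts Nh" "z = pz y" by (rule pz_surj)
  obtain U s where U: "pz y \<in> U" and sec: "hol_section Nh J Z I pz U s"
    by (rule section_through[OF y(1)])
  note s = sectionD[OF sec]
  have "\<exists>w\<in>T10 Z I q. cext1 (alpha s) q w \<noteq> 0" if q: "q \<in> U" for q
  proof -
    obtain v where v: "v \<in> tspace Z q" "alpha s q v \<noteq> 0" using alpha_nz[OF sec q] by blast
    then show ?thesis
      using cext1_alpha[OF sec q v(1)] by (intro bexI[OF _ c10_T10[OF acI s(5)[OF q] v(1)]]) simp
  qed
  moreover have "w = (\<lambda>h. 0)"
    if q: "q \<in> U" and w: "w \<in> form_kernel Nh act Z I pz Lam q"
      and orth: "\<And>x. x \<in> form_kernel Nh act Z I pz Lam q \<Longrightarrow> cext2 (beta s) q w x = 0" for q w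
  proof -
    have wT: "w \<in> T10 Z I q" "cext1 (alpha s) q w = 0"
      using w by (auto simp: form_kernel_section[OF sec q])
    note w' = T10_eq_c10[OF wT(1)]
    have "re_vec w = tzero"
    proof (rule beta_nondegenerate[OF sec q w'(2)])
      have "cext1 (alpha s) q w = 2 * alpha s q (re_vec w)"
        using cext1_alpha[OF sec q w'(2)] w'(1) by simp
      then show "alpha s q (re_vec w) = 0" using wT(2) by simp
      fix v assume v: "v \<in> tspace Z q" "alpha s q v = 0"
      then have "c10 I q v \<in> form_kernel Nh act Z I pz Lam q"
        using c10_T10[OF acI s(5)[OF q] v(1)] cext1_alpha[OF sec q v(1)]
        by (simp add: form_kernel_section[OF sec q])
      from orth[OF this] have "cext2 (beta s) q (c10 I q (re_vec w)) (c10 I q v) = 0"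
        using w'(1) by simp
      then show "beta s q (re_vec w) v = 0" using cext2_beta[OF sec q w'(2) v(1)] by simp
    qed
    then have "w = c10 I q tzero" using w'(1) by simp
    then show ?thesis
      using almost_complex_tzero[OF acI s(5)[OF q]] by (simp add: c10_def tzero_def complex_eq_iff fun_eq_iff)
  qed
  ultimately show "\<exists>U \<alpha> \<beta>. z \<in> U \<and> hol_form1 Z I U \<alpha> \<and> has_ext_deriv Z U \<alpha> \<beta> \<and>
    (\<forall>q\<in>U. (\<exists>w\<in>T10 Z I q. cext1 \<alpha> q w \<noteq> 0) \<and>
       form_kernel Nh act Z I pz Lam q = {w \<in> T10 Z I q. cext1 \<alpha> q w = 0} \<and>
       (\<forall>w\<in>form_kernel Nh act Z I pz Lam q.
          (\<forall>x\<in>form_kernel Nh act Z I pz Lam q. cext2 \<beta> q w x = 0) \<longrightarrow> w = (\<lambda>h. 0)))"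
    using U y(2) alpha_hol[OF sec] alpha_ext_deriv[OF sec] form_kernel_section[OF sec]
    by (intro exI[of _ U] exI[of _ "alpha s"] exI[of _ "beta s"]) blast
qed

lemma cext2_K:
  assumes y: "y \<in> pts Nh" and w: "w \<in> T10 Nh J y"
  shows "cext2 \<Omega> y (part10 J K y) w = 2 * \<i> * cext1 lam y w"
proof -
  note w' = T10_eq_c10[OF w] and Ky = K[OF y]
  \<comment> \<open>The (1, 0)-part of K carries the factor 1/2 that \<open>c10\<close> lacks, hence
    it is \<open>c10\<close> of K/2.\<close>
  let ?u = "lincomb (1/2) (K y) 0 (K y)"
  have u: "?u \<in> tspace Nh y" by (rule lincomb_tspace[OF Ky Ky])
  have "part10 J K y = c10 J y ?u"
    unfolding part10_def c10_def almost_complex_lincomb[OF acJ y Ky Ky]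
    by (simp add: lincomb_def complex_eq_iff fun_eq_iff)
  moreover have "cext2 \<Omega> y (c10 J y ?u) (c10 J y (re_vec w)) = 4 * \<Omega> y ?u (re_vec w)"
    by (rule cext2_c10[OF acJ y u w'(2)]) (use \<Omega>_bilinear[OF y] \<Omega>_J[OF y] in auto)
  moreover have "\<Omega> y ?u (re_vec w) = \<i> * lam y (re_vec w)"
    using \<Omega>_bilinear[OF y Ky Ky w'(2), of "1/2" 0] varpi_K[OF y w'(2)] by (simp add: scaleR_conv_of_real)
  ultimately show ?thesis using w'(1) cext1_lam[OF y w] by simp
qed

text \<open>By \<open>cext2_K\<close> the condition defining the canonical distribution is
  \<lambda>(w) = 0 upstairs. A kernel vector is lifted by a section for one inclusion, and
  \<open>Lam_push\<close> gives the other.\<close>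

lemma form_kernel_eq_canonical:
  assumes "z \<in> pts Z"
  shows "form_kernel Nh act Z I pz Lam z = canonical_contact Nh gh Jh K Z pz z"
proof (intro equalityI subsetI)
  obtain y where y: "y \<in> pts Nh" "z = pz y" using assms by (rule pz_surj)
  obtain U s where "pz y \<in> U" and sec: "hol_section Nh J Z I pz U s"
    by (rule section_through[OF y(1)])
  then have z: "z \<in> U" using y by simp
  note s = sectionD[OF sec]
  fix w assume "w \<in> form_kernel Nh act Z I pz Lam z"
  then have w: "w \<in> T10 Z I z" "cext1 (alpha s) z w = 0" by (auto simp: form_kernel_section[OF sec z])
  note p = section_push_T10[OF sec z w(1)]
  have "assoc_class act (s z) (cext1 lam (s z) (push Nh s z w)) = assoc_class act (s z) 0"
    using assoc_class_cext1[OF sec s(3)[OF z] _ p(1)] p(2) s(4)[OF z] z w(2) by simp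
  then have "cext1 lam (s z) (push Nh s z w) = 0" by (rule assoc_class_inj[OF s(3)[OF z]])
  then have "cext2 \<Omega> (s z) (part10 J K (s z)) (push Nh s z w) = 0"
    using cext2_K[OF s(3)[OF z] p(1)] by simp
  then show "w \<in> canonical_contact Nh gh Jh K Z pz z"
    unfolding canonical_contact_def using p s(3,4)[OF z] by (intro CollectI exI[of _ "s z"]) metis
next
  fix x assume "x \<in> canonical_contact Nh gh Jh K Z pz z"
  then obtain y w where y: "y \<in> pts Nh" "pz y = z" and w: "w \<in> T10 Nh J y" and x: "x = push Z pz y w"
    and "cext2 \<Omega> y (part10 J K y) w = 0"
    by (auto simp: canonical_contact_def)
  then have "cext1 lam y w = 0" using cext2_K[OF y(1) w] by simp
  then have "Lam z x = assoc_class act y 0" using Lam_push[OF y(1) w] y x by simp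
  moreover from hol_map_push_T10[OF atl acI hol_map_pz y(1) w] have "x \<in> T10 Z I z" using x y by simp
  ultimately show "x \<in> form_kernel Nh act Z I pz Lam z"
    unfolding form_kernel_def using y by blast
qed

theorem contact_form:
  "hol_line_bundle Z I (assoc_total Nh act) (assoc_proj pz) (assoc_trivs Nh J act Z I pz) \<and>
    (\<exists>\<Lambda>. (\<forall>y\<in>pts Nh. \<forall>w\<in>T10 Nh J y.
             \<Lambda> (pz y) (push Z pz y w) = assoc_class act y (cext1 lam y w)) \<and>
         hol_form1_with_values Z I (assoc_trivs Nh J act Z I pz) \<Lambda> \<and>
         hol_contact_distribution Z I (form_kernel Nh act Z I pz \<Lambda>) \<and>
         (\<forall>z\<in>pts Z. form_kernel Nh act Z I pz \<Lambda> z = canonical_contact Nh gh Jh K Z pz z))"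
  using hol_line_bundle_assoc Lam_push hol_form1_with_values_Lam hol_contact_distribution_Lam
    form_kernel_eq_canonical by (intro conjI exI[of _ Lam]) auto

end


section \<open>The contact form on the HK cone\<close>

lemma bounded_bilinear_qmul: "bounded_bilinear qmul"
proof -
  have "bilinear qmul"
    unfolding bilinear_def linear_iff by (auto simp: algebra_simps)
  then show ?thesis by (simp add: bilinear_conv_bounded_bilinear)
qed

lemma bounded_linear_qconj: "bounded_linear qconj"
proof -
  have "linear qconj" unfolding linear_iff by auto
  then show ?thesis by (simp add: linear_conv_bounded_linear)
qed

lemma qmul_assoc: "qmul (qmul a b) c = qmul a (qmul b c)"
  by (cases a; cases b; cases c) (auto simp: algebra_simps)

lemma qconj_qmul: "qconj (qmul a b) = qmul (qconj b) (qconj a)"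
  by (cases a; cases b) (auto simp: algebra_simps)

lemmas qmul_bilinear_simps =
  bounded_bilinear.add_left[OF bounded_bilinear_qmul] bounded_bilinear.add_right[OF bounded_bilinear_qmul]
  bounded_bilinear.scaleR_left[OF bounded_bilinear_qmul] bounded_bilinear.scaleR_right[OF bounded_bilinear_qmul]
  bounded_bilinear.minus_left[OF bounded_bilinear_qmul] bounded_bilinear.minus_right[OF bounded_bilinear_qmul]
  bounded_bilinear.zero_left[OF bounded_bilinear_qmul] bounded_bilinear.zero_right[OF bounded_bilinear_qmul]

text \<open>Packs the i- and j-coefficients as the combination \<theta>1 + i \<theta>2 occurring in
  \<lambda>.\<close>

definition qij :: "quat \<Rightarrow> complex" where
  "qij x = Complex (qcomp 1 x) (qcomp 2 x)"

lemma bounded_linear_qij: "bounded_linear qij"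
proof -
  have "linear qij" unfolding linear_iff qij_def by (auto simp: complex_eq_iff)
  then show ?thesis by (simp add: linear_conv_bounded_linear)
qed

lemmas qij_linear_simps =
  linear_add[OF bounded_linear.linear[OF bounded_linear_qij]]
  linear_diff[OF bounded_linear.linear[OF bounded_linear_qij]]
  linear_neg[OF bounded_linear.linear[OF bounded_linear_qij]]
  linear_scale[OF bounded_linear.linear[OF bounded_linear_qij]]

text \<open>The imaginary unit of the action is the quaternion k: since k i = j, one has q = z + w i
  with the complex unit in z and w read as k, and left multiplication by x acts on both
  coordinates.\<close>

lemma q_act_eq_qmul: "q_act x q = qmul (Re x, 0, 0, Im x) q"
  by (cases q) (simp add: Let_def algebra_simps)

text \<open>For c in the span of 1 and k, i times the conjugate of c equals c i, and likewise for j.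
  So on the (i, j)-plane conjugation by c is multiplication by its square, and it preserves the span
  of 1 and k, which \<open>qij\<close> ignores. This is the source of the weight two.\<close>

lemma qij_conjugate: "qij (qmul (qmul (Re x, 0, 0, Im x) m) (qconj (Re x, 0, 0, Im x))) = x\<^sup>2 * qij m"
  by (cases m) (simp add: qij_def complex_eq_iff power2_eq_square algebra_simps)

text \<open>Infinitesimal form of \<open>qij_conjugate\<close>, differentiated at x = 1 in the
  direction of the imaginary unit.\<close>

lemma qij_commutator: "qij (qmul qk m) - qij (qmul m qk) = 2 * \<i> * qij m"
  by (cases m) (simp add: qij_def qk_def complex_eq_iff)

lemma qmul_qconj: "qmul q (qconj q) = (q \<bullet> q, 0, 0, 0)"
  by (cases q) (simp add: inner_prod_def algebra_simps)

lemma push_tzero: "push M' F p tzero = tzero"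
  by (auto simp: push_def tzero_def)

lemma smooth_at_open_mfd_ident:
  assumes "open S" "x \<in> S"
  shows "smooth_at (open_mfd S) x (\<lambda>r. r)"
  using smooth_chart.smooth_at_chart[OF open_mfd_chart[OF assms(1)] assms(2)] by (simp add: id_def)

locale cone_form =
  fixes D :: "('n, 'en::euclidean_space, 'p, 'ep::euclidean_space) hk"
    and Vt :: "'p \<Rightarrow> 'p tvec"
    and Nh :: "('h, 'eh::euclidean_space) mfd"
    and pt :: "quat \<times> 'p \<Rightarrow> 'h"
    and gh :: "('h, real) form2"
    and Jh :: "nat \<Rightarrow> 'h endo"
    and K :: "'h \<Rightarrow> 'h tvec"
    and act :: "complex \<Rightarrow> 'h \<Rightarrow> 'h"
    and lam :: "('h, complex) form1"
  assumes data: "hk_data D"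
    and cone: "hk_cone D Vt Nh pt gh Jh"
    and K: "vfield Nh (pts Nh) K"
    and K_pt: "\<forall>y\<in>pts (cone_mfd D). K (pt y) = push Nh pt y (e3_field D y)"
    and act: "hol_Cx_action Nh (Jh 3) act"
    and act_pt: "\<forall>(q, p)\<in>pts (cone_mfd D). \<forall>x. x \<noteq> 0 \<longrightarrow> act x (pt (q, p)) = pt (q_act x q, p)"
    and lam: "is_form1 Nh (pts Nh) lam"
    and lam_pt: "\<forall>y\<in>pts (cone_mfd D). \<forall>v\<in>tspace (cone_mfd D) y.
       lam (pt y) (push Nh pt y v) = Complex (lambda_cone D 1 y v) (lambda_cone D 2 y v)"
    and dlam: "has_ext_deriv Nh (pts Nh) lam (varpi gh Jh)"
begin

abbreviation "P \<equiv> hkP D"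
abbreviation "C \<equiv> cone_mfd D"

lemma atl: "smooth_atlas P" "smooth_atlas C" "smooth_atlas Nh" "smooth_atlas (open_mfd (- {0 :: quat}))"
proof -
  show 0: "smooth_atlas (open_mfd (- {0 :: quat}))" by (rule smooth_atlas_open_mfd) auto
  show P: "smooth_atlas P"
    using data smooth_manifold_imp_atlas by (auto simp: hk_data_def Let_def circle_bundle_def)
  show "smooth_atlas C" unfolding cone_mfd_def by (rule smooth_atlas_mprod[OF 0 P])
  show "smooth_atlas Nh"
    using cone smooth_manifold_imp_atlas by (auto simp: hk_cone_def pseudo_hyperkahler_def)
qed

lemma pts_C: "pts C = (- {0}) \<times> pts P"
  by (simp add: cone_mfd_def)

lemma pts_C_iff: "y \<in> pts C \<longleftrightarrow> fst y \<noteq> 0 \<and> snd y \<in> pts P"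
  by (simp add: pts_C mem_Times_iff)

lemma pt: "smooth_map_on C (pts C) Nh pt" "pt ` pts C = pts Nh"
  "y \<in> pts C \<Longrightarrow> push Nh pt y ` tspace C y = tspace Nh (pt y)"
  using cone by (auto simp: hk_cone_def space_of_integral_curves_def submersion_def)

lemma hkpi: "smooth_map_on P (pts P) (hkN D) (hkpi D)"
  using data by (simp add: hk_data_def Let_def circle_bundle_def)

lemma act_pt_eq:
  assumes "x \<in> pts C" "t \<noteq> 0"
  shows "act t (pt x) = pt (q_act t (fst x), snd x)"
  using bspec[OF act_pt assms(1)] assms(2) by (simp add: case_prod_unfold del: q_act.simps)

section \<open>The form on the cone in quaternionic terms\<close>

definition Theta :: "'p \<Rightarrow> 'p tvec \<Rightarrow> quat" where
  "Theta p u = (0, hk_theta D 1 p u, hk_theta D 2 p u, hk_theta D 3 p u)"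

text \<open>Removes the connection term of \<lambda> on vectors tangent to the quaternion factor,
  whose projection to \<open>P\<close> is zero.\<close>

lemma Theta_tzero:
  assumes "p \<in> pts P"
  shows "Theta p tzero = 0"
proof -
  let ?x = "hkpi D p"
  have x: "?x \<in> pts (hkN D)"
    by (rule smooth_map_on_pts(2)[OF hkpi assms])
  have V: "hkV D ?x \<in> tspace (hkN D) ?x"
    using data x by (auto simp: hk_data_def Let_def vfield_def)
  have hk: "pseudo_hyperkahler (hkN D) (hkg D) (hkJ D)"
    using data by (simp add: hk_data_def Let_def)
  have g0: "hkg D ?x u tzero = 0" if "u \<in> tspace (hkN D) ?x" for u
  proof -
    have "hkg D ?x u (lincomb 0 u 0 u) = 0"
      using hk x that by (simp add: pseudo_hyperkahler_def pseudo_riemannian_def is_tensor2_def)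
    then show ?thesis by (simp add: lincomb_0_0)
  qed
  have JV: "hkJ D a ?x (hkV D ?x) \<in> tspace (hkN D) ?x" if "a \<in> {1, 2, 3}" for a
    using hk that x V by (auto simp: pseudo_hyperkahler_def complex_structure_def almost_complex_def)
  have \<eta>: "hketa D p tzero = 0"
    using data assms form1_tzero by (auto simp: hk_data_def Let_def circle_connection_def)
  have "theta_P D a p tzero = 0" for a
    unfolding theta_P_def Let_def push_tzero hk_omega_def kahler_form_def
    using g0[OF JV] g0[OF V] \<eta> by auto
  then show ?thesis by (simp add: Theta_def hk_theta_def zero_prod_def)
qed

text \<open>The squared norm in \<open>lambda_cone\<close> cancels the one in \<open>qinv\<close>,
  leaving \<open>qconj\<close>. The expression becomes polynomial in q, and replacing q by c q turns
  the argument m of \<open>qij\<close> into \<open>qmul (qmul c m) (qconj c)\<close>.\<close>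

lemma lam_cone_eq:
  assumes y: "y \<in> pts C" and v: "v \<in> tspace C y"
  shows "lam (pt y) (push Nh pt y v) = hkf D (hkpi D (snd y)) *\<^sub>R
    qij (qmul (vapply v fst) (qconj (fst y)) +
      qmul (qmul (fst y) (Theta (snd y) (push P snd y v))) (qconj (fst y)))"
proof -
  have q: "fst y \<bullet> fst y \<noteq> 0" using y by (simp add: pts_C_iff)
  let ?m = "qmul (vapply v fst) (qconj (fst y)) +
      qmul (qmul (fst y) (Theta (snd y) (push P snd y v))) (qconj (fst y))"
  have "theta_cone D y v = (1 / (fst y \<bullet> fst y)) *\<^sub>R ?m"
    unfolding theta_cone_def Let_def qinv_def Theta_def by (simp add: qmul_bilinear_simps scaleR_add_right)
  moreover have "qcomp a (c *\<^sub>R m) = c * qcomp a m" for a c m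
    by (cases m) simp
  ultimately have "lambda_cone D a y v = hkf D (hkpi D (snd y)) * qcomp a ?m" for a
    using q by (simp add: lambda_cone_def)
  then show ?thesis using lam_pt y v by (simp add: qij_def complex_eq_iff)
qed

section \<open>Vectors tangent to the quaternion factor\<close>

lemma smooth_fst: "y \<in> pts C \<Longrightarrow> smooth_at C y fst"
  unfolding pts_C_iff unfolding cone_mfd_def
  by (rule smooth_at_fst[OF atl(4,1), of y "\<lambda>x. x"]) (auto intro: smooth_at_open_mfd_ident)

lemma smooth_map_snd: "smooth_map_on C (pts C) P snd"
  unfolding cone_mfd_def by (rule smooth_map_on_snd[OF atl(4,1) openin_pts_self])

lemma cone_chart:
  assumes "smooth_chart P W \<psi>"
  shows "smooth_chart C ((- {0}) \<times> W) (map_prod id \<psi>)"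
  unfolding cone_mfd_def by (rule mprod_chart[OF open_mfd_chart assms]) auto

lemma quat_vec_chart:
  assumes "smooth_chart P W \<psi>" "y \<in> (- {0}) \<times> W" "smooth_at C y h"
  shows "((\<lambda>r. h (r, snd y)) has_derivative
    (\<lambda>a. frechet_derivative (h \<circ> inv_into ((- {0}) \<times> W) (map_prod id \<psi>)) (at (map_prod id \<psi> y)) (a, 0))) (at (fst y))"
proof -
  interpret X: smooth_chart C "(- {0}) \<times> W" "map_prod id \<psi>" by (rule cone_chart[OF assms(1)])
  let ?h = "h \<circ> inv_into ((- {0}) \<times> W) (map_prod id \<psi>)"
  have 1: "((\<lambda>r. (r, \<psi> (snd y))) has_derivative (\<lambda>a. (a, 0))) (at (fst y))"
    by (auto intro!: derivative_eq_intros)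
  have 2: "(?h has_derivative frechet_derivative ?h (at (fst y, \<psi> (snd y)))) (at (fst y, \<psi> (snd y)))"
    using X.has_derivative_smooth_at[OF assms(2,3)] by (simp add: map_prod_def case_prod_unfold)
  have "((\<lambda>r. ?h (r, \<psi> (snd y))) has_derivative
      (\<lambda>a. frechet_derivative ?h (at (fst y, \<psi> (snd y))) (a, 0))) (at (fst y))"
    by (rule has_derivative_compose[OF 1 2])
  then have "((\<lambda>r. h (r, snd y)) has_derivative
      (\<lambda>a. frechet_derivative ?h (at (fst y, \<psi> (snd y))) (a, 0))) (at (fst y))"
  proof (rule has_derivative_transform_within_open[of _ _ _ _ "- {0}"])
    fix r :: quat assume "r \<in> - {0}"
    then show "?h (r, \<psi> (snd y)) = h (r, snd y)"
      using X.inv_chart[of "(r, snd y)"] assms(2) by auto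
  qed (use assms(2) in auto)
  then show ?thesis by (simp add: map_prod_def case_prod_unfold)
qed

text \<open>In a product chart a direction \<open>a\<close> of the first factor is the coordinate
  direction \<open>(a, 0)\<close>, so tangency follows from the general facts on
  \<open>cvec\<close>.\<close>

lemma quat_vec_eq_cvec:
  assumes "smooth_chart P W \<psi>" "y \<in> (- {0}) \<times> W"
  shows "quat_vec D y a = cvec C ((- {0}) \<times> W) (map_prod id \<psi>) (a, 0) y"
proof
  fix h
  show "quat_vec D y a h = cvec C ((- {0}) \<times> W) (map_prod id \<psi>) (a, 0) y h"
    using frechet_derivative_at[OF quat_vec_chart[OF assms, of h], symmetric]
    by (simp add: quat_vec_def cvec_def)
qed

lemma P_chart:
  assumes "y \<in> pts C"
  obtains W \<psi> where "smooth_chart P W \<psi>" "y \<in> (- {0}) \<times> W"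
proof -
  have "snd y \<in> pts P" using assms by (simp add: pts_C_iff)
  with atl(1) obtain W \<psi> where "(W, \<psi>) \<in> atlas P" "snd y \<in> W" by (rule smooth_atlasE)
  then show thesis
    using that[of W \<psi>] assms atl(1) by (simp add: smooth_chart_def pts_C_iff mem_Times_iff)
qed

lemma quat_vec_tspace:
  assumes "y \<in> pts C"
  shows "quat_vec D y a \<in> tspace C y"
proof -
  obtain W \<psi> where W: "smooth_chart P W \<psi>" "y \<in> (- {0}) \<times> W" by (rule P_chart[OF assms])
  show ?thesis
    unfolding quat_vec_eq_cvec[OF W] by (rule smooth_chart.cvec_tspace[OF cone_chart[OF W(1)] W(2)])
qed

lemma has_derivative_quat_vec:
  assumes "y \<in> pts C" "smooth_at C y h"
  shows "((\<lambda>r. h (r, snd y)) has_derivative (\<lambda>a. vapply (quat_vec D y a) h)) (at (fst y))"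
proof -
  obtain W \<psi> where W: "smooth_chart P W \<psi>" "y \<in> (- {0}) \<times> W" by (rule P_chart[OF assms(1)])
  show ?thesis
    unfolding quat_vec_eq_cvec[OF W] smooth_chart.vapply_cvec[OF cone_chart[OF W(1)] W(2) assms(2)]
    by (rule quat_vec_chart[OF W assms(2)])
qed

lemma quat_vec_fst:
  assumes "y \<in> pts C"
  shows "vapply (quat_vec D y a) fst = a"
proof -
  have "((\<lambda>r. r) has_derivative (\<lambda>a. vapply (quat_vec D y a) fst)) (at (fst y))"
    using has_derivative_quat_vec[OF assms smooth_fst[OF assms]] by simp
  from has_derivative_unique[OF this has_derivative_ident] show ?thesis by metis
qed

lemma quat_vec_snd:
  assumes "y \<in> pts C"
  shows "push P snd y (quat_vec D y a) = tzero"
proof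
  fix h
  show "push P snd y (quat_vec D y a) h = tzero h"
  proof (cases "smooth_at P (snd y) h")
    case True
    have "smooth_at C y (\<lambda>y. h (snd y))"
      by (rule smooth_at_comp[OF atl(2,1) smooth_map_snd assms True])
    then have "((\<lambda>r. h (snd y)) has_derivative (\<lambda>a. vapply (quat_vec D y a) (\<lambda>y. h (snd y)))) (at (fst y))"
      using has_derivative_quat_vec[OF assms] by fastforce
    from has_derivative_unique[OF this has_derivative_const]
    have "vapply (quat_vec D y a) (\<lambda>y. h (snd y)) = 0" by metis
    then show ?thesis by (simp add: push_def True tzero_def vapply_real comp_def)
  qed (simp add: push_def tzero_def)
qed

lemma lam_quat_vec:
  assumes "y \<in> pts C"
  shows "lam (pt y) (push Nh pt y (quat_vec D y a)) =
    hkf D (hkpi D (snd y)) *\<^sub>R qij (qmul a (qconj (fst y)))"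
proof -
  have "snd y \<in> pts P" using assms by (simp add: pts_C_iff)
  then show ?thesis
    unfolding lam_cone_eq[OF assms quat_vec_tspace[OF assms]] quat_vec_snd[OF assms]
      quat_vec_fst[OF assms] by (simp add: Theta_tzero qmul_bilinear_simps)
qed

text \<open>The field has direction k q and no component along \<open>P\<close>; k q times the
  conjugate of q is a real multiple of k, without i- and j-part.\<close>

lemma lam_e3:
  assumes "y \<in> pts C"
  shows "lam (pt y) (push Nh pt y (e3_field D y)) = 0"
proof -
  have "qij (qmul (qmul qk (fst y)) (qconj (fst y))) = 0"
    unfolding qmul_assoc qmul_qconj by (simp add: qk_def qij_def complex_eq_iff)
  then show ?thesis by (simp add: e3_field_def lam_quat_vec[OF assms])
qed

lemma pt_surj:
  assumes "y \<in> pts Nh"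
  obtains x where "x \<in> pts C" "y = pt x"
  using pt(2) assms by blast

lemma lam_nonzero:
  assumes "y \<in> pts Nh"
  shows "\<exists>v\<in>tspace Nh y. lam y v \<noteq> 0"
proof -
  obtain x where x: "x \<in> pts C" "y = pt x" by (rule pt_surj[OF assms])
  have "fst x \<bullet> fst x \<noteq> 0" using x by (simp add: pts_C_iff)
  moreover have "hkf D (hkpi D (snd x)) \<noteq> 0"
  proof -
    have "hkpi D (snd x) \<in> pts (hkN D)"
      by (rule smooth_map_on_pts(2)[OF hkpi]) (use x(1) in \<open>auto simp: pts_C_iff\<close>)
    then show ?thesis using data by (simp add: hk_data_def Let_def)
  qed
  \<comment> \<open>The witness is the direction i q: times the conjugate of q it gives i scaled by
    the squared norm, so \<lambda> takes the value f times that norm.\<close>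
  moreover have "qij (qmul (qmul (0, 1, 0, 0) (fst x)) (qconj (fst x))) = complex_of_real (fst x \<bullet> fst x)"
    unfolding qmul_assoc qmul_qconj by (simp add: qij_def complex_eq_iff)
  ultimately have "lam (pt x) (push Nh pt x (quat_vec D x (qmul (0, 1, 0, 0) (fst x)))) \<noteq> 0"
    unfolding lam_quat_vec[OF x(1)] by simp
  then show ?thesis
    using push_tspace[OF atl(2,3) pt(1) x(1) quat_vec_tspace[OF x(1)]] x(2) by blast
qed

text \<open>The chart components k q are linear in q. A chart domain suffices, as the field is only
  bracketed with coordinate fields there.\<close>

lemma vfield_e3:
  assumes "smooth_chart P W \<psi>"
  shows "vfield C ((- {0}) \<times> W) (e3_field D)"
proof -
  interpret X: smooth_chart C "(- {0}) \<times> W" "map_prod id \<psi>" by (rule cone_chart[OF assms])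
  show ?thesis
    unfolding vfield_def
  proof (intro conjI ballI allI impI X.openin_U)
    fix y :: "quat \<times> 'p" assume y: "y \<in> (- {0}) \<times> W"
    then have yC: "y \<in> pts C" using X.U_pts by auto
    show "e3_field D y \<in> tspace C y" unfolding e3_field_def by (rule quat_vec_tspace[OF yC])
    fix h :: "quat \<times> 'p \<Rightarrow> real" assume h: "smooth_at C y h"
    have e: "e3_field D x h = (\<Sum>b\<in>Basis. ((qmul qk (fst x), 0) \<bullet> b) *
        cvec C ((- {0}) \<times> W) (map_prod id \<psi>) b x h)" if x: "x \<in> (- {0}) \<times> W" for x
    proof -
      have "linear (\<lambda>e. cvec C ((- {0}) \<times> W) (map_prod id \<psi>) e x h)"
        by (rule X.linear_cvec[OF x, of "\<lambda>v. v h"]) (simp add: lincomb_def)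
      from linear_euclidean_sum[OF this, of "(qmul qk (fst x), 0)"] show ?thesis
        unfolding e3_field_def quat_vec_eq_cvec[OF assms x] by simp
    qed
    have "bounded_linear (\<lambda>r. (qmul qk r, 0 :: 'ep) \<bullet> b)" for b
      by (intro bounded_linear_intros bounded_linear_inner_left_comp bounded_linear_Pair
          bounded_bilinear.bounded_linear_right[OF bounded_bilinear_qmul] bounded_linear_zero)
    from smooth_at_linear_comp[OF atl(2) this smooth_fst[OF yC]]
    have "smooth_at C y (\<lambda>x. \<Sum>b\<in>Basis. ((qmul qk (fst x), 0) \<bullet> b) *
        cvec C ((- {0}) \<times> W) (map_prod id \<psi>) b x h)"
      by (intro smooth_at_sum[OF atl(2) yC] smooth_at_bilinear[OF atl(2) bounded_bilinear_mult]
          vfield_smooth[OF X.vfield_cvec y h])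
    then show "smooth_at C y (\<lambda>x. e3_field D x h)"
      by (rule smooth_at_cong_imp[OF atl(2) X.openin_U y, rotated]) (use e in auto)
  qed
qed

lemma pullback_ext:
  "is_form1 C (pts C) (\<lambda>y v. lam (pt y) (push Nh pt y v))"
  "has_ext_deriv C (pts C) (\<lambda>y v. lam (pt y) (push Nh pt y v))
     (\<lambda>y u v. varpi gh Jh (pt y) (push Nh pt y u) (push Nh pt y v))"
proof -
  show "is_form1 C (pts C) (\<lambda>y v. lam (pt y) (push Nh pt y v))"
    by (rule pullback_form1[OF atl(2,3) pt(1) lam])
  have hk: "pseudo_hyperkahler Nh gh Jh" using cone by (simp add: hk_cone_def)
  show "has_ext_deriv C (pts C) (\<lambda>y v. lam (pt y) (push Nh pt y v))
     (\<lambda>y u v. varpi gh Jh (pt y) (push Nh pt y u) (push Nh pt y v))"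
    by (rule pullback_ext_deriv[OF atl(2,3) pt(1) lam dlam varpi_bilinear[OF hk]])
qed

text \<open>Coordinate fields \<open>Y\<close> of a product chart have constant \<open>\<H>\<close>-component, so their brackets with
  \<open>e\<^sub>3 = k q\<close> are explicit. If \<open>\<lambda>(Y)\<close> is the \<open>(i, j)\<close>-part of \<open>m\<close>, then \<open>d\<lambda>(e\<^sub>3, Y)\<close> is that of the
  commutator \<open>k m - m k\<close>.\<close>

lemma varpi_e3:
  assumes y: "y \<in> pts C" and v: "v \<in> tspace C y"
  shows "varpi gh Jh (pt y) (push Nh pt y (e3_field D y)) (push Nh pt y v) =
    2 * \<i> * lam (pt y) (push Nh pt y v)"
proof -
  obtain W \<psi> where W: "smooth_chart P W \<psi>" "y \<in> (- {0}) \<times> W" by (rule P_chart[OF y])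
  interpret X: smooth_chart C "(- {0}) \<times> W" "map_prod id \<psi>" by (rule cone_chart[OF W(1)])
  interpret W: smooth_chart P W \<psi> by (rule W(1))
  define e where "e = vapply v (map_prod id \<psi>)"
  define Y where "Y = cvec C ((- {0}) \<times> W) (map_prod id \<psi>) e"
  define L where "L x u = lam (pt x) (push Nh pt x u)" for x u
  define f where "f = hkf D (hkpi D (snd y))"
  define q where "q = fst y"
  define \<Theta> where "\<Theta> = Theta (snd y) (cvec P W \<psi> (snd e) (snd y))"
  note XC = X.U_pts
  have Yv: "Y y = v" unfolding Y_def e_def by (rule X.tspace_eq_cvec[OF W(2) v, symmetric])
  have Yt: "Y x \<in> tspace C x" if "x \<in> (- {0}) \<times> W" for x
    unfolding Y_def by (rule X.cvec_tspace[OF that])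
  have Ye: "vapply (Y x) (map_prod id \<psi>) = e" if "x \<in> (- {0}) \<times> W" for x
    unfolding Y_def by (rule X.vapply_cvec_chart[OF that])
  have Yfst: "vapply (Y x) fst = fst e" if "x \<in> (- {0}) \<times> W" for x
    using vapply_linear[OF atl(2) Yt[OF that] bounded_linear_fst X.smooth_at_chart[OF that]] Ye[OF that]
    by simp
  have Ysnd: "vapply (Y x) (\<lambda>x. \<psi> (snd x)) = snd e" if "x \<in> (- {0}) \<times> W" for x
    using vapply_linear[OF atl(2) Yt[OF that] bounded_linear_snd X.smooth_at_chart[OF that]] Ye[OF that]
    by simp
  have vsnd: "vapply (push P snd x u) \<psi> = vapply u (\<lambda>x. \<psi> (snd x))" if "x \<in> (- {0}) \<times> W" for x u
    by (rule vapply_push[where F = snd, OF atl(1) W.smooth_at_chart]) (use that in auto)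
  have Ypush: "push P snd x (Y x) = cvec P W \<psi> (snd e) (snd x)" if x: "x \<in> (- {0}) \<times> W" for x
  proof -
    have xW: "snd x \<in> W" using x by auto
    have t: "push P snd x (Y x) \<in> tspace P (snd x)"
      using push_tspace[OF atl(2,1) smooth_map_snd _ Yt[OF x]] XC x by auto
    show ?thesis using W.tspace_eq_cvec[OF xW t] by (simp add: vsnd[OF x] Ysnd[OF x])
  qed
  \<comment> \<open>On the slice where only the quaternion moves, the coordinate field has fixed
    quaternion part \<open>fst e\<close> and fixed projection to \<open>P\<close>. Hence
    \<lambda>(Y) is an explicit polynomial in \<open>r\<close> that can be differentiated in the
    direction k q.\<close>
  have LY: "L (r, snd y) (Y (r, snd y)) = f *\<^sub>R qij (qmul (fst e) (qconj r) + qmul (qmul r \<Theta>) (qconj r))"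
    if "r \<noteq> 0" for r
  proof -
    have x: "(r, snd y) \<in> (- {0}) \<times> W" using that W(2) by auto
    show ?thesis
      using lam_cone_eq[OF _ Yt[OF x]] XC x
      by (auto simp: L_def f_def \<Theta>_def Yfst[OF x] Ypush[OF x])
  qed
  note vX = vfield_e3[OF W(1)] and vY = X.vfield_cvec[of e, folded Y_def]
  have smL: "smooth_at C y (\<lambda>x. L x (Y x))"
    unfolding L_def by (rule form1_smooth[OF pullback_ext(1) vY XC W(2)])
  have qC: "q \<noteq> 0" using W(2) by (auto simp: q_def)
  have 1: "vapply (e3_field D y) (\<lambda>x. L x (Y x)) = f *\<^sub>R qij (qmul (fst e) (qconj (qmul qk q)) +
      (qmul (qmul q \<Theta>) (qconj (qmul qk q)) + qmul (qmul (qmul qk q) \<Theta>) (qconj q)))"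
  proof -
    have "((\<lambda>r. L (r, snd y) (Y (r, snd y))) has_derivative
        (\<lambda>a. vapply (quat_vec D y a) (\<lambda>x. L x (Y x)))) (at q)"
      using has_derivative_quat_vec[OF y smL] by (simp add: q_def)
    then have A: "((\<lambda>r. f *\<^sub>R qij (qmul (fst e) (qconj r) + qmul (qmul r \<Theta>) (qconj r))) has_derivative
        (\<lambda>a. vapply (quat_vec D y a) (\<lambda>x. L x (Y x)))) (at q)"
      by (rule has_derivative_transform_within_open[of _ _ _ _ "- {0}"]) (use LY qC in auto)
    note cj = bounded_linear.has_derivative[OF bounded_linear_qconj has_derivative_ident]
    have B: "((\<lambda>r. f *\<^sub>R qij (qmul (fst e) (qconj r) + qmul (qmul r \<Theta>) (qconj r))) has_derivative
        (\<lambda>a. f *\<^sub>R qij (qmul (fst e) (qconj a) + (qmul (qmul q \<Theta>) (qconj a) + qmul (qmul a \<Theta>) (qconj q))))) (at q)"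
      by (intro has_derivative_scaleR_right bounded_linear.has_derivative[OF bounded_linear_qij]
          has_derivative_add bounded_linear.has_derivative[OF bounded_bilinear.bounded_linear_right[OF bounded_bilinear_qmul]]
          bounded_bilinear.FDERIV[OF bounded_bilinear_qmul]
          bounded_linear.has_derivative[OF bounded_bilinear.bounded_linear_left[OF bounded_bilinear_qmul]]
          cj has_derivative_ident)
    show ?thesis
      unfolding e3_field_def using fun_cong[OF has_derivative_unique[OF A B]] by (simp add: q_def)
  qed
  have 2: "vapply (Y y) (\<lambda>x. L x (e3_field D x)) = 0"
  proof -
    have "vapply (Y y) (\<lambda>x. L x (e3_field D x)) = vapply (Y y) (\<lambda>x. 0 :: complex)"
      by (rule vapply_cong[OF atl(2) Yt[OF W(2)] X.openin_U W(2)]) (use lam_e3 XC L_def in auto)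
    then show ?thesis using vapply_const[OF atl(2) y Yt[OF W(2)]] by simp
  qed
  let ?B = "bracket C (e3_field D) Y y"
  have Bt: "?B \<in> tspace C y" by (rule bracket_tspace[OF atl(2) vX vY W(2)])
  have Xt: "e3_field D y \<in> tspace C y" by (rule vfield_tspace[OF vX W(2)])
  have Bfst: "vapply ?B fst = - qmul qk (fst e)"
  proof -
    have "vapply (e3_field D y) (\<lambda>x. vapply (Y x) fst) = vapply (e3_field D y) (\<lambda>x. fst e)"
      by (rule vapply_cong[OF atl(2) Xt X.openin_U W(2)]) (rule Yfst)
    also have "\<dots> = 0" by (rule vapply_const[OF atl(2) y Xt])
    finally have a: "vapply (e3_field D y) (\<lambda>x. vapply (Y x) fst) = 0" .
    have "vapply (Y y) (\<lambda>x. vapply (e3_field D x) fst) = vapply (Y y) (\<lambda>x. qmul qk (fst x))"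
      by (rule vapply_cong[OF atl(2) Yt[OF W(2)] X.openin_U W(2)])
        (simp add: e3_field_def quat_vec_fst[OF subsetD[OF XC]])
    also have "\<dots> = qmul qk (vapply (Y y) fst)"
      by (rule vapply_linear[OF atl(2) Yt[OF W(2)]
            bounded_bilinear.bounded_linear_right[OF bounded_bilinear_qmul] smooth_fst[OF y]])
    finally show ?thesis
      unfolding vapply_bracket[OF atl(2) smooth_fst[OF y]] a by (simp add: Yfst[OF W(2)])
  qed
  have Bsnd: "push P snd y ?B = tzero"
  proof -
    have sm: "smooth_at C y (\<lambda>x. \<psi> (snd x))"
      by (rule smooth_at_comp[OF atl(2,1) smooth_map_snd y W.smooth_at_chart]) (use W(2) in auto)
    have "vapply (e3_field D y) (\<lambda>x. vapply (Y x) (\<lambda>x. \<psi> (snd x))) = vapply (e3_field D y) (\<lambda>x. snd e)"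
      by (rule vapply_cong[OF atl(2) Xt X.openin_U W(2)]) (rule Ysnd)
    also have "\<dots> = 0" by (rule vapply_const[OF atl(2) y Xt])
    finally have a: "vapply (e3_field D y) (\<lambda>x. vapply (Y x) (\<lambda>x. \<psi> (snd x))) = 0" .
    have "vapply (Y y) (\<lambda>x. vapply (e3_field D x) (\<lambda>x. \<psi> (snd x))) = vapply (Y y) (\<lambda>x. 0)"
    proof (rule vapply_cong[OF atl(2) Yt[OF W(2)] X.openin_U W(2)])
      fix x :: "quat \<times> 'p" assume x: "x \<in> (- {0}) \<times> W"
      then have "push P snd x (e3_field D x) = tzero"
        unfolding e3_field_def using quat_vec_snd XC by blast
      then show "vapply (e3_field D x) (\<lambda>x. \<psi> (snd x)) = 0"
        using vsnd[OF x, of "e3_field D x"] by simp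
    qed
    also have "\<dots> = 0" by (rule vapply_const[OF atl(2) y Yt[OF W(2)]])
    finally have "vapply (push P snd y ?B) \<psi> = 0"
      unfolding vsnd[OF W(2)] vapply_bracket[OF atl(2) sm] a by simp
    then show ?thesis
      using W.tspace_eqI[OF _ push_tspace[OF atl(2,1) smooth_map_snd y Bt] tzero_tspace] W(2) by auto
  qed
  have 3: "L y ?B = f *\<^sub>R qij (qmul (- qmul qk (fst e)) (qconj q))"
  proof -
    have "snd y \<in> pts P" using y by (simp add: pts_C_iff)
    then show ?thesis
      unfolding L_def lam_cone_eq[OF y Bt] Bfst Bsnd f_def q_def
      by (simp add: Theta_tzero qmul_bilinear_simps)
  qed
  define m where "m = qmul (fst e) (qconj q) + qmul (qmul q \<Theta>) (qconj q)"
  have Lv: "L y v = f *\<^sub>R qij m"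
    using LY[OF qC] Yv by (simp add: q_def m_def)
  \<comment> \<open>Conjugation reverses products and k is imaginary; the sign is what produces a
    commutator.\<close>
  have ck: "qconj (qmul qk a) = - qmul (qconj a) qk" for a
    unfolding qconj_qmul by (simp add: qk_def bounded_bilinear.minus_right[OF bounded_bilinear_qmul, symmetric])
  have "varpi gh Jh (pt y) (push Nh pt y (e3_field D y)) (push Nh pt y (Y y)) =
      vapply (e3_field D y) (\<lambda>x. L x (Y x)) - vapply (Y y) (\<lambda>x. L x (e3_field D x)) - L y ?B"
    unfolding L_def by (rule has_ext_derivD[OF pullback_ext(2) XC vX vY W(2)])
  \<comment> \<open>The derivative of \<lambda>(Y) gives - m k and the \<Theta>-part of k m; the
    bracket term, subtracted with its own minus sign, supplies the remaining part k
    \<open>fst e\<close> of k m.\<close>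
  also have "\<dots> = f *\<^sub>R (qij (qmul qk m) - qij (qmul m qk))"
    unfolding 1 2 3 m_def ck
    by (simp add: qmul_bilinear_simps qij_linear_simps qmul_assoc scaleR_add_right scaleR_diff_right)
  also have "\<dots> = 2 * \<i> * L y v"
    unfolding qij_commutator Lv by (simp add: scaleR_conv_of_real)
  finally show ?thesis unfolding Yv L_def .
qed

lemma varpi_K:
  assumes "y \<in> pts Nh" "v \<in> tspace Nh y"
  shows "varpi gh Jh y (K y) v = 2 * \<i> * lam y v"
proof -
  obtain x where x: "x \<in> pts C" "y = pt x" by (rule pt_surj[OF assms(1)])
  obtain u where "u \<in> tspace C x" "v = push Nh pt x u"
    using pt(3)[OF x(1)] assms(2) x(2) by blast
  then show ?thesis using varpi_e3[OF x(1)] K_pt x by simp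
qed

text \<open>The action lifts to the cone as left multiplication \<open>Q\<close> of the quaternion
  by \<open>c\<close>, leaving \<open>P\<close> alone. By \<open>lam_cone_eq\<close> this conjugates
  the argument of \<open>qij\<close> by \<open>c\<close>, and \<open>qij_conjugate\<close> yields
  the square; surjectivity of the differential of \<open>pt\<close> supplies lifts of all
  vectors.\<close>

lemma lam_act:
  assumes t: "t \<noteq> 0" and y: "y \<in> pts Nh" and w: "w \<in> tspace Nh y"
  shows "lam (act t y) (push Nh (act t) y w) = t\<^sup>2 * lam y w"
proof -
  obtain x where x: "x \<in> pts C" "y = pt x" by (rule pt_surj[OF y])
  obtain v where v: "v \<in> tspace C x" "w = push Nh pt x v"
    using pt(3)[OF x(1)] w x(2) by blast
  define c where "c = (Re t, 0 :: real, 0 :: real, Im t)"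
  define Q where "Q = (\<lambda>x :: quat \<times> 'p. (q_act t (fst x), snd x))"
  have Q: "Q = (\<lambda>x. (qmul c (fst x), snd x))" by (simp add: Q_def c_def q_act_eq_qmul)
  note lin = bounded_bilinear.bounded_linear_right[OF bounded_bilinear_qmul, of c]
  have sm: "smooth_at C x (\<lambda>x. qmul c (fst x))" if "x \<in> pts C" for x
    by (rule smooth_at_linear_comp[OF atl(2) lin smooth_fst[OF that]])
  \<comment> \<open>The conjugate of \<open>c\<close> times \<open>c\<close> is the squared modulus
    of \<open>t\<close>, so multiplication by \<open>c\<close> is injective and \<open>Q\<close>
    stays in the cone.\<close>
  have nz: "qmul c r \<noteq> 0" if "r \<noteq> 0" for r
  proof
    assume "qmul c r = 0"
    then have "qmul (qmul (qconj c) c) r = 0" by (simp add: qmul_assoc qmul_bilinear_simps)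
    moreover have "qmul (qconj c) c = (Re t ^ 2 + Im t ^ 2, 0, 0, 0)"
      by (simp add: c_def power2_eq_square)
    moreover have "qmul (s, 0, 0, 0) r = s *\<^sub>R r" for s by (cases r) simp
    ultimately show False
      using that t by (simp add: complex_eq_iff sum_power2_eq_zero_iff)
  qed
  have "smooth_map_on C (pts C) (open_mfd (- {0})) (\<lambda>x. qmul c (fst x))"
    by (rule smooth_map_on_open_mfd[OF atl(2)]) (use sm nz in \<open>auto simp: pts_C_iff\<close>)
  from smooth_map_on_Pair[OF atl(2) this smooth_map_snd]
  have Qs: "smooth_map_on C (pts C) C Q" unfolding Q cone_mfd_def .
  have Qx: "Q x \<in> pts C" by (rule smooth_map_on_pts(2)[OF Qs x(1)])
  have actpt: "act t (pt x) = pt (Q x)" if "x \<in> pts C" for x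
    using act_pt_eq[OF that t] by (simp add: Q_def)
  let ?v = "push C Q x v"
  have v': "?v \<in> tspace C (Q x)" by (rule push_tspace[OF atl(2,2) Qs x(1) v(1)])
  have as: "smooth_map_on Nh (pts Nh) Nh (act t)"
    using act t hol_map_onD(1) unfolding hol_Cx_action_def by blast
  have "push Nh (act t) (pt x) (push Nh pt x v) = push Nh (\<lambda>x. act t (pt x)) x v"
    using push_push[OF atl(3,3) as, of pt x v] y x(2) by simp
  also have "\<dots> = push Nh (\<lambda>x. pt (Q x)) x v"
    by (rule push_cong[OF atl(2) v(1) openin_pts_self x(1)]) (rule actpt)
  also have "\<dots> = push Nh pt (Q x) ?v"
    by (rule push_push[where F = Q, OF atl(2,3) pt(1) Qx, symmetric])
  finally have "lam (act t y) (push Nh (act t) y w) = lam (pt (Q x)) (push Nh pt (Q x) ?v)"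
    using actpt[OF x(1)] x(2) v(2) by simp
  also have "\<dots> = t\<^sup>2 * lam (pt x) (push Nh pt x v)"
  proof -
    have "vapply ?v fst = vapply v (\<lambda>x. fst (Q x))"
      by (rule vapply_push[where F = Q, OF atl(2) smooth_fst[OF Qx]])
    also have "\<dots> = qmul c (vapply v fst)"
      using vapply_linear[OF atl(2) v(1) lin smooth_fst[OF x(1)]] by (simp add: Q)
    finally have 1: "vapply ?v fst = qmul c (vapply v fst)" .
    have 2: "push P snd (Q x) ?v = push P snd x v"
      using push_push[where F = Q, OF atl(2,1) smooth_map_snd Qx, of v] by (simp add: Q)
    have 3: "fst (Q x) = qmul c (fst x)" "snd (Q x) = snd x" by (simp_all add: Q)
    define m where "m = qmul (vapply v fst) (qconj (fst x)) +
      qmul (qmul (fst x) (Theta (snd x) (push P snd x v))) (qconj (fst x))"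
    have "lam (pt (Q x)) (push Nh pt (Q x) ?v) = hkf D (hkpi D (snd x)) *\<^sub>R
      qij (qmul (qmul c m) (qconj c))"
      unfolding lam_cone_eq[OF Qx v'] 1 2 3 m_def qconj_qmul
      by (simp add: qmul_bilinear_simps qmul_assoc)
    also have "\<dots> = t\<^sup>2 * (hkf D (hkpi D (snd x)) *\<^sub>R qij m)"
      unfolding c_def qij_conjugate by simp
    finally show ?thesis unfolding lam_cone_eq[OF x(1) v(1)] m_def .
  qed
  finally show ?thesis using x(2) v(2) by simp
qed

text \<open>\<open>K\<close> is the velocity of the unit circle inside the acting group, and
  \<open>pz\<close> is constant along orbits. The computation is done on the cone, where the circle
  orbit is an explicit curve with velocity \<open>e3_field\<close>.\<close>

lemma K_vertical:
  assumes Z: "complex_quotient Nh (Jh 3) act Z I pz" and y: "y \<in> pts Nh"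
  shows "push Z pz y (K y) = tzero"
proof
  fix h
  obtain x where x: "x \<in> pts C" "y = pt x" by (rule pt_surj[OF y])
  have pz: "smooth_map_on Nh (pts Nh) Z pz" and Za: "smooth_atlas Z"
    using Z hol_map_onD(1) smooth_manifold_imp_atlas unfolding complex_quotient_def by blast+
  show "push Z pz y (K y) h = tzero h"
  proof (cases "smooth_at Z (pz y) h")
    case True
    define H where "H = (\<lambda>x. h (pz (pt x)))"
    have sN: "smooth_at Nh y (\<lambda>y. h (pz y))" by (rule smooth_at_comp[OF atl(3) Za pz y True])
    have sH: "smooth_at C x H"
      unfolding H_def by (rule smooth_at_comp[OF atl(2,3) pt(1) x(1)]) (use sN x(2) in simp)
    \<comment> \<open>This is exp(t k) q, the lift to the cone of the action of
      \<open>cis t\<close>.\<close>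
    define c where "c t = cos t *\<^sub>R fst x + sin t *\<^sub>R qmul qk (fst x)" for t :: real
    have c: "c t = q_act (cis t) (fst x)" for t
      unfolding q_act_eq_qmul by (cases "fst x") (simp add: c_def qk_def)
    have c0: "c 0 = fst x" by (simp add: c_def)
    have "H (c t, snd x) = h (pz y)" for t
    proof -
      have "pt (c t, snd x) = act (cis t) (pt x)"
        using act_pt_eq[OF x(1) cis_neq_zero] by (simp add: c)
      moreover have "act (cis t) y \<in> pts Nh"
        using act hol_map_onD(1) smooth_map_on_pts(2) y cis_neq_zero[of t] unfolding hol_Cx_action_def by metis
      then have "pz y = pz (act (cis t) y)"
        using Z y cis_neq_zero[of t] unfolding complex_quotient_def by blast
      ultimately show ?thesis by (simp add: H_def x(2))
    qed
    then have A: "((\<lambda>t. H (c t, snd x)) has_derivative (\<lambda>s. 0)) (at 0)" by simp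
    have "(c has_derivative (\<lambda>s. s *\<^sub>R qmul qk (fst x))) (at 0)"
      unfolding c_def by (auto intro!: derivative_eq_intros)
    from has_derivative_compose[OF this, of "\<lambda>r. H (r, snd x)"] has_derivative_quat_vec[OF x(1) sH]
    have "((\<lambda>t. H (c t, snd x)) has_derivative (\<lambda>s. vapply (quat_vec D x (s *\<^sub>R qmul qk (fst x))) H)) (at 0)"
      by (simp add: c0)
    from fun_cong[OF has_derivative_unique[OF this A], of 1]
    have "e3_field D x H = 0" by (simp add: e3_field_def vapply_real)
    then show ?thesis
      using K_pt x True sN by (simp add: push_def tzero_def comp_def H_def)
  qed (simp add: push_def tzero_def)
qed

lemma twistor_quotient_cone:
  assumes "complex_quotient Nh (Jh 3) act Z I pz"
  shows "twistor_quotient Nh gh Jh K act lam Z I pz"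
proof
  show "pseudo_hyperkahler Nh gh Jh" using cone by (simp add: hk_cone_def)
qed (use act lam dlam assms K lam_act varpi_K lam_nonzero K_vertical vfield_tspace in auto)

end

theorem proposition4p4:
  fixes D :: "('n, 'en::euclidean_space, 'p, 'ep::euclidean_space) hk"
    and Vt :: "'p \<Rightarrow> 'p tvec"
    and Nh :: "('h, 'eh::euclidean_space) mfd"
    and pt :: "quat \<times> 'p \<Rightarrow> 'h"
    and gh :: "('h, real) form2"
    and Jh :: "nat \<Rightarrow> 'h endo"
    and K :: "'h \<Rightarrow> 'h tvec"
    and act :: "complex \<Rightarrow> 'h \<Rightarrow> 'h"
    and lam :: "('h, complex) form1"
    and Z :: "('z, 'ez::euclidean_space) mfd"
    and I :: "'z endo"
    and pz :: "'h \<Rightarrow> 'z"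
  assumes "hk_data D"
    and "horizontal_lift D Vt"
    and "hk_cone D Vt Nh pt gh Jh"
    and "vfield Nh (pts Nh) K"
    and "\<forall>y\<in>pts (cone_mfd D). K (pt y) = push Nh pt y (e3_field D y)"
    and "hol_Cx_action Nh (Jh 3) act"
    and "\<forall>(q, p)\<in>pts (cone_mfd D). \<forall>x. x \<noteq> 0 \<longrightarrow> act x (pt (q, p)) = pt (q_act x q, p)"
    and "is_form1 Nh (pts Nh) lam"
    and "\<forall>y\<in>pts (cone_mfd D). \<forall>v\<in>tspace (cone_mfd D) y.
           lam (pt y) (push Nh pt y v) = Complex (lambda_cone D 1 y v) (lambda_cone D 2 y v)"
    and "has_ext_deriv Nh (pts Nh) lam (varpi gh Jh)"
    and "complex_quotient Nh (Jh 3) act Z I pz"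
  shows "hol_line_bundle Z I (assoc_total Nh act) (assoc_proj pz) (assoc_trivs Nh (Jh 3) act Z I pz) \<and>
    (\<exists>\<Lambda>. (\<forall>y\<in>pts Nh. \<forall>w\<in>T10 Nh (Jh 3) y.
             \<Lambda> (pz y) (push Z pz y w) = assoc_class act y (cext1 lam y w)) \<and>
         hol_form1_with_values Z I (assoc_trivs Nh (Jh 3) act Z I pz) \<Lambda> \<and>
         hol_contact_distribution Z I (form_kernel Nh act Z I pz \<Lambda>) \<and>
         (\<forall>z\<in>pts Z. form_kernel Nh act Z I pz \<Lambda> z = canonical_contact Nh gh Jh K Z pz z))"
proof -
  interpret cone_form D Vt Nh pt gh Jh K act lam
    by unfold_locales fact+
  interpret twistor_quotient Nh gh Jh K act lam Z I pz
    by (rule twistor_quotient_cone) fact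
  show ?thesis by (rule contact_form)
qed

end
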